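(* Let $k\geq 2$ be a fixed integer and define $D_{k,\omega}(n) := \dfrac{d(n)}{k^{\omega(n)}}$. Then, for all $x\geq 1$ sufficiently large, \[ \sum_{n\leq x}D_{k,\omega}(n) = \frac{x(\log x)^{2/k-1}}{\Gamma(2/k)}\prod_{p}\Bigl(1-\frac{1}{p}\Bigr)^{2/k}\Bigl(1+\frac{2p-1}{k(p-1)^{2}}\Bigr) + O\bigl(x(\log x)^{-1}(\log\log x)^{4/k}\bigr), \] where the product runs over all primes $p$.
   Context: For a positive integer $n$, $d(n)=\sum_{d\mid n}1$ is the number of divisors of $n$ and $\omega(n)=\sum_{p\mid n}1$ is the number of distinct prime divisors of $n$. $\Gamma$ denotes the Euler Gamma function. The implied constant in the $O$-term may depend on $k$. *)

theory Defs
  imports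
    "HOL-Analysis.Analysis"
    "HOL-Library.Landau_Symbols"
    "HOL-Computational_Algebra.Primes"
begin

definition divisor_count :: "nat \<Rightarrow> nat" where
  "divisor_count n = card {d. d dvd n}"

definition omega :: "nat \<Rightarrow> nat" where
  "omega n = card {p. prime p \<and> p dvd n}"

definition D_omega :: "nat \<Rightarrow> nat \<Rightarrow> real" where
  "D_omega k n = real (divisor_count n) / real k ^ omega n"

definition euler_factor :: "nat \<Rightarrow> nat \<Rightarrow> real" where
  "euler_factor k p =
     (1 - 1 / real p) powr (2 / real k) *
     (1 + (2 * real p - 1) / (real k * (real p - 1)\<^sup>2))"

text \<open>
  A product over the primes is taken along the natural numbers in increasing order, with the
  non-primes contributing a factor 1.  Since \<^const>\<open>prodinf\<close> of a divergent product is an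
  unspecified value, convergence (\<^const>\<open>convergent_prod\<close>) has to be asserted separately.
\<close>

definition on_primes :: "(nat \<Rightarrow> real) \<Rightarrow> nat \<Rightarrow> real" where
  "on_primes f n = (if prime n then f n else 1)"

end

(*
  Write z = 2/k <= 1.  The Dirichlet series of D_{k,omega} is F(s) = zeta(s)^z exp(h(s)), with h
  holomorphic and bounded for Re s > 3/4, so (s - 1)^z F(s) tends to C = exp(h(1))
  as s tends to 1; this C is the Euler product.

  With S(x) the summatory function, v^2 S(e^v) e^{-v} - C v^{z+1} / Gamma(z) has as Laplace
  transform the second derivative of F(1+w)/(1+w) minus that of C w^{-z}.  For 0 < Re w <= 1 this
  is O(1 + |w|^{-2}): near w = 0 by the factorization, elsewhere by bounds of the form |t|^a for
  zeta, its derivatives and 1/zeta, where the bound of 1/zeta comes from the 3-4-1 inequality.  No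
  zero-free region to the left of Re s = 1 is needed.  By Fubini, averaging against a Gaussian of width
  1/y around y amounts to integrating the transform against a Gaussian of width y on the line
  Re w = 1/y; the average is therefore O(y).  Monotonicity of S removes the smoothing at the cost
  of a relative error O(log u / u), where u = log x, which is below the claimed error term.
*)

theory Submission
  imports
    Defs
    "HOL-Probability.Probability"
    "HOL-Complex_Analysis.Complex_Analysis"
    "HOL-Real_Asymp.Real_Asymp"
begin

section \<open>Laplace transforms and Gaussian averages\<close>

text \<open>The weight v^2 is what produces the saving. A bounded transform integrated against a
  Gaussian of width y gives only O(y); dividing by u^2 at the end turns this into 1 / u, that is x /
  log x, whereas a single factor v would leave no decay at all. The term |w|^(-2) costs no more,
  since its integral along Re w = 1 / y is pi y. Two derivatives bring in powers of zeta' / zeta, so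
  the growth exponents must be small. With T = (|t| + 4)^(1/16), zeta and its derivatives are O(T)
  and 1 / zeta is O(T^4); the logarithmic derivatives cost T^10, |zeta|^z one T more, and the
  denominator 1 + w gives T^16 back. The power zeta^z is always the exponential of a sum over primes
  of principal logarithms, so no branch has to be chosen for it; the estimates use only moduli and
  logarithmic derivatives. Continuation past Re s = 1 serves Cauchy's estimates and the behaviour at
  s = 1. The desmoothing error u^(z-2) log u is tightest for k = 2, where log u / u stands against
  (log u)^2 / u.\<close>

definition laplace :: "(real \<Rightarrow> complex) \<Rightarrow> complex \<Rightarrow> complex" where
  "laplace q w = (LBINT v. exp (- w * of_real v) * q v)"

text \<open>Integrability is asked at real abscissas only, because the modulus of the kernel depends
  on Re w alone. Vanishing on the negative axis makes the two-sided integral in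
  \<open>laplace\<close> one-sided.\<close>

definition laplaceable :: "(real \<Rightarrow> complex) \<Rightarrow> bool" where
  "laplaceable q \<longleftrightarrow> (\<forall>v<0. q v = 0) \<and>
     (\<forall>s>0. integrable lborel (\<lambda>v. exp (- complex_of_real (s * v)) * q v))"

lemma laplaceable_measurable:
  assumes "laplaceable q"
  shows "q \<in> borel_measurable lborel"
proof -
  have 1: "integrable lborel (\<lambda>v. exp (- complex_of_real (1 * v)) * q v)"
    using assms unfolding laplaceable_def using zero_less_one by blast
  have "(\<lambda>v. exp (complex_of_real v) * (exp (- complex_of_real (1 * v)) * q v)) \<in> borel_measurable lborel"
    by (rule borel_measurable_times[OF _ borel_measurable_integrable[OF 1]]) measurable
  moreover have "(\<lambda>v. exp (complex_of_real v) * (exp (- complex_of_real (1 * v)) * q v)) = q"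
    by (simp add: mult.assoc[symmetric] mult_exp_exp)
  ultimately show ?thesis by (simp only:)
qed

lemma laplaceable_integrable:
  assumes "laplaceable q" "Re w > 0"
  shows "integrable lborel (\<lambda>v. exp (- w * of_real v) * q v)"
proof -
  have 1: "integrable lborel (\<lambda>v. exp (- complex_of_real (Re w * v)) * q v)"
    using assms unfolding laplaceable_def by blast
  note [measurable] = laplaceable_measurable[OF assms(1)]
  have 2: "(\<lambda>v. exp (- w * of_real v) * q v) \<in> borel_measurable lborel"
    by measurable
  show ?thesis
    by (rule Bochner_Integration.integrable_bound[OF 1 2]) (simp add: norm_mult)
qed

lemma le_exp_div:
  fixes v s :: real assumes "s > 0"
  shows "v \<le> exp (s * v) / s"
proof -
  have "s * v \<le> exp (s * v)" using exp_ge_add_one_self[of "s * v"] by linarith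
  thus ?thesis using assms by (simp add: field_simps)
qed

text \<open>Half of the decay, exp(-s v / 2), absorbs the factor v; the other half keeps the
  integral finite.\<close>

lemma laplaceable_times:
  assumes "laplaceable q"
  shows "laplaceable (\<lambda>v. of_real v * q v)"
  unfolding laplaceable_def
proof (intro conjI allI impI)
  show "complex_of_real v * q v = 0" if "v < 0" for v using assms that by (auto simp: laplaceable_def)
next
  fix s :: real assume s: "s > 0"
  note [measurable] = laplaceable_measurable[OF assms]
  have 1: "integrable lborel (\<lambda>v. complex_of_real (2/s) * (exp (- complex_of_real (s/2 * v)) * q v))"
    using assms s unfolding laplaceable_def by (intro integrable_mult_right) (metis half_gt_zero)
  show "integrable lborel (\<lambda>v. exp (- complex_of_real (s * v)) * (of_real v * q v))"
  proof (rule Bochner_Integration.integrable_bound[OF 1])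
    show "(\<lambda>v. exp (- complex_of_real (s * v)) * (of_real v * q v)) \<in> borel_measurable lborel"
      by measurable
    show "AE v in lborel. norm (exp (- complex_of_real (s * v)) * (complex_of_real v * q v))
            \<le> norm (complex_of_real (2 / s) * (exp (- complex_of_real (s / 2 * v)) * q v))"
    proof (rule AE_I2)
      fix v :: real
      show "norm (exp (- complex_of_real (s * v)) * (complex_of_real v * q v))
            \<le> norm (complex_of_real (2 / s) * (exp (- complex_of_real (s / 2 * v)) * q v))"
      proof (cases "v < 0")
        case True thus ?thesis using assms by (simp add: laplaceable_def)
      next
        case False
        have "exp (-(s * v)) * v \<le> exp (-(s * v)) * (exp (s/2 * v) / (s/2))"
          using le_exp_div[of "s/2" v] s by (intro mult_left_mono) auto
        also have "\<dots> = 2 / s * exp (- (s/2 * v))"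
          by (simp add: exp_add[symmetric] field_simps mult_exp_exp)
        finally have "exp (-(s * v)) * v * norm (q v) \<le> 2 / s * exp (- (s/2 * v)) * norm (q v)"
          by (intro mult_right_mono) auto
        thus ?thesis using False s by (simp add: norm_mult norm_divide mult.assoc)
      qed
    qed
  qed
qed

text \<open>Differentiation under the integral sign, made quantitative: the second-order Taylor
  remainder of exp gives an error K |h| in the difference quotient, where K is a weighted integral
  of v^2 |q|.\<close>

lemma has_field_derivative_laplace:
  assumes q: "laplaceable q" and w: "Re w > 0"
  shows "(laplace q has_field_derivative - laplace (\<lambda>v. of_real v * q v) w) (at w)"
proof -
  \<comment> \<open>Half of the abscissa pays for the perturbation: |h| < s costs at most exp(s v),
    which leaves exp(-s v) out of exp(-2 s v).\<close>
  define s where "s = Re w / 2"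
  have s: "s > 0" using w by (simp add: s_def)
  define q2 where "q2 = (\<lambda>v. of_real v * (of_real v * q v))"
  have q1: "laplaceable (\<lambda>v. of_real v * q v)" by (rule laplaceable_times[OF q])
  have q2: "laplaceable q2" unfolding q2_def by (rule laplaceable_times[OF q1])
  have i2: "integrable lborel (\<lambda>v. exp (- of_real s * of_real v) * q2 v)"
    using laplaceable_integrable[OF q2, of "of_real s"] s by simp
  define K where "K = (LBINT v. norm (exp (- complex_of_real s * of_real v) * q2 v))"
  let ?D = "- laplace (\<lambda>v. of_real v * q v) w"
  have bound: "norm ((laplace q (w+h) - laplace q w) / h - ?D) \<le> K * norm h"
    if h: "norm h < s" "h \<noteq> 0" for h
  proof -
    have Rh: "Re (w + h) > 0" using abs_Re_le_cmod[of h] h s by (auto simp: s_def)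
    note i = laplaceable_integrable[OF q w] laplaceable_integrable[OF q Rh] laplaceable_integrable[OF q1 w]
    have eq: "laplace q (w+h) - laplace q w - h * ?D =
      (LBINT v. (exp (- (w+h) * of_real v) * q v - exp (- w * of_real v) * q v) + h * (exp (- w * of_real v) * (of_real v * q v)))"
      unfolding laplace_def using i by simp
    have "norm (laplace q (w+h) - laplace q w - h * ?D) \<le> (LBINT v. (norm h)^2 * norm (exp (- of_real s * of_real v) * q2 v))"
      unfolding eq
    proof (rule Bochner_Integration.integral_norm_bound_integral)
      show "integrable lborel (\<lambda>v. (exp (- (w+h) * of_real v) * q v - exp (- w * of_real v) * q v) + h * (exp (- w * of_real v) * (of_real v * q v)))"
        using i by simp
      show "integrable lborel (\<lambda>v. (norm h)^2 * norm (exp (- of_real s * of_real v) * q2 v))"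
        using i2 by (intro integrable_mult_right integrable_norm)
      fix v :: real
      show "norm ((exp (- (w+h) * of_real v) * q v - exp (- w * of_real v) * q v) + h * (exp (- w * of_real v) * (of_real v * q v)))
          \<le> (norm h)^2 * norm (exp (- of_real s * of_real v) * q2 v)"
      proof (cases "v < 0")
        case True
        thus ?thesis using q by (simp add: laplaceable_def)
      next
        case False
        define x where "x = - h * of_real v"
        have nx: "norm x = norm h * v" using False by (simp add: x_def norm_mult)
        have eq2: "(exp (- (w+h) * of_real v) * q v - exp (- w * of_real v) * q v) + h * (exp (- w * of_real v) * (of_real v * q v))
            = exp (- w * of_real v) * q v * (exp x - (1 + x))"
          by (simp add: x_def algebra_simps mult_exp_exp)
        have "norm (exp x - (\<Sum>k\<le>1. x ^ k / fact k)) \<le> exp \<bar>Re x\<bar> * (norm x)^Suc 1 / fact 1"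
          by (rule Taylor_exp)
        hence "norm (exp x - (1 + x)) \<le> exp \<bar>Re x\<bar> * (norm x)^2" by (simp add: power2_eq_square)
        also have "\<dots> \<le> exp (s * v) * (norm x)^2"
        proof -
          have "\<bar>Re x\<bar> \<le> norm h * v" using abs_Re_le_cmod[of x] nx by simp
          also have "\<dots> \<le> s * v" using h False by (intro mult_right_mono) auto
          finally show ?thesis by (intro mult_right_mono) auto
        qed
        finally have "norm (exp (- w * of_real v) * q v * (exp x - (1 + x))) \<le> exp (- (2 * s * v)) * norm (q v) * (exp (s * v) * (norm x)^2)"
          unfolding norm_mult by (intro mult_mono) (auto simp: s_def)
        also have "\<dots> = (norm h)^2 * norm (exp (- of_real s * of_real v) * q2 v)"
          using False by (simp add: nx q2_def norm_mult power2_eq_square mult_exp_exp algebra_simps)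
        finally show ?thesis unfolding eq2 .
      qed
    qed
    also have "\<dots> = (norm h)^2 * K" by (simp add: K_def)
    finally have *: "norm (laplace q (w+h) - laplace q w - h * ?D) \<le> (norm h)^2 * K" .
    have "(laplace q (w+h) - laplace q w) / h - ?D = (laplace q (w+h) - laplace q w - h * ?D) / h"
      using h by (simp add: field_simps)
    hence "norm ((laplace q (w+h) - laplace q w) / h - ?D) = norm (laplace q (w+h) - laplace q w - h * ?D) / norm h"
      by (simp add: norm_divide)
    also have "\<dots> \<le> (norm h)^2 * K / norm h" using * by (intro divide_right_mono) auto
    also have "\<dots> = K * norm h" using h by (simp add: power2_eq_square)
    finally show ?thesis .
  qed
  have "((\<lambda>h. (laplace q (w+h) - laplace q w) / h - ?D) \<longlongrightarrow> 0) (at 0)"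
  proof (rule Lim_null_comparison)
    show "\<forall>\<^sub>F h in at 0. norm ((laplace q (w+h) - laplace q w) / h - ?D) \<le> K * norm h"
      unfolding eventually_at using bound s by (intro exI[of _ s]) (auto simp: dist_norm)
    show "((\<lambda>h::complex. K * norm h) \<longlongrightarrow> 0) (at 0)"
      by (auto intro!: tendsto_eq_intros)
  qed
  hence "((\<lambda>h. (laplace q (w+h) - laplace q w) / h) \<longlongrightarrow> ?D) (at 0)"
    using LIM_zero_iff by blast
  thus ?thesis unfolding DERIV_def .
qed

text \<open>Uniqueness of derivatives transfers explicit formulas for f' and f'' to the weighted
  transforms; the two minus signs cancel.\<close>

lemma deriv2_laplace:
  assumes q: "laplaceable q" and w: "Re w > 0"
    and L: "\<And>w. Re w > 0 \<Longrightarrow> laplace q w = f w"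
    and f1: "\<And>w. Re w > 0 \<Longrightarrow> (f has_field_derivative f' w) (at w)"
    and f2: "\<And>w. Re w > 0 \<Longrightarrow> (f' has_field_derivative f'' w) (at w)"
  shows "laplace (\<lambda>v. of_real v * (of_real v * q v)) w = f'' w"
proof -
  have op: "open {w::complex. Re w > 0}" by (rule open_halfspace_Re_gt)
  have 1: "laplace (\<lambda>v. of_real v * q v) w = - f' w" if "Re w > 0" for w
  proof -
    have "(f has_field_derivative - laplace (\<lambda>v. of_real v * q v) w) (at w)"
      by (rule has_field_derivative_transform_within_open[OF has_field_derivative_laplace[OF q that] op])
        (use L that in auto)
    from DERIV_unique[OF this f1[OF that]] show ?thesis by (metis minus_minus)
  qed
  have "(laplace (\<lambda>v. of_real v * q v) has_field_derivative - f'' w) (at w)"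
    by (rule has_field_derivative_transform_within_open[OF DERIV_minus[OF f2[OF w]] op])
      (use 1 w in auto)
  from DERIV_unique[OF this has_field_derivative_laplace[OF laplaceable_times[OF q] w]]
  show ?thesis by (metis minus_minus)
qed

section \<open>Gaussian averages as integrals over vertical lines\<close>

text \<open>The characteristic function of the standard normal law, read with the two variables
  exchanged and rescaled by s: the Gaussian is its own Fourier transform.\<close>

lemma gaussian_fourier:
  assumes "s > 0"
  shows "integrable lborel (\<lambda>t. exp (- (s^2 * t^2) / 2))"
    "(LBINT t. complex_of_real (exp (- (s^2 * t^2) / 2)) * exp (\<i> * of_real (t * x))) =
       2 * of_real pi * of_real (normal_density 0 s x)"
proof -
  \<comment> \<open>The form \<open>0 + s * t\<close> matches the affine substitution rules for
    \<open>lborel\<close>.\<close>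
  have e: "exp (- (s^2 * t^2) / 2) = sqrt (2*pi) * std_normal_density (0 + s * t)" for t
    by (simp add: std_normal_density_def power_mult_distrib)
  show "integrable lborel (\<lambda>t. exp (- (s^2 * t^2) / 2))"
    unfolding e by (intro integrable_mult_right lborel_integrable_real_affine) (use assms in auto)
  have "char std_normal_distribution (x/s) = (LBINT t. std_normal_density t *\<^sub>R exp (\<i> * of_real (x / s * t)))"
    unfolding char_def by (subst integral_density) (auto simp: mult_ac)
  also have "\<dots> = \<bar>s\<bar> *\<^sub>R (LBINT t. std_normal_density (0 + s*t) *\<^sub>R exp (\<i> * of_real (x / s * (0 + s*t))))"
    by (rule lborel_integral_real_affine) (use assms in auto)
  also have "\<dots> = \<bar>s\<bar> *\<^sub>R (LBINT t. (1/ sqrt (2*pi)) * (complex_of_real (exp (- (s^2 * t^2) / 2)) * exp (\<i> * of_real (t * x))))"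
    unfolding e using assms by (intro arg_cong2[of _ _ _ _ scaleR] refl Bochner_Integration.integral_cong) (auto simp: scaleR_conv_of_real mult_ac)
  also have "\<dots> = of_real (s / sqrt (2*pi)) * (LBINT t. (complex_of_real (exp (- (s^2 * t^2) / 2)) * exp (\<i> * of_real (t * x))))"
    using assms by (simp add: scaleR_conv_of_real)
  finally have "of_real (s / sqrt (2*pi)) * (LBINT t. (complex_of_real (exp (- (s^2 * t^2) / 2)) * exp (\<i> * of_real (t * x)))) = of_real (exp (- ((x/s)\<^sup>2) / 2))"
    by (simp add: char_std_normal_distribution)
  hence "(LBINT t. (complex_of_real (exp (- (s^2 * t^2) / 2)) * exp (\<i> * of_real (t * x)))) = of_real (sqrt (2*pi) / s * exp (- ((x/s)\<^sup>2) / 2))"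
    using assms by (simp add: field_simps)
  also have "sqrt (2*pi) / s * exp (- ((x/s)\<^sup>2) / 2) = 2 * pi * normal_density 0 s x"
    using assms by (simp add: normal_density_def real_sqrt_mult power_divide field_simps)
  finally show "(LBINT t. complex_of_real (exp (- (s^2 * t^2) / 2)) * exp (\<i> * of_real (t * x))) =
       2 * of_real pi * of_real (normal_density 0 s x)" by simp
qed

lemma normal_density_shift: "normal_density 0 s (y - v) = normal_density y s v"
  by (simp add: normal_density_def power2_commute)

text \<open>Both sides are iterated integrals of one kernel with phase exp(i t (y - v)). Integrating
  over t first gives the normal density centred at y, integrating over v first gives the transform
  on Re w = e.\<close>

lemma gaussian_laplace_fubini:
  assumes q: "laplaceable q" and e: "e > 0" and s: "s > 0"
  shows "2 * of_real pi * (LBINT v. of_real (normal_density y s v) * (exp (- of_real (e * v)) * q v)) =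
     (LBINT t. of_real (exp (- (s^2 * t^2) / 2)) * exp (\<i> * of_real (t * y)) * laplace q (Complex e t))"
proof -
  note [measurable] = laplaceable_measurable[OF q]
  have iq: "integrable lborel (\<lambda>v. exp (- of_real (e * v)) * q v)"
    using q e by (auto simp: laplaceable_def simp del: of_real_mult)
  have ig: "integrable lborel (\<lambda>t. exp (- (s^2 * t^2) / 2))" by (rule gaussian_fourier(1)[OF s])
  define f where "f = (\<lambda>t v. complex_of_real (exp (- (s^2 * t^2) / 2)) * exp (\<i> * of_real (t * (y - v))) * (exp (- of_real (e * v)) * q v))"
  have intf: "integrable (lborel \<Otimes>\<^sub>M lborel) (case_prod f)"
  proof (rule lborel_pair.Fubini_integrable)
    show "case_prod f \<in> borel_measurable (lborel \<Otimes>\<^sub>M lborel)" unfolding f_def by measurable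
    have "(\<lambda>t. LBINT v. norm (f t v)) = (\<lambda>t. exp (- (s^2 * t^2) / 2) * (LBINT v. norm (exp (- of_real (e * v)) * q v)))"
      unfolding f_def by (simp add: norm_mult)
    thus "integrable lborel (\<lambda>t. LBINT v. norm (case (t, v) of (x, xa) \<Rightarrow> f x xa))"
      using ig by simp
    show "AE t in lborel. integrable lborel (\<lambda>v. case (t, v) of (x, xa) \<Rightarrow> f x xa)"
    proof (rule AE_I2)
      fix t :: real
      have [measurable]: "f t \<in> borel_measurable lborel" unfolding f_def by measurable
      have "integrable lborel (\<lambda>v. of_real (exp (- (s^2 * t^2) / 2)) * (exp (- of_real (e * v)) * q v))"
        using iq by (intro integrable_mult_right)
      thus "integrable lborel (\<lambda>v. case (t, v) of (x, xa) \<Rightarrow> f x xa)"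
        by (rule Bochner_Integration.integrable_bound) (auto simp: f_def norm_mult)
    qed
  qed
  have "(LBINT v. LBINT t. f t v) = (LBINT t. LBINT v. f t v)"
    by (rule lborel_pair.Fubini_integral[OF intf])
  moreover have "(LBINT t. f t v) = 2 * of_real pi * (of_real (normal_density y s v) * (exp (- of_real (e * v)) * q v))" for v
    unfolding f_def integral_mult_left_zero
    by (subst gaussian_fourier(2)[OF s]) (simp add: normal_density_shift)
  moreover have "(LBINT v. f t v) = of_real (exp (- (s^2 * t^2) / 2)) * exp (\<i> * of_real (t * y)) * laplace q (Complex e t)" for t
  proof -
    have "f t v = of_real (exp (- (s^2 * t^2) / 2)) * exp (\<i> * of_real (t * y)) * (exp (- Complex e t * of_real v) * q v)" for v
      unfolding f_def by (simp add: Complex_eq algebra_simps mult_exp_exp)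
    thus ?thesis unfolding laplace_def by simp
  qed
  ultimately show ?thesis by simp
qed

lemma inverse_square_plus_integrable:
  fixes e :: real assumes "e > 0"
  shows "integrable lborel (\<lambda>t. 1 / (e^2 + t^2))" "(LBINT t. 1 / (e^2 + t^2)) = pi / e"
proof -
  have 1: "has_bochner_integral lborel (\<lambda>x::real. inverse (1 + x^2)) pi"
    using Sinc_Integral.integrable_inverse_1_plus_square Sinc_Integral.LBINT_inverse_1_plus_square
    by (auto simp: has_bochner_integral_iff set_integrable_def interval_lebesgue_integral_def set_lebesgue_integral_def einterval_def)
  have e: "1 / (e^2 + t^2) = (1/e^2) * inverse (1 + (0 + (1/e) * t)^2)" for t
    using assms by (simp add: field_simps power2_eq_square)
  show "integrable lborel (\<lambda>t. 1 / (e^2 + t^2))" "(LBINT t. 1 / (e^2 + t^2)) = pi / e"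
    unfolding e
  proof -
    show "integrable lborel (\<lambda>t. (1/e^2) * inverse (1 + (0 + (1/e) * t)^2))"
      using 1 assms by (intro integrable_mult_right lborel_integrable_real_affine) (auto simp: has_bochner_integral_iff)
    have "pi = \<bar>1/e\<bar> *\<^sub>R (LBINT t. inverse (1 + (0 + (1/e) * t)^2))"
      using 1 assms by (subst lborel_integral_real_affine[symmetric]) (auto simp: has_bochner_integral_iff)
    hence "(LBINT t. inverse (1 + (0 + (1/e) * t)^2)) = pi * e"
      using assms by (simp add: field_simps)
    thus "(LBINT t. (1/e^2) * inverse (1 + (0 + (1/e) * t)^2)) = pi / e"
      unfolding integral_mult_right_zero using assms by (simp add: power2_eq_square)
  qed
qed

section \<open>Laplace transforms of powers\<close>

definition pow_fun :: "real \<Rightarrow> real \<Rightarrow> complex" where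
  "pow_fun a v = (if v > 0 then of_real (v powr a) else 0)"

lemma has_bochner_integral_powr_exp:
  fixes a s :: real assumes a: "a > -1" and s: "s > 0"
  shows "has_bochner_integral lborel (\<lambda>v. exp (- s * v) * (if v > 0 then v powr a else 0)) (Gamma (a + 1) * s powr (- a - 1))"
proof -
  let ?g = "\<lambda>t::real. indicator {0..} t * t powr (a + 1 - 1) / exp t"
  have G: "has_bochner_integral lborel ?g (Gamma (a + 1))"
    using Gamma_conv_nn_integral_real[of "a + 1"] a
    by (intro has_bochner_integral_nn_integral) (auto intro!: Gamma_real_pos less_imp_le)
  have i: "integrable lborel (\<lambda>v. ?g (0 + s * v))" "(LBINT v. ?g (0 + s * v)) = Gamma (a + 1) / s"
    using G s lborel_integrable_real_affine[of ?g s 0] lborel_integral_real_affine[of s ?g 0]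
    by (auto simp: has_bochner_integral_iff field_simps)
  have eq: "exp (- s * v) * (if v > 0 then v powr a else 0) = s powr (-a) * ?g (0 + s * v)" if "v \<noteq> 0" for v
    using that s by (auto simp: indicator_def powr_mult powr_minus exp_minus field_simps zero_le_mult_iff)
  have AE: "AE v in lborel. exp (- s * v) * (if v > 0 then v powr a else 0) = s powr (-a) * ?g (0 + s * v)"
    using AE_lborel_singleton[of "0::real"] by eventually_elim (rule eq)
  have m: "(\<lambda>v::real. exp (- s * v) * (if v > 0 then v powr a else 0)) \<in> borel_measurable lborel"
    by measurable
  have h: "has_bochner_integral lborel (\<lambda>v. s powr (-a) * ?g (0 + s * v)) (s powr (-a) * (Gamma (a + 1) / s))"
    unfolding has_bochner_integral_iff
    by (intro conjI integrable_mult_right i(1), subst integral_mult_right_zero, subst i(2), rule refl)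
  have "has_bochner_integral lborel (\<lambda>v. exp (- s * v) * (if v > 0 then v powr a else 0)) (s powr (-a) * (Gamma (a + 1) / s))"
    using has_bochner_integral_cong_AE[OF m borel_measurable_has_bochner_integral[OF h] AE] h by blast
  moreover have "s powr (-a) * (Gamma (a + 1) / s) = Gamma (a + 1) * s powr (- a - 1)"
    using s by (simp add: powr_diff)
  ultimately show ?thesis by simp
qed

lemma laplaceable_pow_fun:
  assumes a: "a > -1"
  shows "laplaceable (pow_fun a)"
  unfolding laplaceable_def
proof (intro conjI allI impI)
  fix s :: real assume s: "s > 0"
  have "has_bochner_integral lborel (\<lambda>v. complex_of_real (exp (- s * v) * (if v > 0 then v powr a else 0))) (of_real (Gamma (a + 1) * s powr (- a - 1)))"
    by (rule has_bochner_integral_of_real[OF has_bochner_integral_powr_exp[OF a s]])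
  moreover have "(\<lambda>v. complex_of_real (exp (- s * v) * (if v > 0 then v powr a else 0))) = (\<lambda>v. exp (- complex_of_real (s * v)) * pow_fun a v)"
    by (auto simp: fun_eq_iff pow_fun_def exp_of_real[symmetric])
  ultimately show "integrable lborel (\<lambda>v. exp (- complex_of_real (s * v)) * pow_fun a v)"
    by (auto simp: has_bochner_integral_iff simp del: of_real_mult)
qed (simp add: pow_fun_def)

lemma laplace_pow_fun_real:
  assumes a: "a > -1" and s: "s > 0"
  shows "laplace (pow_fun a) (of_real s) = of_real (Gamma (a + 1)) * of_real s powr of_real (- a - 1)"
proof -
  have h: "has_bochner_integral lborel (\<lambda>v. complex_of_real (exp (- s * v) * (if v > 0 then v powr a else 0))) (of_real (Gamma (a + 1) * s powr (- a - 1)))"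
    by (rule has_bochner_integral_of_real[OF has_bochner_integral_powr_exp[OF a s]])
  have "(\<lambda>v. complex_of_real (exp (- s * v) * (if v > 0 then v powr a else 0))) = (\<lambda>v. exp (- of_real s * of_real v) * pow_fun a v)"
    by (auto simp: fun_eq_iff pow_fun_def exp_of_real[symmetric])
  with h have "laplace (pow_fun a) (of_real s) = of_real (Gamma (a + 1) * s powr (- a - 1))"
    by (simp add: laplace_def has_bochner_integral_iff)
  also have "\<dots> = of_real (Gamma (a + 1)) * of_real s powr of_real (- a - 1)"
    using s powr_of_real[of s "- a - 1"] by simp
  finally show ?thesis .
qed

text \<open>Both sides are holomorphic on the right half-plane and agree on the positive reals by
  Euler's integral, so the identity theorem applies; no contour has to be rotated.\<close>

lemma laplace_pow_fun:
  assumes a: "a > -1" and w: "Re w > 0"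
  shows "laplace (pow_fun a) w = of_real (Gamma (a + 1)) * w powr of_real (- a - 1)"
proof -
  let ?H = "{w::complex. Re w > 0}"
  let ?g = "\<lambda>w. of_real (Gamma (a + 1)) * w powr of_real (- a - 1)"
  have op: "open ?H" by (rule open_halfspace_Re_gt)
  have conn: "connected ?H" by (intro convex_connected convex_halfspace_Re_gt)
  have h1: "laplace (pow_fun a) holomorphic_on ?H"
    unfolding holomorphic_on_def
    using has_field_derivative_laplace[OF laplaceable_pow_fun[OF a]] field_differentiable_def
      field_differentiable_at_within by blast
  have h2: "?g holomorphic_on ?H"
    by (intro holomorphic_intros) (auto simp: complex_nonpos_Reals_iff)
  have "laplace (pow_fun a) w - ?g w = 0"
  proof (rule analytic_continuation[of "\<lambda>w. laplace (pow_fun a) w - ?g w" ?H "of_real ` {0<..}" 1])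
    show "1 islimpt complex_of_real ` {0<..}"
    proof (rule islimpt_sequential[THEN iffD2], intro exI conjI allI)
      let ?f = "\<lambda>n. complex_of_real (1 + 1 / of_nat (Suc n))"
      show "?f n \<in> complex_of_real ` {0<..} - {1}" for n
        by (auto simp: image_iff complex_eq_iff intro!: add_pos_pos)
      have "(\<lambda>n. 1 + 1 / real (Suc n)) \<longlonglongrightarrow> 1 + 0"
        by (intro tendsto_add tendsto_const LIMSEQ_Suc[OF lim_1_over_n])
      from tendsto_of_real[OF this] show "?f \<longlonglongrightarrow> 1" unfolding add_0_right of_real_1 .
    qed
  qed (use h1 h2 op conn w laplace_pow_fun_real[OF a] in \<open>auto intro!: holomorphic_on_diff simp del: of_real_minus of_real_diff\<close>)
  thus ?thesis by simp
qed

section \<open>A Tauberian theorem\<close>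

text \<open>On the tail, half of the Gaussian exponent is at least a^2 y^2 / 4 and comes out as a
  constant. The other half is sqrt 2 times a normal density of width sqrt 2 / y, and sqrt 2 is
  rounded up to 2.\<close>

lemma normal_density_tail:
  fixes a y m :: real assumes y: "y > 0" and a: "a \<ge> 0"
  shows "integrable lborel (\<lambda>v. normal_density m (1/y) v * indicator {v. a < \<bar>v - m\<bar>} v)"
    "(LBINT v. normal_density m (1/y) v * indicator {v. a < \<bar>v - m\<bar>} v) \<le> 2 * exp (- (a^2 * y^2) / 4)"
proof -
  let ?n = "normal_density m (1/y)" and ?n2 = "normal_density m (sqrt 2 / y)"
  let ?e = "2 * exp (- (a^2 * y^2) / 4)"
  have le: "?n v * indicator {v. a < \<bar>v - m\<bar>} v \<le> ?e * ?n2 v" for v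
  proof (cases "a < \<bar>v - m\<bar>")
    case True
    hence "a^2 \<le> (v - m)^2" using a by (metis abs_ge_self abs_le_square_iff abs_of_nonneg less_imp_le)
    hence "a^2 * y^2 \<le> (v-m)^2 * y^2" by (intro mult_right_mono) auto
    hence *: "exp (- ((v-m)^2 * y^2) / 2) \<le> exp (- (a^2 * y^2) / 4) * exp (- ((v-m)^2 * y^2) / 4)"
      by (simp add: mult_exp_exp)
    have s2: "sqrt 2 \<le> 2" by (rule real_le_lsqrt) auto
    have "?n v = y / sqrt (2 * pi) * exp (- ((v-m)^2 * y^2) / 2)"
      using y by (simp add: normal_density_def real_sqrt_mult real_sqrt_divide power_divide field_simps)
    also have "\<dots> \<le> y / sqrt (2 * pi) * (exp (- (a^2 * y^2) / 4) * exp (- ((v-m)^2 * y^2) / 4))"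
      using * y by (intro mult_left_mono) auto
    also have "\<dots> = exp (- (a^2 * y^2) / 4) * sqrt 2 * ?n2 v"
      using y by (simp add: normal_density_def real_sqrt_mult real_sqrt_divide power_divide field_simps)
    also have "\<dots> \<le> ?e * ?n2 v" using s2 by (intro mult_right_mono) auto
    finally show ?thesis using True by simp
  qed auto
  have i2: "integrable lborel (\<lambda>v. ?e * ?n2 v)" using y by (intro integrable_mult_right) auto
  show i: "integrable lborel (\<lambda>v. ?n v * indicator {v. a < \<bar>v - m\<bar>} v)"
    by (rule Bochner_Integration.integrable_bound[OF i2]) (use le in auto)
  have "(LBINT v. ?n v * indicator {v. a < \<bar>v - m\<bar>} v) \<le> (LBINT v. ?e * ?n2 v)"
    by (rule integral_mono[OF i i2 le])
  also have "\<dots> = ?e" using y by simp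
  finally show "(LBINT v. ?n v * indicator {v. a < \<bar>v - m\<bar>} v) \<le> ?e" .
qed

text \<open>The upper estimate uses p inside the window and the global bound K on the tail; the
  lower one discards the tail, where Q is nonnegative. With the window on one side of a point, p can
  be taken from the value of a monotone function at that point.\<close>

lemma normal_density_average:
  fixes a y m K p :: real and Q :: "real \<Rightarrow> real"
  assumes y: "y > 0" and a: "a \<ge> 0" and [measurable]: "Q \<in> borel_measurable borel"
    and Q: "\<And>v. 0 \<le> Q v" "\<And>v. Q v \<le> K" and p: "p \<ge> 0"
  shows "integrable lborel (\<lambda>v. normal_density m (1/y) v * Q v)"
    "(\<And>v. \<bar>v - m\<bar> \<le> a \<Longrightarrow> Q v \<le> p) \<Longrightarrow>
       (LBINT v. normal_density m (1/y) v * Q v) \<le> p + 2 * exp (- (a^2 * y^2) / 4) * K"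
    "(\<And>v. \<bar>v - m\<bar> \<le> a \<Longrightarrow> p \<le> Q v) \<Longrightarrow>
       p * (1 - 2 * exp (- (a^2 * y^2) / 4)) \<le> (LBINT v. normal_density m (1/y) v * Q v)"
proof -
  let ?n = "normal_density m (1/y)" and ?I = "\<lambda>v. indicator {v. a < \<bar>v - m\<bar>} v :: real"
  note t = normal_density_tail[OF y a, of m]
  have n: "integrable lborel ?n" "(LBINT v. ?n v) = 1" using y by auto
  have iK: "integrable lborel (\<lambda>v. K * ?n v)" using n by (intro integrable_mult_right)
  show i: "integrable lborel (\<lambda>v. ?n v * Q v)"
  proof (rule Bochner_Integration.integrable_bound[OF iK])
    show "AE v in lborel. norm (?n v * Q v) \<le> norm (K * ?n v)"
    proof (rule AE_I2)
      fix v have "?n v * Q v \<le> ?n v * K" using Q by (intro mult_left_mono) auto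
      thus "norm (?n v * Q v) \<le> norm (K * ?n v)" using Q[of v] by (simp add: abs_mult mult_ac)
    qed
  qed auto
  have K: "K \<ge> 0" using Q[of 0] by linarith
  show "(LBINT v. ?n v * Q v) \<le> p + 2 * exp (- (a^2 * y^2) / 4) * K"
    if *: "\<And>v. \<bar>v - m\<bar> \<le> a \<Longrightarrow> Q v \<le> p"
  proof -
    have i3: "integrable lborel (\<lambda>v. p * ?n v + K * (?n v * ?I v))" using n t by auto
    have "(LBINT v. ?n v * Q v) \<le> (LBINT v. p * ?n v + K * (?n v * ?I v))"
    proof (rule integral_mono[OF i i3])
      fix v show "?n v * Q v \<le> p * ?n v + K * (?n v * ?I v)"
      proof (cases "a < \<bar>v - m\<bar>")
        case True
        have "?n v * Q v \<le> ?n v * K" using Q by (intro mult_left_mono) auto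
        thus ?thesis using True p by (simp add: mult_ac add_increasing)
      next
        case False
        have "?n v * Q v \<le> ?n v * p" using * False by (intro mult_left_mono) auto
        thus ?thesis using False p by (simp add: mult_ac)
      qed
    qed
    also have "\<dots> = p + K * (LBINT v. ?n v * ?I v)" using n t by simp
    also have "\<dots> \<le> p + K * (2 * exp (- (a^2 * y^2) / 4))" using t K by (intro add_left_mono mult_left_mono)
    finally show ?thesis by (simp add: mult_ac)
  qed
  show "p * (1 - 2 * exp (- (a^2 * y^2) / 4)) \<le> (LBINT v. ?n v * Q v)"
    if *: "\<And>v. \<bar>v - m\<bar> \<le> a \<Longrightarrow> p \<le> Q v"
  proof -
    have i3: "integrable lborel (\<lambda>v. p * ?n v - p * (?n v * ?I v))" using n t by auto
    have "p * (1 - 2 * exp (- (a^2 * y^2) / 4)) \<le> p * (1 - (LBINT v. ?n v * ?I v))"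
      using t p by (intro mult_left_mono) auto
    also have "\<dots> = (LBINT v. p * ?n v - p * (?n v * ?I v))" using n t by (simp add: algebra_simps)
    also have "\<dots> \<le> (LBINT v. ?n v * Q v)"
    proof (rule integral_mono[OF i3 i])
      fix v show "p * ?n v - p * (?n v * ?I v) \<le> ?n v * Q v"
      proof (cases "a < \<bar>v - m\<bar>")
        case True thus ?thesis using Q by simp
      next
        case False
        have "?n v * p \<le> ?n v * Q v" using * False by (intro mult_left_mono) auto
        thus ?thesis using False by (simp add: mult_ac)
      qed
    qed
    finally show ?thesis .
  qed
qed

text \<open>The cube root is estimated first: 1 + v <= 3 y (1 + v / (3 y)) <= 3 y exp(v / (3 y)).
  This is the crude global bound that the Gaussian tails have to beat.\<close>

lemma cube_exp_le:
  fixes v y :: real assumes "v \<ge> 0" "y \<ge> 1"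
  shows "(1 + v)^3 * exp (- v / y) \<le> 27 * y^3"
proof -
  have "1 + v \<le> 3 * y * (1 + v / (3 * y))" using assms by (simp add: field_simps)
  also have "\<dots> \<le> 3 * y * exp (v / (3 * y))" using assms by (intro mult_left_mono) auto
  finally have "(1+v)^3 \<le> (3 * y * exp (v / (3 * y)))^3" using assms by (intro power_mono) auto
  also have "\<dots> = 27 * y^3 * exp (v / y)"
    by (simp add: power_mult_distrib exp_of_nat_mult[symmetric])
  finally show ?thesis by (simp add: exp_minus field_simps)
qed

section \<open>Removal of the smoothing\<close>

text \<open>Monotonicity of T bounds T u by averages over a window just to the right of u from above
  and just to the left of u from below. Over a window of length 2 a with a = 4 ln u / u the model
  term and the exponentials vary by a relative O(a) only, so the loss is O(a) times u^(z-1). The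
  growth bound on T serves only to control the tails.\<close>

lemma desmoothing:
  fixes T :: "real \<Rightarrow> real" and z c M :: real
  assumes mono: "mono T" and T0: "\<And>v. T v \<ge> 0" and Tle: "\<And>v. v \<ge> 0 \<Longrightarrow> T v \<le> (1 + v) * exp v"
    and z: "0 < z" "z \<le> 1" and c: "c \<ge> 0" and M: "M \<ge> 0"
    and J: "\<And>y. y \<ge> 1 \<Longrightarrow> \<bar>LBINT v. normal_density y (1/y) v * (exp (- v / y) * ((if v > 0 then v^2 * T v * exp (- v) else 0) - (if v > 0 then c * v powr (z+1) else 0)))\<bar> \<le> M * y"
  shows "(\<lambda>u. T u * exp (- u) - c * u powr (z - 1)) \<in> O(\<lambda>u. 1 / u + u powr (z - 2) * ln u)"
proof -
  have [measurable]: "T \<in> borel_measurable borel" by (rule borel_measurable_mono[OF mono])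
  \<comment> \<open>The damping exp(-v / y) stems from the line Re w = 1 / y; near v = y it is close
    to exp(-1), which the factor \<open>exp 1\<close> in \<open>K\<close> compensates.\<close>
  define A where "A = (\<lambda>y v::real. exp (- v / y) * (if v > 0 then v^2 * T v * exp (- v) else 0))"
  define B where "B = (\<lambda>y v::real. exp (- v / y) * (if v > 0 then c * v powr (z+1) else 0))"
  have mA[measurable]: "A y \<in> borel_measurable borel" for y unfolding A_def by measurable
  have mB[measurable]: "B y \<in> borel_measurable borel" for y unfolding B_def by measurable
  have A0: "A y v \<ge> 0" for y v using T0 by (simp add: A_def)
  have B0: "B y v \<ge> 0" for y v using c by (simp add: B_def)
  have AK: "A y v \<le> 27 * y^3" if "y \<ge> 1" for y v
  proof (cases "v > 0")
    case True
    have "v^2 * T v * exp (-v) \<le> (1 + v)^2 * ((1 + v) * exp v) * exp (-v)"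
      using Tle[of v] T0[of v] True by (intro mult_right_mono mult_mono power_mono) auto
    also have "\<dots> = (1 + v)^3" by (simp add: power2_eq_square power3_eq_cube exp_minus)
    finally have "A y v \<le> exp (- v / y) * (1 + v)^3" using True by (auto simp: A_def intro!: mult_left_mono)
    also have "\<dots> \<le> 27 * y^3" using cube_exp_le[of v y] that True by (simp add: mult.commute)
    finally show ?thesis .
  qed (use that in \<open>auto simp: A_def\<close>)
  have BK: "B y v \<le> 27 * c * y^3" if "y \<ge> 1" for y v
  proof (cases "v > 0")
    case True
    have "v powr (z+1) \<le> (1 + v) powr (z + 1)" using True z by (intro powr_mono2) auto
    also have "\<dots> \<le> (1 + v) powr 3" using True z by (intro powr_mono) auto
    also have "\<dots> = (1 + v)^3" using True by simp
    finally have "c * v powr (z+1) \<le> c * (1+v)^3" using c by (rule mult_left_mono)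
    hence "B y v \<le> exp (- v / y) * (c * (1 + v)^3)" using True by (auto simp: B_def intro!: mult_left_mono)
    also have "\<dots> = c * ((1+v)^3 * exp (- v / y))" by simp
    also have "\<dots> \<le> c * (27 * y^3)" using cube_exp_le[of v y] that True c by (intro mult_left_mono) auto
    finally show ?thesis by simp
  qed (use that c in \<open>auto simp: B_def\<close>)
  let ?IA = "\<lambda>y. LBINT v. normal_density y (1/y) v * A y v"
  let ?IB = "\<lambda>y. LBINT v. normal_density y (1/y) v * B y v"
  have J': "\<bar>?IA y - ?IB y\<bar> \<le> M * y" if y: "y \<ge> 1" for y
  proof -
    have iA: "integrable lborel (\<lambda>v. normal_density y (1/y) v * A y v)"
      by (rule normal_density_average(1)[where a=0 and p=0, OF _ _ mA A0 AK[OF y]]) (use y in auto)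
    have iB: "integrable lborel (\<lambda>v. normal_density y (1/y) v * B y v)"
      by (rule normal_density_average(1)[where a=0 and p=0, OF _ _ mB B0 BK[OF y]]) (use y in auto)
    have "?IA y - ?IB y = (LBINT v. normal_density y (1/y) v * A y v - normal_density y (1/y) v * B y v)"
      by (rule Bochner_Integration.integral_diff[OF iA iB, symmetric])
    also have "\<dots> = (LBINT v. normal_density y (1/y) v * (exp (- v / y) * ((if v > 0 then v^2 * T v * exp (- v) else 0) - (if v > 0 then c * v powr (z+1) else 0))))"
      unfolding A_def B_def by (simp only: right_diff_distrib)
    finally show ?thesis using J[OF y] by simp
  qed
  \<comment> \<open>2 M comes from M y <= 2 M u, and 27 c and 27 come from the tails of
    \<open>B\<close> and \<open>A\<close>.\<close>
  define K where "K = exp 1 * (2 * M + 27 * c + 27)"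
  have K: "K \<ge> 0" using M c by (simp add: K_def)
  \<comment> \<open>The condition u >= exp 4 gives ln u >= 4, needed for the tail 2 / u^4, and 40 ln
    u <= u gives a <= 1 / 10. The constant 80 is 20 times the 4 in a, where 20 a bounds exp(10 a) -
    1; the 3 is a bound for 1 + 20 a.\<close>
  have main: "\<bar>T u * exp (- u) - c * u powr (z - 1)\<bar> \<le> (80 * c + 3 * K) * (1 / u + u powr (z - 2) * ln u)"
    if u: "u \<ge> exp 4" and u1: "40 * ln u \<le> u" for u
  proof -
    \<comment> \<open>The Gaussian has width about \<open>1/u\<close>; shifting its centre by \<open>a\<close> puts all but
      \<open>2 / u^4\<close> of its mass on one side of \<open>u\<close>, where \<open>T\<close> is monotone.\<close>
    define a where "a = 4 * ln u / u"
    have u5: "u \<ge> 5" using exp_ge_add_one_self[of 4] u by linarith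
    have lnu: "ln u \<ge> 4" using u u5 by (simp add: ln_ge_iff)
    have a: "0 < a" "a \<le> 1 / 10" using u5 lnu u1 by (auto simp: a_def field_simps)
    define X where "X = T u * exp (- u) * u^2"
    define Bu where "Bu = c * u powr (z+1)"
    have X0: "X \<ge> 0" using T0 by (simp add: X_def)
    have Bu0: "Bu \<ge> 0" using c by (simp add: Bu_def)
    \<comment> \<open>Since a y >= 2 ln u, the exponent is at least (ln u)^2 >= 4 ln u. The fourth
      power of u is there to outweigh the global bound of order y^3.\<close>
    have tau: "2 * exp (- (a^2 * y^2) / 4) \<le> 2 / u^4" "2 * exp (- (a^2 * y^2) / 4) * y^3 \<le> 1"
      if y: "u / 2 \<le> y" "y \<le> 2 * u" for y
    proof -
      have "a * y \<ge> a * (u/2)" using y a by (intro mult_left_mono) auto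
      hence "a * y \<ge> 2 * ln u" using u5 by (simp add: a_def)
      hence "(a * y)^2 \<ge> (2 * ln u)^2" using lnu by (intro power_mono) auto
      hence "a^2 * y^2 / 4 \<ge> ln u * ln u" by (simp add: power_mult_distrib) (simp add: power2_eq_square)
      moreover have "ln u * ln u \<ge> 4 * ln u" using lnu by (intro mult_right_mono) auto
      ultimately have "exp (- (a^2 * y^2) / 4) \<le> exp (- (4 * ln u))" by simp
      also have "\<dots> = 1 / u^4" using u5 exp_of_nat_mult[of 4 "ln u"] by (simp add: exp_minus field_simps)
      finally show 1: "2 * exp (- (a^2 * y^2) / 4) \<le> 2 / u^4" by simp
      have "2 * exp (- (a^2 * y^2) / 4) * y^3 \<le> 2 / u^4 * (2 * u)^3"
        using 1 y u5 by (intro mult_mono power_mono) auto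
      also have "\<dots> = 16 / u" using u5 by (simp add: field_simps power_mult_distrib eval_nat_numeral)
      also have "\<dots> \<le> 1"
      proof -
        have "16 \<le> u" using u1 lnu by linarith
        thus ?thesis by simp
      qed
      finally show "2 * exp (- (a^2 * y^2) / 4) * y^3 \<le> 1" .
    qed
    have tau_a: "2 / u^4 \<le> a"
    proof -
      have "2 \<le> 4 * ln u * u^3" 
        using lnu u5 mult_mono[of 16 "4 * ln u" 1 "u^3"] one_le_power[of u 3] by simp
      thus ?thesis using u5 by (simp add: a_def field_simps eval_nat_numeral)
    qed
    have upper: "X \<le> (Bu + K * u) * exp (10 * a)"
    proof -
      define y where "y = u + a"
      have y: "y \<ge> 1" "u / 2 \<le> y" "y \<le> 2 * u" using a u5 by (auto simp: y_def)
      define t where "t = 2 * exp (- (a^2 * y^2) / 4)"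
      have t: "0 < t" "t \<le> a" "t * y^3 \<le> 1" using tau[OF y(2,3)] tau_a by (auto simp: t_def)
      have ay: "a / y \<le> a" using a y by (simp add: field_simps)
      \<comment> \<open>Of the exponent, 1 + a bounds v / y and 2 a bounds the drift of exp(-v) over
        the window, which begins at u.\<close>
      have 1: "X * exp (- 1 - 3 * a) * (1 - t) \<le> ?IA y"
        unfolding t_def
      proof (rule normal_density_average(3)[OF _ _ mA A0 AK])
        fix v assume v: "\<bar>v - y\<bar> \<le> a"
        hence v': "u \<le> v" "v \<le> u + 2 * a" by (auto simp: y_def)
        have "v / y \<le> (y + a) / y" using v y by (intro divide_right_mono) auto
        also have "\<dots> = 1 + a / y" using y by (simp add: field_simps)
        finally have vy: "v / y \<le> 1 + a" using ay by linarith
        have "X * exp (- 1 - 3 * a) = exp (-1-a) * (u^2 * T u * exp (-u - 2 * a))"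
          by (simp add: X_def mult_exp_exp algebra_simps)
        also have "\<dots> \<le> exp (- v / y) * (v^2 * T v * exp (- v))"
          using vy v' u5 T0 monoD[OF mono v'(1)] by (intro mult_mono power_mono) auto
        also have "\<dots> = A y v" using v' u5 by (simp add: A_def)
        finally show "X * exp (- 1 - 3 * a) \<le> A y v" .
      qed (use y a X0 in auto)
      \<comment> \<open>Here a comes from the damping and 4 a from v^(z+1) <= (u exp(2 a))^(z+1)
        with z + 1 <= 2.\<close>
      have 2: "?IB y \<le> Bu * exp (- 1 + 5 * a) + t * (27 * c * y^3)"
        unfolding t_def
      proof (rule normal_density_average(2)[OF _ _ mB B0 BK])
        fix v assume v: "\<bar>v - y\<bar> \<le> a"
        hence v': "u \<le> v" "v \<le> u + 2 * a" by (auto simp: y_def)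
        have "(y - a) / y \<le> v / y" using v y by (intro divide_right_mono) auto
        moreover have "(y - a) / y = 1 - a / y" using y by (simp add: field_simps)
        ultimately have vy: "1 - a \<le> v / y" using ay by linarith
        have "u * (1 + 2 * a / u) = u + 2 * a" using u5 by (simp add: field_simps)
        hence "v \<le> u * (1 + 2 * a / u)" using v' by simp
        also have "\<dots> \<le> u * exp (2 * a / u)" using u5 by (intro mult_left_mono) auto
        also have "\<dots> \<le> u * exp (2 * a)" using u5 a by (intro mult_left_mono) (auto simp: field_simps)
        finally have "v powr (z+1) \<le> (u * exp (2 * a)) powr (z+1)" using v' u5 z by (intro powr_mono2) auto
        also have "\<dots> = u powr (z+1) * exp (2 * a * (z + 1))" using u5 by (simp add: powr_mult exp_powr_real)
        also have "\<dots> \<le> u powr (z+1) * exp (4 * a)" using z a by (intro mult_left_mono) auto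
        finally have v2: "v powr (z+1) \<le> u powr (z+1) * exp (4 * a)" .
        have "B y v = exp (- v / y) * (c * v powr (z+1))" using v' u5 by (simp add: B_def)
        also have "\<dots> \<le> exp (- 1 + a) * (c * (u powr (z+1) * exp (4 * a)))"
          using vy v2 c by (intro mult_mono) auto
        also have "\<dots> = Bu * exp (- 1 + 5 * a)" by (simp add: Bu_def mult_exp_exp)
        finally show "B y v \<le> Bu * exp (- 1 + 5 * a)" .
      qed (use y a Bu0 in auto)
      have "t * (27 * c * y^3) \<le> 27 * c" using mult_left_mono[OF t(3), of "27 * c"] c by (simp add: mult_ac)
      moreover have "27 * c \<le> 27 * c * u" using c u5 by (simp add: mult_le_cancel_left1)
      moreover have "M * y \<le> 2 * M * u" using mult_left_mono[OF y(3) M] by simp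
      ultimately have "X * exp (- 1 - 3 * a) * (1 - t) \<le> Bu * exp (- 1 + 5 * a) + (2 * M + 27 * c + 27) * u"
        using 1 2 J'[OF y(1)] u5 by (simp add: algebra_simps)
      hence "exp 1 * (X * exp (- 1 - 3 * a) * (1 - t)) \<le> exp 1 * (Bu * exp (- 1 + 5 * a) + (2 * M + 27 * c + 27) * u)"
        by (intro mult_left_mono) auto
      moreover have "exp 1 * (X * exp (- 1 - 3 * a) * (1 - t)) = X * exp (- (3 * a)) * (1 - t)"
        by (simp add: mult_exp_exp mult.left_commute mult.assoc[symmetric])
      moreover have "exp 1 * (Bu * exp (- 1 + 5 * a) + (2 * M + 27 * c + 27) * u) = Bu * exp (5 * a) + K * u"
        by (simp add: K_def mult_exp_exp distrib_left mult.left_commute mult.assoc[symmetric])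
      ultimately have 3: "X * exp (- (3 * a)) * (1 - t) \<le> Bu * exp (5 * a) + K * u" by simp
      \<comment> \<open>The lost tail mass is written as an exponential too, so that all losses add
        up in the exponent: 3 a + 2 a + 5 a = 10 a.\<close>
      have "exp (- (2 * a)) \<le> 1 - t"
      proof -
        have "exp (- (2 * a)) = 1 / exp (2 * a)" by (simp add: exp_minus field_simps)
        also have "\<dots> \<le> 1 / (1 + 2 * a)" using a by (intro divide_left_mono) auto
        also have "\<dots> \<le> 1 - a" using a by (simp add: field_simps)
        finally show ?thesis using t by linarith
      qed
      hence "X * exp (- (3 * a)) * exp (- (2 * a)) \<le> X * exp (- (3 * a)) * (1 - t)"
        using X0 by (intro mult_left_mono) auto
      also note 3
      also have "Bu * exp (5 * a) + K * u \<le> (Bu + K * u) * exp (5 * a)"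
      proof -
        have "K * u * 1 \<le> K * u * exp (5 * a)" using K u5 a by (intro mult_left_mono) auto
        thus ?thesis by (simp add: distrib_right)
      qed
      finally have "X * exp (- (5 * a)) \<le> (Bu + K * u) * exp (5 * a)" by (simp add: mult_exp_exp mult.assoc)
      hence "X * exp (- (5 * a)) * exp (5 * a) \<le> (Bu + K * u) * exp (5 * a) * exp (5 * a)" by (intro mult_right_mono) auto
      thus ?thesis by (simp add: mult_exp_exp mult.assoc)
    qed
    have lower: "Bu * (1 - 9 * a) - K * u \<le> X"
    proof -
      define y where "y = u - a"
      have y: "y \<ge> 1" "u / 2 \<le> y" "y \<le> 2 * u" using a u5 by (auto simp: y_def)
      define t where "t = 2 * exp (- (a^2 * y^2) / 4)"
      have t: "0 < t" "t \<le> a" "t * y^3 \<le> 1" using tau[OF y(2,3)] tau_a by (auto simp: t_def)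
      have ay: "a / y \<le> a" using a y by (simp add: field_simps)
      \<comment> \<open>The factor 1 - 4 a is Bernoulli's bound for (1 - 2 a)^2. Together with a
        from the damping, a from the tail mass and 3 a from the factor on \<open>X\<close>, this
        makes up the final 9 a.\<close>
      have 1: "Bu * (1 - 4 * a) * exp (- 1 - a) * (1 - t) \<le> ?IB y"
        unfolding t_def
      proof (rule normal_density_average(3)[OF _ _ mB B0 BK])
        fix v assume v: "\<bar>v - y\<bar> \<le> a"
        hence v': "u - 2 * a \<le> v" "v \<le> u" by (auto simp: y_def)
        have v0: "v > 0" using v' a u5 by linarith
        have "v / y \<le> (y + a) / y" using v y by (intro divide_right_mono) auto
        also have "\<dots> = 1 + a / y" using y by (simp add: field_simps)
        finally have vy: "v / y \<le> 1 + a" using ay by linarith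
        have b1: "0 < 1 - 2 * a" using a by auto
        have "u * (1 - 2 * a) \<le> u * (1 - 2 * a / u)" using u5 a by (intro mult_left_mono) (auto simp: field_simps)
        also have "\<dots> = u - 2 * a" using u5 by (simp add: field_simps)
        finally have "u * (1 - 2 * a) \<le> v" using v' by linarith
        hence "(u * (1 - 2 * a)) powr (z + 1) \<le> v powr (z+1)" using u5 a z b1 by (intro powr_mono2) auto
        moreover have "(u * (1 - 2 * a)) powr (z + 1) = u powr (z+1) * (1 - 2 * a) powr (z+1)" using u5 a b1 by (simp add: powr_mult)
        moreover have "(1 - 2 * a) powr 2 \<le> (1 - 2 * a) powr (z + 1)" using z a by (intro powr_mono') auto
        moreover have "1 - 4 * a \<le> (1 - 2 * a) powr 2" using b1 by (simp add: power2_eq_square algebra_simps)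
        ultimately have v2: "u powr (z+1) * (1 - 4 * a) \<le> v powr (z+1)"
          using mult_left_mono[of "1 - 4 * a" "(1 - 2 * a) powr (z+1)" "u powr (z+1)"] by simp
        have "Bu * (1 - 4 * a) * exp (- 1 - a) = exp (- 1 - a) * (c * (u powr (z+1) * (1 - 4 * a)))" by (simp add: Bu_def)
        also have "\<dots> \<le> exp (- v / y) * (c * v powr (z+1))"
          using vy v2 c a by (intro mult_mono) auto
        also have "\<dots> = B y v" using v0 by (simp add: B_def)
        finally show "Bu * (1 - 4 * a) * exp (- 1 - a) \<le> B y v" .
      qed (use y a Bu0 in auto)
      have 2: "?IA y \<le> X * exp (- 1 + 3 * a) + t * (27 * y^3)"
        unfolding t_def
      proof (rule normal_density_average(2)[OF _ _ mA A0 AK])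
        fix v assume v: "\<bar>v - y\<bar> \<le> a"
        hence v': "u - 2 * a \<le> v" "v \<le> u" by (auto simp: y_def)
        have v0: "v > 0" using v' a u5 by linarith
        have "(y - a) / y \<le> v / y" using v y by (intro divide_right_mono) auto
        moreover have "(y - a) / y = 1 - a / y" using y by (simp add: field_simps)
        ultimately have vy: "1 - a \<le> v / y" using ay by linarith
        have "A y v = exp (- v / y) * (v^2 * T v * exp (- v))" using v0 by (simp add: A_def)
        also have "\<dots> \<le> exp (-1 + a) * (u^2 * T u * exp (- u + 2 * a))"
          using vy v' v0 T0 monoD[OF mono v'(2)] by (intro mult_mono power_mono) auto
        also have "\<dots> = X * exp (- 1 + 3 * a)" by (simp add: X_def mult_exp_exp algebra_simps)
        finally show "A y v \<le> X * exp (- 1 + 3 * a)" .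
      qed (use y a X0 in auto)
      have "t * (27 * y^3) \<le> 27 * u" using t(3) u5 by linarith
      moreover have "M * y \<le> 2 * M * u" using mult_left_mono[OF y(3) M] by simp
      moreover have "0 \<le> 27 * c * u" using c u5 by simp
      ultimately have "Bu * (1 - 4 * a) * exp (- 1 - a) * (1 - t) \<le> X * exp (- 1 + 3 * a) + (2 * M + 27 * c + 27) * u"
        using 1 2 J'[OF y(1)] by (simp add: algebra_simps)
      hence "exp 1 * (Bu * (1 - 4 * a) * exp (- 1 - a) * (1 - t)) \<le> exp 1 * (X * exp (- 1 + 3 * a) + (2 * M + 27 * c + 27) * u)"
        by (intro mult_left_mono) auto
      moreover have "exp 1 * (Bu * (1 - 4 * a) * exp (- 1 - a) * (1 - t)) = Bu * (1 - 4 * a) * exp (- a) * (1 - t)"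
        by (simp add: mult_exp_exp mult.left_commute mult.assoc[symmetric])
      moreover have "exp 1 * (X * exp (- 1 + 3 * a) + (2 * M + 27 * c + 27) * u) = X * exp (3 * a) + K * u"
        by (simp add: K_def mult_exp_exp distrib_left mult.left_commute mult.assoc[symmetric])
      ultimately have 3: "Bu * (1 - 4 * a) * exp (- a) * (1 - t) \<le> X * exp (3 * a) + K * u" by simp
      have "(1 - 4 * a) * (1 - a) * (1 - a) \<le> (1 - 4 * a) * exp (- a) * (1 - t)"
        using a t exp_ge_add_one_self[of "-a"] by (intro mult_mono) auto
      moreover have "1 - 6 * a \<le> (1 - 4 * a) * (1 - a) * (1 - a)"
      proof -
        have "(1 - 4 * a) * (1 - a) * (1 - a) = 1 - 6 * a + a * a * (9 - 4 * a)" by (simp add: algebra_simps)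
        moreover have "0 \<le> a * a * (9 - 4 * a)" using a by (intro mult_nonneg_nonneg) auto
        ultimately show ?thesis by linarith
      qed
      ultimately have "Bu * (1 - 6 * a) \<le> Bu * ((1 - 4 * a) * exp (- a) * (1 - t))"
        using Bu0 by (intro mult_left_mono) auto
      with 3 have 4: "Bu * (1 - 6 * a) - K * u \<le> X * exp (3 * a)" by (simp add: mult_ac)
      have "(Bu * (1 - 6 * a) - K * u) * exp (- (3 * a)) \<le> X * exp (3 * a) * exp (- (3 * a))"
        using 4 by (intro mult_right_mono) auto
      hence 5: "Bu * (1 - 6 * a) * exp (- (3 * a)) - K * u * exp (- (3 * a)) \<le> X" by (simp add: mult_exp_exp mult.assoc left_diff_distrib)
      have "K * u * exp (- (3 * a)) \<le> K * u * 1" using K u5 a by (intro mult_left_mono) auto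
      moreover have "Bu * (1 - 9 * a) \<le> Bu * ((1 - 6 * a) * exp (- (3 * a)))"
      proof (intro mult_left_mono Bu0)
        have "1 - 9 * a \<le> (1 - 6 * a) * (1 - 3 * a)" using a by (simp add: algebra_simps)
        also have "\<dots> \<le> (1 - 6 * a) * exp (- (3 * a))" using a exp_ge_add_one_self[of "- (3 * a)"] by (intro mult_left_mono) auto
        finally show "1 - 9 * a \<le> (1 - 6 * a) * exp (- (3 * a))" .
      qed
      ultimately show ?thesis using 5 by (simp add: mult_ac)
    qed
    have "exp (10 * a) \<le> 1 + 10 * a + (10 * a)^2"
      using a by (intro exp_bound) auto
    also have "(10 * a)^2 \<le> 10 * a" using a by (simp add: power2_eq_square)
    finally have ea: "exp (10 * a) \<le> 1 + 20 * a" by simp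
    have "X \<le> (Bu + K * u) * (1 + 20 * a)"
      using upper mult_left_mono[OF ea, of "Bu + K * u"] Bu0 K u5 by simp
    also have "\<dots> \<le> Bu + 20 * a * Bu + 3 * K * u"
      using mult_right_mono[of "20 * a" 2 "K * u"] K u5 a by (simp add: algebra_simps)
    finally have Xu: "X \<le> Bu + 20 * a * Bu + 3 * K * u" .
    have "\<bar>X - Bu\<bar> \<le> 20 * a * Bu + 3 * K * u"
    proof -
      have "0 \<le> a * Bu" "0 \<le> K * u" using a Bu0 K u5 by auto
      thus ?thesis using lower Xu by (simp add: algebra_simps abs_le_iff)
    qed
    hence "\<bar>X - Bu\<bar> / u^2 \<le> (20 * a * Bu + 3 * K * u) / u^2" by (intro divide_right_mono) auto
    also have "(20 * a * Bu + 3 * K * u) / u^2 = 80 * c * (u powr (z - 2) * ln u) + 3 * K * (1 / u)"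
      using u5 by (simp add: a_def Bu_def powr_add powr_diff field_simps power2_eq_square power3_eq_cube)
    also have "\<dots> \<le> (80 * c + 3 * K) * (1 / u + u powr (z - 2) * ln u)"
      using c K u5 lnu by (simp add: algebra_simps)
    also have "\<bar>X - Bu\<bar> / u^2 = \<bar>(X - Bu) / u^2\<bar>" by simp
    also have "(X - Bu) / u^2 = T u * exp (- u) - c * u powr (z - 1)"
      using u5 by (simp add: X_def Bu_def powr_add powr_diff field_simps power2_eq_square)
    finally show ?thesis .
  qed
  show ?thesis
  proof (rule bigoI)
    have "\<forall>\<^sub>F u::real in at_top. 40 * ln u \<le> u" by real_asymp
    with eventually_ge_at_top[of "exp 4"]
    show "\<forall>\<^sub>F u in at_top. norm (T u * exp (- u) - c * u powr (z - 1)) \<le> (80 * c + 3 * K) * norm (1 / u + u powr (z - 2) * ln u)"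
    proof eventually_elim
      case (elim u)
      have "u \<ge> 5" using exp_ge_add_one_self[of 4] elim by linarith
      hence "1 / u + u powr (z - 2) * ln u \<ge> 0" by auto
      thus ?case using main[of u] elim by simp
    qed
  qed
qed

text \<open>The width of the average and the abscissa are both 1 / y. The constant part of the bound
  contributes sqrt (2 pi) y, the part |w|^(-2) contributes pi y; the sum is at most 2 pi y, and the
  2 pi cancels against that of Fourier inversion.\<close>

lemma normal_density_laplace_bound:
  fixes q :: "real \<Rightarrow> real"
  assumes q: "laplaceable (\<lambda>v. complex_of_real (q v))" and M: "M \<ge> 0" and y: "y \<ge> 1"
    and bd: "\<And>w. 0 < Re w \<Longrightarrow> Re w \<le> 1 \<Longrightarrow> norm (laplace (\<lambda>v. complex_of_real (q v)) w) \<le> M * (1 + 1 / (norm w)^2)"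
  shows "\<bar>LBINT v. normal_density y (1/y) v * (exp (- v / y) * q v)\<bar> \<le> M * y"
proof -
  define s where "s = 1 / y"
  have s: "0 < s" "s \<le> 1" using y by (auto simp: s_def)
  let ?L = "\<lambda>t. laplace (\<lambda>v. complex_of_real (q v)) (Complex s t)"
  let ?g = "\<lambda>t. exp (- (s^2 * t^2) / 2)"
  have g: "integrable lborel ?g" "(LBINT t. ?g t) = 2 * pi * normal_density 0 s 0"
  proof -
    show "integrable lborel ?g" by (rule gaussian_fourier(1)[OF s(1)])
    have "complex_of_real (LBINT t. ?g t) = of_real (2 * pi * normal_density 0 s 0)"
      using gaussian_fourier(2)[OF s(1), of 0] by simp
    thus "(LBINT t. ?g t) = 2 * pi * normal_density 0 s 0" by (simp only: of_real_eq_iff)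
  qed
  note h = inverse_square_plus_integrable[OF s(1)]
  have i: "integrable lborel (\<lambda>t. M * ?g t + M * (1 / (s^2 + t^2)))"
    by (intro Bochner_Integration.integrable_add integrable_mult_right g h)
  \<comment> \<open>A non-integrable f has integral 0 by default, and the right-hand side is
    nonnegative, so both cases are covered without a measurability proof for the transform.\<close>
  have *: "norm (LBINT t. f t) \<le> (LBINT t. M * ?g t + M * (1 / (s^2 + t^2)))"
    if "\<And>t. norm (f t) \<le> M * ?g t + M * (1 / (s^2 + t^2))" for f :: "real \<Rightarrow> complex"
  proof (cases "integrable lborel f")
    case True
    show ?thesis by (rule Bochner_Integration.integral_norm_bound_integral[OF True i that])
  next
    case False
    have "0 \<le> (LBINT t. M * ?g t + M * (1 / (s^2 + t^2)))"
      using M by (intro Bochner_Integration.integral_nonneg) auto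
    thus ?thesis using False by (simp add: not_integrable_integral_eq)
  qed
  have F: "2 * of_real pi * (LBINT v. of_real (normal_density y s v) * (exp (- of_real (s * v)) * complex_of_real (q v))) =
      (LBINT t. of_real (?g t) * exp (\<i> * of_real (t * y)) * ?L t)"
    by (rule gaussian_laplace_fubini[OF q s(1) s(1)])
  have "norm (2 * complex_of_real pi * (LBINT v. of_real (normal_density y s v) * (exp (- of_real (s * v)) * complex_of_real (q v)))) \<le> (LBINT t. M * ?g t + M * (1 / (s^2 + t^2)))"
    unfolding F
  proof (rule *)
    fix t :: real
    have nw: "(norm (Complex s t))^2 = s^2 + t^2" by (simp add: cmod_power2)
    have "norm (of_real (?g t) * exp (\<i> * of_real (t * y)) * ?L t) = ?g t * norm (?L t)"
      by (simp add: norm_mult)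
    also have "\<dots> \<le> ?g t * (M * (1 + 1 / (norm (Complex s t))^2))"
      using bd[of "Complex s t"] s by (intro mult_left_mono) auto
    also have "\<dots> = M * ?g t + ?g t * (M * (1 / (s^2 + t^2)))" by (simp add: nw algebra_simps)
    also have "\<dots> \<le> M * ?g t + 1 * (M * (1 / (s^2 + t^2)))"
      using M by (intro add_left_mono mult_right_mono) auto
    finally show "norm (of_real (?g t) * exp (\<i> * of_real (t * y)) * ?L t) \<le> M * ?g t + M * (1 / (s^2 + t^2))" by simp
  qed
  also have "\<dots> = M * (LBINT t. ?g t) + M * (LBINT t. 1 / (s^2 + t^2))"
    by (subst Bochner_Integration.integral_add[OF integrable_mult_right[OF g(1)] integrable_mult_right[OF h(1)]])
      (simp only: integral_mult_right_zero)
  also have "\<dots> = M * (2 * pi * normal_density 0 s 0 + pi / s)" unfolding g h by (simp add: distrib_left)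
  also have "2 * pi * normal_density 0 s 0 = sqrt (2 * pi) * y"
  proof -
    have "2 * pi * normal_density 0 s 0 = (2 * pi) / (sqrt (2 * pi) * s)"
      using s by (simp add: normal_density_def real_sqrt_mult)
    also have "\<dots> = (2 * pi) / sqrt (2 * pi) * y" using y by (simp add: s_def)
    also have "(2 * pi) / sqrt (2 * pi) = sqrt (2 * pi)" by (rule real_div_sqrt) simp
    finally show ?thesis .
  qed
  also have "sqrt (2 * pi) * y + pi / s = (sqrt (2 * pi) + pi) * y" by (simp add: s_def algebra_simps)
  finally have 1: "norm (2 * complex_of_real pi * (LBINT v. of_real (normal_density y s v) * (exp (- of_real (s * v)) * complex_of_real (q v)))) \<le> M * ((sqrt (2 * pi) + pi) * y)" .
  have "(LBINT v. of_real (normal_density y s v) * (exp (- of_real (s * v)) * complex_of_real (q v))) =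
      (LBINT v. complex_of_real (normal_density y (1/y) v * (exp (- v / y) * q v)))"
    by (intro Bochner_Integration.integral_cong) (auto simp: s_def exp_of_real[symmetric])
  hence 2: "2 * pi * \<bar>LBINT v. normal_density y (1/y) v * (exp (- v / y) * q v)\<bar> \<le> M * ((sqrt (2 * pi) + pi) * y)"
  proof -
    have "(LBINT v. complex_of_real (normal_density y (1/y) v * (exp (- v / y) * q v))) =
        complex_of_real (LBINT v. normal_density y (1/y) v * (exp (- v / y) * q v))"
      by (rule integral_complex_of_real)
    hence "norm (2 * complex_of_real pi * complex_of_real (LBINT v. normal_density y (1/y) v * (exp (- v / y) * q v))) \<le> M * ((sqrt (2 * pi) + pi) * y)"
      using 1 \<open>_ = (LBINT v. complex_of_real (normal_density y (1/y) v * (exp (- v / y) * q v)))\<close> by (simp only:)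
    thus ?thesis by (simp only: norm_mult norm_of_real) simp
  qed
  have "sqrt (2 * pi) \<le> pi"
  proof (rule real_le_lsqrt)
    show "2 * pi \<le> pi^2" using pi_gt3 by (simp add: power2_eq_square)
  qed simp
  hence "M * ((sqrt (2 * pi) + pi) * y) \<le> M * (2 * pi * y)"
    using M y by (intro mult_left_mono mult_right_mono) auto
  from order_trans[OF 2 this]
  have "2 * pi * \<bar>LBINT v. normal_density y (1/y) v * (exp (- v / y) * q v)\<bar> \<le> 2 * pi * (M * y)"
    by (simp only: mult_ac)
  thus ?thesis by (rule mult_left_le_imp_le) simp
qed

lemma laplaceable_diff:
  "laplaceable p \<Longrightarrow> laplaceable q \<Longrightarrow> laplaceable (\<lambda>v. p v - q v)"
  by (auto simp: laplaceable_def right_diff_distrib)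

lemma laplaceable_cmult: "laplaceable p \<Longrightarrow> laplaceable (\<lambda>v. c * p v)"
  by (auto simp: laplaceable_def mult.left_commute[of _ c])

lemma laplace_diff:
  "laplaceable p \<Longrightarrow> laplaceable q \<Longrightarrow> Re w > 0 \<Longrightarrow> laplace (\<lambda>v. p v - q v) w = laplace p w - laplace q w"
  unfolding laplace_def
  by (subst Bochner_Integration.integral_diff[symmetric])
    (auto intro: laplaceable_integrable[where q=p, simplified] laplaceable_integrable[where q=q, simplified] simp: right_diff_distrib)

lemma laplace_cmult: "laplace (\<lambda>v. c * p v) w = c * laplace p w"
  unfolding laplace_def by (simp add: mult.left_commute[of _ c])

text \<open>Here c is the coefficient of w^(-z) in f near 0, and c z (z + 1) w^(-z-2) is the second
  derivative of that singular part. It is the transform of c / Gamma z times v^(z+1), because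
  Gamma(z + 2) = z (z + 1) Gamma z.\<close>

theorem tauberian:
  fixes T :: "real \<Rightarrow> real" and z c M :: real and f f' f'' :: "complex \<Rightarrow> complex"
  defines "q \<equiv> \<lambda>v. if v > 0 then complex_of_real (T v * exp (- v)) else 0"
  assumes mono: "mono T" and T0: "\<And>v. T v \<ge> 0" and Tle: "\<And>v. v \<ge> 0 \<Longrightarrow> T v \<le> (1 + v) * exp v"
    and z: "0 < z" "z \<le> 1" and c: "c \<ge> 0" and M: "M \<ge> 0"
    and q: "laplaceable q"
    and L: "\<And>w. Re w > 0 \<Longrightarrow> laplace q w = f w"
    and f1: "\<And>w. Re w > 0 \<Longrightarrow> (f has_field_derivative f' w) (at w)"
    and f2: "\<And>w. Re w > 0 \<Longrightarrow> (f' has_field_derivative f'' w) (at w)"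
    and bd: "\<And>w. 0 < Re w \<Longrightarrow> Re w \<le> 1 \<Longrightarrow>
       norm (f'' w - of_real (c * z * (z + 1)) * w powr of_real (- z - 2)) \<le> M * (1 + 1 / (norm w)^2)"
  shows "(\<lambda>u. T u * exp (- u) - c / Gamma z * u powr (z - 1)) \<in> O(\<lambda>u. 1 / u + u powr (z - 2) * ln u)"
proof (rule desmoothing[OF mono T0 Tle z _ M])
  have Gz: "Gamma z > 0" using z by simp
  show "0 \<le> c / Gamma z" using c Gz by simp
  define q2 where "q2 = (\<lambda>v. (if v > 0 then v^2 * T v * exp (- v) else 0) - (if v > 0 then c / Gamma z * v powr (z+1) else 0))"
  have q2: "complex_of_real (q2 v) = of_real v * (of_real v * q v) - of_real (c / Gamma z) * pow_fun (z+1) v" for v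
    by (simp add: q2_def q_def pow_fun_def power2_eq_square)
  have l1: "laplaceable (\<lambda>v. of_real v * (of_real v * q v))" by (intro laplaceable_times q)
  have l2: "laplaceable (\<lambda>v. of_real (c / Gamma z) * pow_fun (z+1) v)"
    using z by (intro laplaceable_cmult laplaceable_pow_fun) auto
  have l: "laplaceable (\<lambda>v. complex_of_real (q2 v))"
    unfolding q2 by (rule laplaceable_diff[OF l1 l2])
  have lw: "laplace (\<lambda>v. complex_of_real (q2 v)) w = f'' w - of_real (c * z * (z + 1)) * w powr of_real (- z - 2)"
    if w: "Re w > 0" for w
  proof -
    have "laplace (\<lambda>v. complex_of_real (q2 v)) w = f'' w - of_real (c / Gamma z) * (of_real (Gamma (z + 1 + 1)) * w powr of_real (- (z + 1) - 1))"
      unfolding q2 laplace_diff[OF l1 l2 w] laplace_cmult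
    proof (intro arg_cong2[of _ _ _ _ "(-)"] arg_cong2[of _ _ _ _ "(*)"] refl)
      show "laplace (\<lambda>v. complex_of_real v * (complex_of_real v * q v)) w = f'' w"
        by (rule deriv2_laplace[OF q w L f1 f2])
      show "laplace (pow_fun (z + 1)) w = of_real (Gamma (z + 1 + 1)) * w powr of_real (- (z + 1) - 1)"
        by (rule laplace_pow_fun) (use z w in auto)
    qed
    also have "Gamma (z + 1 + 1) = (z + 1) * (z * Gamma z)"
    proof -
      have "z \<notin> \<int>\<^sub>\<le>\<^sub>0" "z + 1 \<notin> \<int>\<^sub>\<le>\<^sub>0" using z by (auto dest: nonpos_Ints_nonpos)
      thus ?thesis using Gamma_plus1[of z] Gamma_plus1[of "z+1"] by simp
    qed
    also have "of_real (c / Gamma z) * (of_real ((z + 1) * (z * Gamma z)) * w powr of_real (- (z + 1) - 1))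
       = of_real (c * z * (z + 1)) * w powr of_real (- z - 2)"
    proof -
      have 1: "c / Gamma z * ((z + 1) * (z * Gamma z)) = c * z * (z + 1)" using Gz by (simp add: field_simps)
      have 2: "- (z + 1) - 1 = - z - 2" by simp
      have "of_real (c / Gamma z) * (of_real ((z + 1) * (z * Gamma z)) * w powr of_real (- z - 2))
          = of_real (c / Gamma z * ((z + 1) * (z * Gamma z))) * w powr of_real (- z - 2)"
        by (simp only: of_real_mult mult.assoc)
      thus ?thesis unfolding 1 2 .
    qed

    finally show ?thesis .
  qed
  fix y :: real assume y: "y \<ge> 1"
  show "\<bar>LBINT v. normal_density y (1/y) v * (exp (- v / y) * ((if v > 0 then v^2 * T v * exp (- v) else 0) - (if v > 0 then c / Gamma z * v powr (z+1) else 0)))\<bar> \<le> M * y"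
    using normal_density_laplace_bound[OF l M y] bd lw unfolding q2_def by simp
qed

section \<open>Divisor sums and Euler products\<close>

lemma divisor_count_mult:
  assumes "coprime a b" "a > 0" "b > 0"
  shows "divisor_count (a * b) = divisor_count a * divisor_count b"
proof -
  let ?D = "\<lambda>n::nat. {d. d dvd n}"
  have inj: "inj_on (\<lambda>(x,y). x * y) (?D a \<times> ?D b)"
  proof (rule inj_onI, clarsimp)
    fix x y x' y' assume *: "x dvd a" "y dvd b" "x' dvd a" "y' dvd b" "x * y = x' * y'"
    have "coprime x y'" "coprime x' y" using * assms by (meson coprime_divisors)+
    hence "x dvd x'" "x' dvd x" using *(5) by (metis coprime_dvd_mult_left_iff dvd_triv_left)+
    hence "x = x'" by (rule dvd_antisym)
    moreover have "x > 0" using * assms by (meson dvd_pos_nat)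
    ultimately show "x = x' \<and> y = y'" using *(5) by simp
  qed
  have "?D (a * b) = (\<lambda>(x,y). x * y) ` (?D a \<times> ?D b)"
  proof (intro equalityI subsetI)
    fix d assume "d \<in> ?D (a * b)"
    then obtain x y where "d = x * y" "x dvd a" "y dvd b" using division_decomp[of d a b] by blast
    thus "d \<in> (\<lambda>(x,y). x * y) ` (?D a \<times> ?D b)" by auto
  qed (auto intro: mult_dvd_mono)
  thus ?thesis using card_image[OF inj] by (simp add: divisor_count_def card_cartesian_product)
qed

lemma omega_mult:
  assumes "coprime a b" "a > 0" "b > 0"
  shows "omega (a * b) = omega a + omega b"
proof -
  have "{p. prime p \<and> p dvd a * b} = {p. prime p \<and> p dvd a} \<union> {p. prime p \<and> p dvd b}"
    by (auto simp: prime_dvd_mult_iff)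
  moreover have "{p. prime p \<and> p dvd a} \<inter> {p. prime p \<and> p dvd b} = {}"
  proof -
    have False if "prime p" "p dvd a" "p dvd b" for p
      using coprime_common_divisor[OF assms(1) that(2,3)] that(1) not_prime_unit by blast
    thus ?thesis by blast
  qed
  moreover have "finite {p. prime p \<and> p dvd a}" "finite {p. prime p \<and> p dvd b}"
    using assms by auto
  ultimately show ?thesis by (simp add: omega_def card_Un_disjoint)
qed

lemma D_omega_mult:
  assumes "coprime a b" "a > 0" "b > 0"
  shows "D_omega k (a * b) = D_omega k a * D_omega k b"
  using divisor_count_mult[OF assms] omega_mult[OF assms] by (simp add: D_omega_def power_add)

lemma D_omega_1: "D_omega k 1 = 1"
proof -
  have "{p::nat. prime p \<and> p dvd 1} = {}" using not_prime_unit by blast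
  hence "omega 1 = 0" by (simp only: omega_def card.empty)
  thus ?thesis by (simp add: D_omega_def divisor_count_def)
qed

lemma D_omega_prime_power:
  assumes "prime p" "m > 0"
  shows "D_omega k (p ^ m) = real (m + 1) / real k"
proof -
  have "{d. d dvd p ^ m} = (\<lambda>i. p ^ i) ` {..m}"
    using assms by (auto simp: divides_primepow_nat image_iff le_imp_power_dvd)
  moreover have "inj_on (\<lambda>i. p ^ i) {..m}"
    using assms power_inject_exp[OF prime_gt_1_nat[OF assms(1)]] by (auto intro!: inj_onI)
  ultimately have "divisor_count (p ^ m) = m + 1" by (simp add: divisor_count_def card_image)
  moreover have "{q. prime q \<and> q dvd p ^ m} = {p}"
    using assms by (auto simp: prime_dvd_power_iff primes_dvd_imp_eq)
  hence "omega (p ^ m) = 1" by (simp add: omega_def)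
  ultimately show ?thesis by (simp add: D_omega_def)
qed

lemma D_omega_nonneg: "D_omega k n \<ge> 0" by (simp add: D_omega_def)

lemma D_omega_0: "D_omega k 0 = 0"
  by (simp add: D_omega_def divisor_count_def)

lemma D_omega_le: "k \<ge> 1 \<Longrightarrow> D_omega k n \<le> real (divisor_count n)"
  by (simp add: D_omega_def field_simps mult_le_cancel_left1)

text \<open>Pairs (n, d) with d dividing n correspond to factorizations n = a b. The weight h is
  left free: h = 1 gives the growth bound, h = n^(-s) the convergence of the Dirichlet
  series.\<close>

lemma sum_divisor_count:
  fixes h :: "nat \<Rightarrow> real"
  shows "(\<Sum>n=1..N. real (divisor_count n) * h n) = (\<Sum>a=1..N. \<Sum>b=1..N div a. h (a * b))"
proof -
  have aux: "b \<le> N" if "b * k \<le> N" "0 < k" for b k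
    using that by (metis One_nat_def Suc_leI le_trans mult.right_neutral mult_le_mono2)
  have "(\<Sum>n=1..N. real (divisor_count n) * h n) = (\<Sum>n=1..N. \<Sum>d | d dvd n. h n)"
    by (simp add: divisor_count_def)
  also have "\<dots> = (\<Sum>(n,d)\<in>(SIGMA n:{1..N}. {d. d dvd n}). h n)"
    by (rule sum.Sigma) auto
  also have "\<dots> = (\<Sum>(a,b)\<in>(SIGMA a:{1..N}. {1..N div a}). h (a * b))"
    by (rule sum.reindex_bij_witness[of _ "\<lambda>(a,b). (a * b, a)" "\<lambda>(n,d). (d, n div d)"])
      (auto simp: Suc_le_eq dvd_imp_le dvd_pos_nat div_le_mono less_eq_div_iff_mult_less_eq mult.commute
        intro: le_trans[OF dvd_imp_le] aux elim!: dvdE)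
  also have "\<dots> = (\<Sum>a=1..N. \<Sum>b=1..N div a. h (a * b))"
    by (rule sum.Sigma[symmetric]) auto
  finally show ?thesis .
qed

lemma harmonic_le:
  assumes "N \<ge> 1"
  shows "(\<Sum>a=1..N. 1 / real a) \<le> 1 + ln (real N)"
  using assms
proof (induction N rule: dec_induct)
  case (step n)
  have "ln (real n / real (Suc n)) \<le> real n / real (Suc n) - 1"
    using step by (intro ln_le_minus_one) auto
  also have "\<dots> = - 1 / real (Suc n)" by (simp add: field_simps)
  finally have "1 / real (Suc n) \<le> ln (real (Suc n)) - ln (real n)"
    using step by (simp add: ln_div)
  thus ?case using step by simp
qed auto

text \<open>The trivial bound for the divisor sum; it supplies the growth hypothesis of
  \<open>tauberian\<close>.\<close>

lemma sum_D_omega_le: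
  assumes "k \<ge> 1" "x \<ge> 1"
  shows "(\<Sum>n | 1 \<le> n \<and> real n \<le> x. D_omega k n) \<le> x * (1 + ln x)"
proof -
  define N where "N = nat \<lfloor>x\<rfloor>"
  have N: "N \<ge> 1" "real N \<le> x" using assms by (auto simp: N_def le_nat_floor)
  have eq: "{n. 1 \<le> n \<and> real n \<le> x} = {1..N}" using assms by (auto simp: N_def le_nat_floor) linarith
  have "(\<Sum>n | 1 \<le> n \<and> real n \<le> x. D_omega k n) \<le> (\<Sum>n=1..N. real (divisor_count n) * 1)"
    unfolding eq using D_omega_le[OF assms(1)] by (intro sum_mono) auto
  also have "\<dots> = (\<Sum>a=1..N. real (N div a))" by (subst sum_divisor_count) simp
  also have "\<dots> \<le> (\<Sum>a=1..N. real N * (1 / real a))"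
    by (intro sum_mono) (simp add: of_nat_div_le_of_nat)
  also have "\<dots> = real N * (\<Sum>a=1..N. 1 / real a)" by (rule sum_distrib_left[symmetric])
  also have "\<dots> \<le> x * (1 + ln x)"
    using N harmonic_le[OF N(1)] assms by (intro mult_mono order_trans[OF harmonic_le[OF N(1)]] sum_nonneg) auto
  finally show ?thesis .
qed

lemma summable_powr: "s > 1 \<Longrightarrow> summable (\<lambda>n. real n powr (- s))"
  by (subst summable_real_powr_iff) auto

text \<open>Dominated by the divisor function, the partial sums stay below the square of the sum of
  n^(-s).\<close>

lemma summable_D_omega:
  assumes k: "k \<ge> 1" and s: "s > 1"
  shows "summable (\<lambda>n. D_omega k n * real n powr (- s))"
proof (rule summableI_nonneg_bounded)
  let ?Z = "\<Sum>n. real n powr (- s)"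
  fix N
  have "(\<Sum>n<N. D_omega k n * real n powr (- s)) \<le> (\<Sum>n\<in>{0..N}. D_omega k n * real n powr (- s))"
    using D_omega_nonneg by (intro sum_mono2) auto
  also have "\<dots> = (\<Sum>n=1..N. D_omega k n * real n powr (- s))"
    by (rule sum.mono_neutral_right) (auto simp: Suc_le_eq)
  also have "\<dots> \<le> (\<Sum>n=1..N. real (divisor_count n) * real n powr (- s))"
    using D_omega_le[OF k] by (intro sum_mono mult_right_mono) auto
  also have "\<dots> = (\<Sum>a=1..N. \<Sum>b=1..N div a. real (a * b) powr (- s))" by (rule sum_divisor_count)
  also have "\<dots> = (\<Sum>a=1..N. real a powr (- s) * (\<Sum>b=1..N div a. real b powr (- s)))"
    by (simp add: powr_mult sum_distrib_left)
  also have "\<dots> \<le> (\<Sum>a=1..N. real a powr (- s) * ?Z)"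
    by (intro sum_mono mult_left_mono sum_le_suminf summable_powr s) auto
  also have "\<dots> = (\<Sum>a=1..N. real a powr (- s)) * ?Z" by (rule sum_distrib_right[symmetric])
  also have "\<dots> \<le> ?Z * ?Z"
    by (intro mult_right_mono sum_le_suminf summable_powr s suminf_nonneg) auto
  finally show "(\<Sum>n<N. D_omega k n * real n powr (- s)) \<le> ?Z * ?Z" .
qed (use D_omega_nonneg in auto)

section \<open>Euler products\<close>

definition smooth_over :: "nat set \<Rightarrow> nat set" where
  "smooth_over P = {n. n > 0 \<and> (\<forall>q. prime q \<longrightarrow> q dvd n \<longrightarrow> q \<in> P)}"

text \<open>Adding a prime p to P corresponds to the unique decomposition N = p^m n with p not
  dividing n. Absolute convergence allows unordered sums, so the sum over pairs (m, n) factors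
  regardless of the order of summation.\<close>

lemma infsum_smooth_over:
  fixes f :: "nat \<Rightarrow> complex"
  assumes mult: "\<And>p m n. prime p \<Longrightarrow> \<not> p dvd n \<Longrightarrow> n > 0 \<Longrightarrow> f (p ^ m * n) = f (p ^ m) * f n"
    and f1: "f 1 = 1" and sm: "summable (\<lambda>n. norm (f n))"
    and P: "finite P" "\<And>p. p \<in> P \<Longrightarrow> prime p"
  shows "infsum f (smooth_over P) = (\<Prod>p\<in>P. \<Sum>m. f (p ^ m))"
  using P
proof (induction P rule: finite_induct)
  case empty
  have "smooth_over {} = {1}" by (auto simp: smooth_over_def) (metis prime_factor_nat not_less_eq One_nat_def)
  thus ?case using f1 by simp
next
  case (insert p P)
  have p: "prime p" using insert by auto
  have fU: "f summable_on UNIV" by (rule norm_summable_imp_summable_on[OF sm])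
  have fS: "f summable_on A" for A using summable_on_subset_banach[OF fU] by simp
  have ndvd: "\<not> p dvd n" if "n \<in> smooth_over P" for n
    using that insert p by (auto simp: smooth_over_def)
  let ?g = "\<lambda>(m,n). p ^ m * n"
  have bij: "bij_betw ?g (UNIV \<times> smooth_over P) (smooth_over (insert p P))"
  proof (rule bij_betwI')
    fix x y :: "nat \<times> nat" assume *: "x \<in> UNIV \<times> smooth_over P" "y \<in> UNIV \<times> smooth_over P"
    obtain m n m' n' where xy: "x = (m, n)" "y = (m', n')" by (cases x, cases y) auto
    have n: "\<not> p dvd n" "\<not> p dvd n'" using * ndvd by (auto simp: xy)
    have "m = m' \<and> n = n'" if eq: "p ^ m * n = p ^ m' * n'"
    proof -
      have "multiplicity p (p ^ m * n) = m" "multiplicity p (p ^ m' * n') = m'"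
        using n p by (auto intro!: multiplicity_eqI simp: mult.commute[of "p ^ _"] prime_gt_0_nat)
      hence "m = m'" using eq by simp
      thus ?thesis using eq p by (simp add: prime_gt_0_nat)
    qed
    thus "(?g x = ?g y) = (x = y)" by (auto simp: xy)
  next
    fix x :: "nat \<times> nat" assume "x \<in> UNIV \<times> smooth_over P"
    thus "?g x \<in> smooth_over (insert p P)"
      using p by (auto simp: smooth_over_def prime_dvd_mult_iff prime_gt_0_nat)
        (metis prime_dvd_power primes_dvd_imp_eq)
  next
    fix N assume N: "N \<in> smooth_over (insert p P)"
    hence N0: "N \<noteq> 0" by (auto simp: smooth_over_def)
have pu: "\<not> is_unit p" using p not_prime_unit by blast
    from multiplicity_decompose'[OF N0 pu]
    obtain n where n: "N = p ^ multiplicity p N * n" "\<not> p dvd n" .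
        have "n \<in> smooth_over P" using N n N0 unfolding smooth_over_def
      by (auto intro: Nat.gr0I) (metis dvd_mult insertE)
    thus "\<exists>x\<in>UNIV \<times> smooth_over P. N = ?g x" using n by (intro bexI[of _ "(multiplicity p N, n)"]) auto
  qed
  have "infsum f (smooth_over (insert p P)) = infsum (\<lambda>x. f (?g x)) (UNIV \<times> smooth_over P)"
    by (rule infsum_reindex_bij_betw[OF bij, symmetric])
  also have "\<dots> = infsum (\<lambda>(m,n). f (p ^ m) * f n) (UNIV \<times> smooth_over P)"
    using mult[OF p ndvd] by (intro infsum_cong) (auto simp: smooth_over_def)
  also have "\<dots> = (\<Sum>\<^sub>\<infinity>m\<in>UNIV. \<Sum>\<^sub>\<infinity>n\<in>smooth_over P. f (p ^ m) * f n)"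
  proof (rule infsum_Sigma'_banach[symmetric])
    have "(\<lambda>x. f (?g x)) summable_on (UNIV \<times> smooth_over P)"
      using summable_on_reindex_bij_betw[OF bij, of f] fS by simp
    moreover have "(\<lambda>x. f (?g x)) summable_on (UNIV \<times> smooth_over P) \<longleftrightarrow> (\<lambda>(m,n). f (p ^ m) * f n) summable_on (UNIV \<times> smooth_over P)"
      using mult[OF p ndvd] by (intro summable_on_cong) (auto simp: smooth_over_def)
    ultimately show "(\<lambda>(m,n). f (p ^ m) * f n) summable_on (UNIV \<times> smooth_over P)" by simp
  qed
  also have "\<dots> = (\<Sum>\<^sub>\<infinity>m\<in>UNIV. f (p ^ m)) * infsum f (smooth_over P)"
    by (simp add: infsum_cmult_right' infsum_cmult_left')
  also have "(\<Sum>\<^sub>\<infinity>m\<in>UNIV. f (p ^ m)) = (\<Sum>m. f (p ^ m))"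
  proof -
    have inj: "inj (\<lambda>m::nat. p ^ m)" using power_inject_exp[OF prime_gt_1_nat[OF p]] by (auto intro!: injI)
    have "(\<lambda>m. f (p ^ m)) summable_on UNIV"
      using summable_on_reindex[OF inj, of f] fS by (simp add: o_def)
    thus ?thesis by (metis has_sum_imp_sums has_sum_infsum sums_unique)
  qed
  finally show ?case using insert by simp
qed

text \<open>Every n with 1 <= n < N has only prime factors below N, so the error is at most the tail
  of the series of norms. The value f 0 = 0 takes care of n = 0, which lies in none of the smooth
  sets.\<close>

lemma euler_product:
  fixes f :: "nat \<Rightarrow> complex"
  assumes mult: "\<And>p m n. prime p \<Longrightarrow> \<not> p dvd n \<Longrightarrow> n > 0 \<Longrightarrow> f (p ^ m * n) = f (p ^ m) * f n"
    and f1: "f 1 = 1" and f0: "f 0 = 0" and sm: "summable (\<lambda>n. norm (f n))"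
  shows "(\<lambda>N. \<Prod>p | prime p \<and> p < N. \<Sum>m. f (p ^ m)) \<longlonglongrightarrow> (\<Sum>n. f n)"
proof -
  let ?P = "\<lambda>N. {p. prime p \<and> p < N}"
  let ?S = "\<lambda>N. smooth_over (?P N)"
  have fU: "f summable_on UNIV" by (rule norm_summable_imp_summable_on[OF sm])
  have nU: "(\<lambda>n. norm (f n)) summable_on UNIV" by (rule norm_summable_imp_summable_on) (use sm in simp)
  have fS: "f summable_on A" for A using summable_on_subset_banach[OF fU] by simp
  have nS: "(\<lambda>n. norm (f n)) summable_on A" for A using summable_on_subset_banach[OF nU] by simp
  have f_eq: "(\<Sum>n. f n) = infsum f UNIV" by (metis fU has_sum_imp_sums has_sum_infsum sums_unique)
  have n_eq: "(\<Sum>n. norm (f n)) = infsum (\<lambda>n. norm (f n)) UNIV" by (metis nU has_sum_imp_sums has_sum_infsum sums_unique)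
  have bound: "norm (infsum f (?S N) - (\<Sum>n. f n)) \<le> (\<Sum>n. norm (f n)) - (\<Sum>n<N. norm (f n))" for N
  proof -
    have "(\<Sum>n. f n) - infsum f (?S N) = infsum f (UNIV - ?S N)"
      unfolding f_eq by (rule infsum_Diff[symmetric]) (use fS in auto)
    also have "norm \<dots> \<le> infsum (\<lambda>n. norm (f n)) (UNIV - ?S N)"
      by (rule norm_infsum_bound) (rule nS)
    also have "\<dots> = (\<Sum>n. norm (f n)) - infsum (\<lambda>n. norm (f n)) (?S N)"
      unfolding n_eq by (rule infsum_Diff) (use nS in auto)
    also have "infsum (\<lambda>n. norm (f n)) (?S N) \<ge> infsum (\<lambda>n. norm (f n)) {1..<N}"
      by (rule infsum_mono_neutral) (use nS in \<open>auto simp: smooth_over_def dest: dvd_imp_le\<close>)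
    hence "(\<Sum>n. norm (f n)) - infsum (\<lambda>n. norm (f n)) (?S N) \<le> (\<Sum>n. norm (f n)) - (\<Sum>n\<in>{1..<N}. norm (f n))" by simp
    also have "(\<Sum>n\<in>{1..<N}. norm (f n)) = (\<Sum>n<N. norm (f n))"
      using f0 by (intro sum.mono_neutral_left) (auto simp: Suc_le_eq)
    finally show ?thesis by (simp add: norm_minus_commute)
  qed
  have "(\<lambda>N. infsum f (?S N) - (\<Sum>n. f n)) \<longlonglongrightarrow> 0"
  proof (rule Lim_null_comparison)
    show "\<forall>\<^sub>F N in sequentially. norm (infsum f (?S N) - (\<Sum>n. f n)) \<le> (\<Sum>n. norm (f n)) - (\<Sum>n<N. norm (f n))"
      using bound by (intro always_eventually allI)
    have "(\<lambda>N. (\<Sum>n. norm (f n)) - (\<Sum>n<N. norm (f n))) \<longlonglongrightarrow> (\<Sum>n. norm (f n)) - (\<Sum>n. norm (f n))"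
      by (intro tendsto_diff tendsto_const summable_LIMSEQ sm)
    thus "(\<lambda>N. (\<Sum>n. norm (f n)) - (\<Sum>n<N. norm (f n))) \<longlonglongrightarrow> 0" by simp
  qed
  hence "(\<lambda>N. infsum f (?S N)) \<longlonglongrightarrow> (\<Sum>n. f n)" by (simp add: LIM_zero_iff)
  moreover have "infsum f (?S N) = (\<Prod>p | prime p \<and> p < N. \<Sum>m. f (p ^ m))" for N
    by (rule infsum_smooth_over[OF mult f1 sm]) auto
  ultimately show ?thesis by simp
qed

section \<open>The zeta function on the half-plane Re s > 1\<close>

text \<open>A local Weierstrass test. The neighbourhood T may leave S, so that balls and half-planes
  can be used directly.\<close>

lemma holomorphic_suminf:
  fixes f :: "nat \<Rightarrow> complex \<Rightarrow> complex"
  assumes S: "open S" and hol: "\<And>n. f n holomorphic_on S"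
    and bd: "\<And>z. z \<in> S \<Longrightarrow> \<exists>T h. open T \<and> z \<in> T \<and> summable h \<and> (\<forall>n. \<forall>w\<in>T \<inter> S. norm (f n w) \<le> h n)"
  shows "(\<lambda>z. \<Sum>n. f n z) holomorphic_on S"
proof (rule holomorphic_onI)
  fix z assume z: "z \<in> S"
  obtain T h where T: "open T" "z \<in> T" "summable h" "\<And>n w. w \<in> T \<inter> S \<Longrightarrow> norm (f n w) \<le> h n"
    using bd[OF z] by blast
  have op: "open (T \<inter> S)" using T S by auto
  have hfd: "(f n has_field_derivative deriv (f n) x) (at x)" if "x \<in> T \<inter> S" for n x
    using holomorphic_derivI[OF hol S] that by blast
  obtain g g' where g: "\<forall>x \<in> T \<inter> S. ((\<lambda>n. f n x) sums g x) \<and> ((\<lambda>n. deriv (f n) x) sums g' x) \<and> (g has_field_derivative g' x) (at x)"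
  proof (rule series_and_derivative_comparison[OF op T(3) hfd])
    show "\<forall>\<^sub>F n in sequentially. \<forall>x\<in>T \<inter> S. norm (f n x) \<le> h n"
      using T(4) by (intro always_eventually) blast
  qed blast+
  have "((\<lambda>z. \<Sum>n. f n z) has_field_derivative g' z) (at z)"
    by (rule has_field_derivative_transform_within_open[of g _ _ "T \<inter> S"]) (use g op z T in \<open>auto simp: sums_iff\<close>)
  thus "(\<lambda>z. \<Sum>n. f n z) field_differentiable at z within S"
    using field_differentiable_at_within field_differentiable_def by blast
qed

lemma powr_power_real: "x > 0 \<Longrightarrow> (x powr a) ^ n = (x::real) powr (a * real n)"
  by (subst powr_realpow[symmetric]) (auto simp: powr_powr)

lemma norm_of_nat_powr: "norm (of_nat n powr s :: complex) = real n powr Re s"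
  by (subst norm_powr_real_powr) auto

lemma of_nat_powr_mult: "(of_nat (a * b) powr s :: complex) = of_nat a powr s * of_nat b powr s"
  by (simp add: powr_times_real)

lemma of_nat_power_powr: "(of_nat (a ^ m) powr s :: complex) = (of_nat a powr s) ^ m"
  by (induction m) (simp_all add: of_nat_powr_mult del: of_nat_mult of_nat_power)

lemma prime_powr_bound:
  assumes "prime p" "Re s > 0"
  shows "norm (of_nat p powr (- s) :: complex) < 1" "Re s > 1 \<Longrightarrow> norm (of_nat p powr (- s) :: complex) < 1 / 2"
proof -
  have p: "real p \<ge> 2" using prime_ge_2_nat[OF assms(1)] by simp
  show "norm (of_nat p powr (- s) :: complex) < 1"
    using powr_less_mono[of "- Re s" 0 "real p"] p assms by (simp add: norm_of_nat_powr)
  assume s: "Re s > 1"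
  have "real p powr (- Re s) < real p powr (- 1)" using p s by (intro powr_less_mono) auto
  also have "\<dots> \<le> 1 / 2" using p by (simp add: powr_minus_divide)
  finally show "norm (of_nat p powr (- s) :: complex) < 1 / 2" by (simp add: norm_of_nat_powr)
qed

section \<open>Dirichlet series as exponentials of sums over primes\<close>

text \<open>The junk value \<open>0 powr z = 0\<close> makes the term \<open>n = 0\<close> vanish, so all series run over \<open>nat\<close>.\<close>
definition dirichlet :: "(nat \<Rightarrow> complex) \<Rightarrow> complex \<Rightarrow> complex" where
  "dirichlet f s = (\<Sum>n. f n * of_nat n powr (- s))"

text \<open>L is the logarithm of a local factor as a function of y = p^(-s); this form covers both
  \<open>log_zeta\<close> and \<open>log_corr\<close>.\<close>

definition prime_sum :: "(complex \<Rightarrow> complex) \<Rightarrow> complex \<Rightarrow> complex" where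
  "prime_sum L s = (\<Sum>n. if prime n then L (of_nat n powr (- s)) else 0)"

text \<open>The exponent b is the order to which L is controlled at y = 0: b = 1 gives convergence
  for Re s > 1, and b = 2 for Re s > 1/2.\<close>

lemma prime_sum_summable:
  fixes b :: nat
  assumes L: "\<And>n. prime n \<Longrightarrow> norm (L (of_nat n powr (- s))) \<le> C * (norm (of_nat n powr (- s) :: complex)) ^ b"
    and s: "Re s * real b > 1" and C: "C \<ge> 0"
  shows "summable (\<lambda>n. norm (if prime n then L (of_nat n powr (- s)) else 0))"
proof (rule summable_comparison_test[OF _ summable_mult[OF summable_powr[OF s], of C]])
  have "norm (if prime n then L (of_nat n powr (- s)) else 0) \<le> C * real n powr - (Re s * real b)" for n
  proof (cases "prime n")
    case True
    have "(norm (of_nat n powr (- s) :: complex)) ^ b = real n powr - (Re s * real b)"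
      using True by (simp add: norm_of_nat_powr powr_power_real prime_gt_0_nat)
    thus ?thesis using L[OF True] True by simp
  qed (use C in auto)
  thus "\<exists>N. \<forall>n\<ge>N. norm (norm (if prime n then L (of_nat n powr (- s)) else 0)) \<le> C * real n powr - (Re s * real b)"
    by auto
qed

lemma prime_sum_holomorphic:
  fixes b :: nat and x0 :: real
  assumes hol: "L holomorphic_on ball 0 1" and x0: "x0 > 0" "x0 * real b \<ge> 1"
    and L: "\<And>n s. prime n \<Longrightarrow> Re s > x0 \<Longrightarrow> norm (L (of_nat n powr (- s))) \<le> C * (norm (of_nat n powr (- s) :: complex)) ^ b"
    and C: "C \<ge> 0"
  shows "prime_sum L holomorphic_on {s. Re s > x0}"
  unfolding prime_sum_def
proof (rule holomorphic_suminf)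
  show op: "open {s. x0 < Re s}" by (rule open_halfspace_Re_gt)
  show "(\<lambda>s. if prime n then L (of_nat n powr (- s)) else 0) holomorphic_on {s. x0 < Re s}" for n
  proof (cases "prime n")
    case True
    have "(\<lambda>s. of_nat n powr (- s) :: complex) holomorphic_on {s. x0 < Re s}"
      by (intro holomorphic_intros) (use True in \<open>auto simp: prime_gt_0_nat\<close>)
    moreover have "(\<lambda>s. of_nat n powr (- s)) ` {s. x0 < Re s} \<subseteq> ball 0 1"
      using prime_powr_bound[OF True] x0 by auto
    ultimately have "(L \<circ> (\<lambda>s. of_nat n powr (- s))) holomorphic_on {s. x0 < Re s}"
      by (rule holomorphic_on_compose_gen[OF _ hol])
    thus ?thesis using True by (simp add: o_def)
  qed auto
  fix z assume "z \<in> {s. x0 < Re s}"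
  hence z: "x0 < Re z" by simp
  \<comment> \<open>The midpoint gives a majorant valid on all of Re s > x1; x1 > x0 makes x1 b
    exceed 1 strictly although x0 b may equal 1.\<close>
  define x1 where "x1 = (x0 + Re z) / 2"
  have x1: "x0 < x1" "x1 < Re z" using z by (auto simp: x1_def)
  have b: "b > 0" using x0 by (cases b) auto
  have s1: "x1 * real b > 1" using x0(2) mult_strict_right_mono[OF x1(1), of "real b"] b by linarith
  show "\<exists>T h. open T \<and> z \<in> T \<and> summable h \<and>
     (\<forall>n. \<forall>s\<in>T \<inter> {s. x0 < Re s}. norm (if prime n then L (of_nat n powr (- s)) else 0) \<le> h n)"
  proof (intro exI[of _ "{s. x1 < Re s}"] exI[of _ "\<lambda>n. C * real n powr (- (x1 * real b))"] conjI allI ballI)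
    show "open {s. x1 < Re s}" by (rule open_halfspace_Re_gt)
    show "summable (\<lambda>n. C * real n powr (- (x1 * real b)))" by (intro summable_mult summable_powr s1)
    fix n s assume s: "s \<in> {s. x1 < Re s} \<inter> {s. x0 < Re s}"
    show "norm (if prime n then L (of_nat n powr (- s)) else 0) \<le> C * real n powr (- (x1 * real b))"
    proof (cases "prime n")
      case True
      have "(norm (of_nat n powr (- s) :: complex)) ^ b = (real n powr (- Re s)) ^ b"
        by (simp add: norm_of_nat_powr)
      also have "\<dots> \<le> (real n powr (- x1)) ^ b"
        using s True prime_gt_1_nat[OF True] by (intro power_mono powr_mono) auto
      also have "\<dots> = real n powr (- (x1 * real b))"
        using True by (simp add: powr_power_real prime_gt_0_nat)
      finally have "C * (norm (of_nat n powr (- s) :: complex)) ^ b \<le> C * real n powr (- (x1 * real b))"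
        using C by (intro mult_left_mono)
      with L[OF True, of s] s True show ?thesis by (auto intro: order_trans)
    qed (use C in auto)
  qed (use x1 in auto)
qed

text \<open>The finite Euler products are exponentials of partial sums of logarithms, so continuity
  of exp yields the limit, and nonvanishing comes for free.\<close>

lemma dirichlet_euler_exp:
  assumes mult: "\<And>p m n. prime p \<Longrightarrow> \<not> p dvd n \<Longrightarrow> n > 0 \<Longrightarrow> f (p ^ m * n) = f (p ^ m) * f n"
    and f1: "f 1 = 1" and sm: "summable (\<lambda>n. norm (f n * of_nat n powr (- s)))"
    and L: "\<And>p. prime p \<Longrightarrow> (\<lambda>m. f (p ^ m) * (of_nat p powr (- s)) ^ m) sums exp (L (of_nat p powr (- s)))"
    and smL: "summable (\<lambda>n. norm (if prime n then L (of_nat n powr (- s)) else 0))"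
  shows "dirichlet f s = exp (prime_sum L s)"
proof -
  let ?f = "\<lambda>n. f n * of_nat n powr (- s)"
  let ?L = "\<lambda>n. if prime n then L (of_nat n powr (- s)) else 0"
  have "(\<lambda>N. \<Prod>p | prime p \<and> p < N. \<Sum>m. ?f (p ^ m)) \<longlonglongrightarrow> (\<Sum>n. ?f n)"
    by (rule euler_product) (use mult f1 sm in \<open>auto simp: of_nat_powr_mult simp del: of_nat_mult of_nat_power\<close>)
  moreover have "(\<Prod>p | prime p \<and> p < N. \<Sum>m. ?f (p ^ m)) = exp (\<Sum>n<N. ?L n)" for N
  proof -
    have "(\<Prod>p | prime p \<and> p < N. \<Sum>m. ?f (p ^ m)) = (\<Prod>p | prime p \<and> p < N. exp (?L p))"
      using L by (intro prod.cong) (auto simp: of_nat_power_powr sums_iff simp del: of_nat_power)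
    also have "\<dots> = exp (\<Sum>p | prime p \<and> p < N. ?L p)" by (simp add: exp_sum)
    also have "(\<Sum>p | prime p \<and> p < N. ?L p) = (\<Sum>n<N. ?L n)"
      by (intro sum.mono_neutral_left) auto
    finally show ?thesis .
  qed
  ultimately have A: "(\<lambda>N. exp (\<Sum>n<N. ?L n)) \<longlonglongrightarrow> (\<Sum>n. ?f n)" by simp
  have B: "(\<lambda>N. exp (\<Sum>n<N. ?L n)) \<longlonglongrightarrow> exp (\<Sum>n. ?L n)"
    by (intro tendsto_exp summable_LIMSEQ summable_norm_cancel[OF smL])
  show ?thesis unfolding dirichlet_def prime_sum_def by (rule LIMSEQ_unique[OF A B])
qed

definition zeta :: "complex \<Rightarrow> complex" where "zeta = dirichlet (\<lambda>_. 1)"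

text \<open>A holomorphic branch of log zeta on Re s > 1; powers of zeta with exponent 2 / k are
  taken through it.\<close>

definition log_zeta :: "complex \<Rightarrow> complex" where "log_zeta = prime_sum (\<lambda>y. - Ln (1 - y))"

lemma log_zeta_bound:
  assumes "prime n" "Re s > 1"
  shows "norm (- Ln (1 - of_nat n powr (- s))) \<le> 2 * (norm (of_nat n powr (- s) :: complex)) ^ 1"
  using norm_Ln_le[of "- (of_nat n powr (- s))"] prime_powr_bound(2)[OF assms(1), of s] assms by simp

lemma one_minus_nonpos: "norm (y::complex) < 1 \<Longrightarrow> 1 - y \<notin> \<real>\<^sub>\<le>\<^sub>0"
  using complex_Re_le_cmod[of y] by (auto simp: complex_nonpos_Reals_iff)

lemma log_zeta_holomorphic: "log_zeta holomorphic_on {s. Re s > 1}"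
  unfolding log_zeta_def
  by (rule prime_sum_holomorphic[where b=1 and C=2])
    (use log_zeta_bound one_minus_nonpos in \<open>auto intro!: holomorphic_intros\<close>)

lemma log_zeta_summable: "Re s > 1 \<Longrightarrow> summable (\<lambda>n. norm (if prime n then - Ln (1 - of_nat n powr (- s)) else 0))"
  by (rule prime_sum_summable[where b=1 and C=2 and L="\<lambda>y. - Ln (1 - y)"]) (use log_zeta_bound in auto)

lemma zeta_summable: "Re s > 1 \<Longrightarrow> summable (\<lambda>n. norm (of_nat n powr (- s) :: complex))"
  using summable_powr[of "Re s"] by (simp add: norm_of_nat_powr)

lemma zeta_eq_exp_log_zeta: 
  assumes s: "Re s > 1"
  shows "zeta s = exp (log_zeta s)"
  unfolding zeta_def log_zeta_def
proof (rule dirichlet_euler_exp)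
  fix p :: nat assume p: "prime p"
  have y: "norm (of_nat p powr (- s) :: complex) < 1" using prime_powr_bound(1)[OF p] s by auto
  have "exp (- Ln (1 - of_nat p powr (- s))) = 1 / (1 - of_nat p powr (- s) :: complex)"
    using y by (subst exp_minus, subst exp_Ln) (auto simp: field_simps)
  thus "(\<lambda>m. 1 * (of_nat p powr (- s)) ^ m) sums exp (- Ln (1 - of_nat p powr (- s)) :: complex)"
    using geometric_sums[OF y] by simp
qed (use zeta_summable[OF s] log_zeta_summable[OF s] in auto)

text \<open>In the power series of the logarithms the n-th coefficient is r^n / n times 3 + 4 cos a
  + cos 2a = 2 (1 + cos a)^2, where cos a is the real part of u^n.\<close>

lemma three_four_one:
  fixes r :: real and u :: complex
  assumes r: "0 \<le> r" "r < 1" and u: "norm u = 1"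
  shows "0 \<le> 3 * Re (- Ln (1 - of_real r)) + 4 * Re (- Ln (1 - of_real r * u)) + Re (- Ln (1 - of_real r * u^2))"
proof -
  \<comment> \<open>The term n = 0 is a division by zero with value 0, so the series effectively
    starts at n = 1.\<close>
  have L: "(\<lambda>n. y ^ n / of_nat n) sums (- Ln (1 - y))" if "norm y < 1" for y :: complex
    using sums_minus[OF Ln_series'[of "- y"]] that by simp
  have n: "norm (of_real r :: complex) < 1" "norm (of_real r * u) < 1" "norm (of_real r * u^2) < 1"
    using r u by (auto simp: norm_mult norm_power)
  have s: "(\<lambda>n. 3 * Re ((of_real r) ^ n / of_nat n) + 4 * Re ((of_real r * u) ^ n / of_nat n) + Re ((of_real r * u^2) ^ n / of_nat n))
     sums (3 * Re (- Ln (1 - of_real r)) + 4 * Re (- Ln (1 - of_real r * u)) + Re (- Ln (1 - of_real r * u^2)))"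
    by (intro sums_add sums_mult sums_Re L n)
  have "0 \<le> 3 * Re ((of_real r) ^ n / of_nat n) + 4 * Re ((of_real r * u) ^ n / of_nat n) + Re ((of_real r * u^2) ^ n / of_nat n)" for n
  proof -
    define c where "c = u ^ n"
    have "norm c = 1" using u by (simp add: c_def norm_power)
    hence c: "(Re c)^2 + (Im c)^2 = 1" by (simp add: cmod_def)
    have e: "(of_real r * u) ^ n = of_real (r ^ n) * c" "(of_real r * u^2) ^ n = of_real (r ^ n) * c^2"
      by (simp_all add: c_def power_mult_distrib power_mult[symmetric] mult.commute)
    have "3 * Re ((of_real r) ^ n / of_nat n) + 4 * Re ((of_real r * u) ^ n / of_nat n) + Re ((of_real r * u^2) ^ n / of_nat n)
       = r ^ n / real n * (3 + 4 * Re c + ((Re c)^2 - (Im c)^2))"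
      unfolding e by (simp add: Re_divide_of_nat of_real_power[symmetric] power2_eq_square algebra_simps add_divide_distrib diff_divide_distrib del: of_real_power)
    also have "3 + 4 * Re c + ((Re c)^2 - (Im c)^2) = 2 * (1 + Re c)^2"
      using c by (simp add: power2_eq_square algebra_simps)
    finally show ?thesis using r by simp
  qed
  thus ?thesis using sums_le[OF _ sums_zero s] by simp
qed

text \<open>\<open>three_four_one\<close> is applied at each prime n with r = n^(-x) and u = n^(-i
  t), summed, and exponentiated.\<close>

lemma zeta_341:
  assumes x: "x > 1"
  shows "1 \<le> norm (zeta (of_real x)) ^ 3 * norm (zeta (Complex x t)) ^ 4 * norm (zeta (Complex x (2 * t)))"
proof -
  let ?a = "\<lambda>s n. if prime n then - Ln (1 - of_nat n powr (- s)) else 0 :: complex"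
  have s: "(\<lambda>n. Re (?a s n)) sums Re (log_zeta s)" if "Re s > 1" for s
    unfolding log_zeta_def prime_sum_def
    by (intro sums_Re summable_sums summable_norm_cancel[OF log_zeta_summable[OF that]])
  have S: "(\<lambda>n. 3 * Re (?a (of_real x) n) + 4 * Re (?a (Complex x t) n) + Re (?a (Complex x (2 * t)) n))
     sums (3 * Re (log_zeta (of_real x)) + 4 * Re (log_zeta (Complex x t)) + Re (log_zeta (Complex x (2 * t))))"
    by (intro sums_add sums_mult s) (use x in auto)
  have "0 \<le> 3 * Re (?a (of_real x) n) + 4 * Re (?a (Complex x t) n) + Re (?a (Complex x (2 * t)) n)" for n
  proof (cases "prime n")
    case True
    define u :: complex where "u = of_nat n powr (- (\<i> * of_real t))"
    define r where "r = real n powr (- x)"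
    have n0: "n > 0" "n > 1" using True by (auto simp: prime_gt_0_nat prime_gt_Suc_0_nat)
    have u: "norm u = 1" using n0 by (simp add: u_def norm_of_nat_powr)
    have r: "0 \<le> r" "r < 1" using n0 x powr_less_mono[of "- x" 0 "real n"] by (auto simp: r_def)
    have rr: "of_real r = (of_nat n powr (- of_real x) :: complex)"
      using powr_of_real[of "real n" "- x"] by (simp add: r_def)
    have e1: "(of_nat n powr (- Complex x t) :: complex) = of_real r * u"
      unfolding rr u_def by (simp add: powr_add[symmetric] Complex_eq)
    have e2: "(of_nat n powr (- Complex x (2 * t)) :: complex) = of_real r * u^2"
      unfolding rr u_def power2_eq_square by (simp add: powr_add[symmetric] Complex_eq algebra_simps)
    show ?thesis using True three_four_one[OF r u] unfolding e1 e2 rr[symmetric] by simp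
  qed auto
  hence "0 \<le> 3 * Re (log_zeta (of_real x)) + 4 * Re (log_zeta (Complex x t)) + Re (log_zeta (Complex x (2 * t)))"
    using sums_le[OF _ sums_zero S] by simp
  hence "1 \<le> exp (3 * Re (log_zeta (of_real x)) + 4 * Re (log_zeta (Complex x t)) + Re (log_zeta (Complex x (2 * t))))" by simp
  also have "\<dots> = norm (zeta (of_real x)) ^ 3 * norm (zeta (Complex x t)) ^ 4 * norm (zeta (Complex x (2 * t)))"
  proof -
    have "exp (3 * a + 4 * b + c) = exp a ^ 3 * exp b ^ 4 * exp c" for a b c :: real
      using exp_of_nat_mult[of 3 a] exp_of_nat_mult[of 4 b] by (simp add: exp_add)
    moreover have "norm (zeta s) = exp (Re (log_zeta s))" if "Re s > 1" for s
      using that by (simp add: zeta_eq_exp_log_zeta)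
    ultimately show ?thesis using x by simp
  qed
  finally show ?thesis .
qed

section \<open>Continuation of (s - 1) zeta(s) past Re s = 1\<close>

text \<open>
  Comparing \<open>n powr -s\<close> with the integral of \<open>x powr -s\<close> over \<open>[n, n + 1]\<close> and multiplying by
  \<open>s - 1\<close> gives terms that are entire, so that no singularity at \<open>s = 1\<close> has to be removed.
\<close>
definition zeta_reg_term :: "real \<Rightarrow> complex \<Rightarrow> complex" where
  "zeta_reg_term x s = (s - 1) * of_real x powr (- s) + of_real (x + 1) powr (1 - s) - of_real x powr (1 - s)"

lemma of_real_segment:
  assumes "z \<in> closed_segment (of_real a) (of_real b :: complex)" "a \<le> b"
  obtains x where "z = of_real x" "a \<le> x" "x \<le> b"
  using assms by (auto simp: closed_segment_of_real closed_segment_eq_real_ivl)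

lemma norm_of_real_powr: "x > 0 \<Longrightarrow> norm (of_real x powr s :: complex) = x powr Re s"
  by (subst norm_powr_real_powr) auto

text \<open>One bound is trivial, the other is the mean value estimate. The second decays better in
  x but grows with |s|; both are needed for interpolation.\<close>

lemma powr_diff_bound:
  assumes x: "1 \<le> x" "x \<le> y" "y \<le> x + 1" and s: "Re s \<ge> 0"
  shows "norm (of_real y powr (- s) - of_real x powr (- s) :: complex) \<le> 2 * x powr (- Re s)"
    and "norm (of_real y powr (- s) - of_real x powr (- s) :: complex) \<le> norm s * x powr (- Re s - 1)"
proof -
  have "norm (of_real y powr (- s) - of_real x powr (- s) :: complex) \<le> y powr (- Re s) + x powr (- Re s)"
    using x by (intro order_trans[OF norm_triangle_ineq4]) (simp add: norm_of_real_powr)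
  also have "y powr (- Re s) \<le> x powr (- Re s)" using x s by (intro powr_mono2') auto
  finally show "norm (of_real y powr (- s) - of_real x powr (- s) :: complex) \<le> 2 * x powr (- Re s)" by simp
  have "norm (of_real y powr (- s) - of_real x powr (- s) :: complex) \<le> (norm s * x powr (- Re s - 1)) * norm (of_real y - of_real x :: complex)"
  proof (rule field_differentiable_bound[where S="closed_segment (of_real x) (of_real y)" and f="\<lambda>z. z powr (- s)"])
    fix z :: complex assume "z \<in> closed_segment (of_real x) (of_real y)"
    then obtain v where v: "z = of_real v" "x \<le> v" "v \<le> y" using of_real_segment x by metis
    have z: "z \<notin> \<real>\<^sub>\<le>\<^sub>0" using v x by (auto simp: complex_nonpos_Reals_iff)
    show "((\<lambda>z. z powr (- s)) has_field_derivative (- s * z powr (- s - 1))) (at z within closed_segment (of_real x) (of_real y))"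
      by (rule has_field_derivative_at_within[OF has_field_derivative_powr[OF z]])
    have "norm (- s * z powr (- s - 1)) = norm s * v powr (- Re s - 1)"
      using v x by (simp add: norm_mult norm_of_real_powr)
    also have "\<dots> \<le> norm s * x powr (- Re s - 1)" using v x s by (intro mult_left_mono powr_mono2') auto
    finally show "norm (- s * z powr (- s - 1)) \<le> norm s * x powr (- Re s - 1)" .
  qed auto
  also have "\<dots> \<le> (norm s * x powr (- Re s - 1)) * 1"
    using x by (intro mult_left_mono) (auto simp: of_real_diff[symmetric] simp del: of_real_diff)
  finally show "norm (of_real y powr (- s) - of_real x powr (- s) :: complex) \<le> norm s * x powr (- Re s - 1)" by simp
qed

text \<open>The term is the increment over [x, x + 1] of a function whose derivative at v is (1 -
  s)(v^(-s) - x^(-s)).\<close>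

lemma zeta_reg_term_bound_of:
  assumes x: "1 \<le> x" and B: "\<And>v. x \<le> v \<Longrightarrow> v \<le> x + 1 \<Longrightarrow> norm (of_real v powr (- s) - of_real x powr (- s) :: complex) \<le> B"
  shows "norm (zeta_reg_term x s) \<le> norm (s - 1) * B"
proof -
  let ?f = "\<lambda>z. z powr (1 - s) - z * ((1 - s) * of_real x powr (- s))"
  have "norm (?f (of_real (x + 1)) - ?f (of_real x)) \<le> (norm (s - 1) * B) * norm (of_real (x + 1) - of_real x :: complex)"
  proof (rule field_differentiable_bound[where S="closed_segment (of_real x) (of_real (x + 1))" and f="?f"])
    fix z :: complex assume "z \<in> closed_segment (of_real x) (of_real (x + 1))"
    then obtain v where v: "z = of_real v" "x \<le> v" "v \<le> x + 1" by (rule of_real_segment) auto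
    have z: "z \<notin> \<real>\<^sub>\<le>\<^sub>0" using v x by (auto simp: complex_nonpos_Reals_iff)
    have "(?f has_field_derivative ((1 - s) * z powr (1 - s - 1) - 1 * ((1 - s) * of_real x powr (- s)))) (at z within closed_segment (of_real x) (of_real (x + 1)))"
      by (rule DERIV_diff[OF has_field_derivative_at_within[OF has_field_derivative_powr[OF z]] DERIV_cmult_right[OF DERIV_ident]])
    moreover have "(1 - s) * z powr (1 - s - 1) - 1 * ((1 - s) * of_real x powr (- s)) = (1 - s) * (z powr (- s) - of_real x powr (- s))"
      by (simp add: algebra_simps)
    ultimately show "(?f has_field_derivative (1 - s) * (z powr (- s) - of_real x powr (- s))) (at z within closed_segment (of_real x) (of_real (x + 1)))" by simp
    show "norm ((1 - s) * (z powr (- s) - of_real x powr (- s))) \<le> norm (s - 1) * B"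
      using B[of v] v by (simp add: norm_mult norm_minus_commute mult_left_mono)
  qed auto
  moreover have "?f (of_real (x + 1)) - ?f (of_real x) = zeta_reg_term x s"
    by (simp add: zeta_reg_term_def algebra_simps)
  ultimately show ?thesis by simp
qed

text \<open>The geometric mean of the two available bounds with weights 1 - a and a: the growth is
  only |s|^a, and the gain x^(-a) still gives convergence slightly to the left of Re s = 1.\<close>

lemma zeta_reg_term_bound:
  assumes x: "1 \<le> x" and s: "Re s \<ge> 0" and a: "0 < a" "a < 1"
  shows "norm (zeta_reg_term x s) \<le> 2 * norm (s - 1) * norm s powr a * x powr (- Re s - a)"
proof -
  have 1: "norm (zeta_reg_term x s) \<le> norm (s - 1) * (2 * x powr (- Re s))"
    by (rule zeta_reg_term_bound_of[OF x]) (use powr_diff_bound(1)[OF x _ _ s] in auto)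
  have 2: "norm (zeta_reg_term x s) \<le> norm (s - 1) * (norm s * x powr (- Re s - 1))"
    by (rule zeta_reg_term_bound_of[OF x]) (use powr_diff_bound(2)[OF x _ _ s] in auto)
  have "norm (zeta_reg_term x s) = norm (zeta_reg_term x s) powr (1 - a) * norm (zeta_reg_term x s) powr a"
    by (simp add: powr_add[symmetric])
  also have "\<dots> \<le> (norm (s - 1) * (2 * x powr (- Re s))) powr (1 - a) * (norm (s - 1) * (norm s * x powr (- Re s - 1))) powr a"
    using 1 2 a by (intro mult_mono powr_mono2) auto
  also have "\<dots> = (norm (s - 1) powr (1 - a) * norm (s - 1) powr a) * 2 powr (1 - a) * norm s powr a * (x powr (- Re s * (1 - a)) * x powr ((- Re s - 1) * a))"
    using x by (simp add: powr_mult powr_powr)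
  also have "norm (s - 1) powr (1 - a) * norm (s - 1) powr a = norm (s - 1)"
    by (simp add: powr_add[symmetric])
  also have "x powr (- Re s * (1 - a)) * x powr ((- Re s - 1) * a) = x powr (- Re s - a)"
    using x by (simp add: powr_add[symmetric] algebra_simps)
  also have "norm (s - 1) * 2 powr (1 - a) * norm s powr a * x powr (- Re s - a) \<le> norm (s - 1) * 2 powr 1 * norm s powr a * x powr (- Re s - a)"
    using a by (intro mult_right_mono mult_left_mono powr_mono) auto
  finally show ?thesis by (simp add: mult_ac)
qed

lemma summable_powr_Suc: "s > 1 \<Longrightarrow> summable (\<lambda>n. real (Suc n) powr (- s))"
  by (rule iffD2[OF summable_Suc_iff[of "\<lambda>n. real n powr (- s)"] summable_powr])

text \<open>The continuation of (s - 1) zeta(s). The summand 1 compensates the telescoping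
  differences (n+1)^(1-s) - n^(1-s), whose sum over n >= 1 is -1 for Re s > 1.\<close>

definition zeta_reg :: "complex \<Rightarrow> complex" where
  "zeta_reg s = 1 + (\<Sum>n. zeta_reg_term (real (Suc n)) s)"

lemma zeta_reg_term_holomorphic: "x \<ge> 1 \<Longrightarrow> zeta_reg_term x holomorphic_on A"
  unfolding zeta_reg_term_def by (intro holomorphic_intros) (auto simp: complex_nonpos_Reals_iff complex_eq_iff)

text \<open>The gain a is split in halves: one pays for going past Re s = 1, the other is left for
  convergence.\<close>

lemma zeta_reg_term_Suc_bound:
  assumes a: "0 < a" "a < 1" and s: "Re s \<ge> 1 - a / 2"
  shows "norm (zeta_reg_term (real (Suc n)) s) \<le> 2 * norm (s - 1) * norm s powr a * real (Suc n) powr (- (1 + a / 2))"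
proof -
  have "norm (zeta_reg_term (real (Suc n)) s) \<le> 2 * norm (s - 1) * norm s powr a * real (Suc n) powr (- Re s - a)"
    using a s by (intro zeta_reg_term_bound) auto
  also have "\<dots> \<le> 2 * norm (s - 1) * norm s powr a * real (Suc n) powr (- (1 + a / 2))"
    using a s by (intro mult_left_mono powr_mono) auto
  finally show ?thesis .
qed

lemma zeta_reg_holomorphic:
  assumes a: "0 < a" "a < 1"
  shows "zeta_reg holomorphic_on {s. Re s > 1 - a / 2}"
  unfolding zeta_reg_def
proof (intro holomorphic_on_add holomorphic_on_const holomorphic_suminf)
  show "open {s. 1 - a / 2 < Re s}" by (rule open_halfspace_Re_gt)
  show "zeta_reg_term (real (Suc n)) holomorphic_on {s. 1 - a / 2 < Re s}" for n by (rule zeta_reg_term_holomorphic) auto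
  fix z :: complex
  let ?h = "\<lambda>n. 2 * (norm z + 2) * (norm z + 1) powr a * real (Suc n) powr (- (1 + a / 2))"
  show "\<exists>T h. open T \<and> z \<in> T \<and> summable h \<and> (\<forall>n. \<forall>w\<in>T \<inter> {s. 1 - a / 2 < Re s}. norm (zeta_reg_term (real (Suc n)) w) \<le> h n)"
  proof (intro exI[of _ "ball z 1"] exI[of _ ?h] conjI allI ballI)
    show "summable ?h" using a by (intro summable_mult summable_powr_Suc) simp
    fix n w assume w: "w \<in> ball z 1 \<inter> {s. 1 - a / 2 < Re s}"
    have "norm w \<le> norm z + norm (w - z)" by norm
    moreover have "norm (w - z) < 1" using w by (simp add: dist_norm norm_minus_commute)
    ultimately have nw: "norm w \<le> norm z + 1" by linarith
    have nw1: "norm (w - 1) \<le> norm z + 2" using norm_triangle_ineq4[of w 1] nw by simp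
    show "norm (zeta_reg_term (real (Suc n)) w) \<le> ?h n"
    proof (rule order_trans[OF zeta_reg_term_Suc_bound[OF a]])
      have "2 * norm (w - 1) * norm w powr a \<le> 2 * (norm z + 2) * (norm z + 1) powr a"
        using a nw nw1 by (intro mult_mono powr_mono2) auto
      thus "2 * norm (w - 1) * norm w powr a * real (Suc n) powr (- (1 + a / 2)) \<le> ?h n"
        by (intro mult_right_mono) auto
    qed (use w in auto)
  qed auto
qed

lemma zeta_reg_bound:
  assumes a: "0 < a" "a < 1"
  obtains H where "H \<ge> 0" "\<And>s. Re s \<ge> 1 - a / 2 \<Longrightarrow> norm (zeta_reg s - 1) \<le> H * norm (s - 1) * norm s powr a"
proof
  let ?H = "2 * (\<Sum>n. real (Suc n) powr (- (1 + a / 2)))"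
  have sm: "summable (\<lambda>n. real (Suc n) powr (- (1 + a / 2)))"
    using a by (intro summable_powr_Suc) simp
  show "0 \<le> ?H" by (intro mult_nonneg_nonneg suminf_nonneg sm) auto
  fix s assume s: "Re s \<ge> 1 - a / 2"
  have "norm (\<Sum>n. zeta_reg_term (real (Suc n)) s) \<le> (\<Sum>n. 2 * norm (s - 1) * norm s powr a * real (Suc n) powr (- (1 + a / 2)))"
    by (rule norm_suminf_le) (use zeta_reg_term_Suc_bound[OF a s] sm in \<open>auto intro!: summable_mult\<close>)
  also have "\<dots> = ?H * norm (s - 1) * norm s powr a"
    using suminf_mult[OF sm, of "2 * norm (s - 1) * norm s powr a"] by (simp add: mult_ac)
  finally show "norm (zeta_reg s - 1) \<le> ?H * norm (s - 1) * norm s powr a" by (simp add: zeta_reg_def)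
qed

text \<open>The residue of zeta at 1. It makes the limit at s = 1 equal to the correction factor
  alone.\<close>

lemma zeta_reg_1: "zeta_reg 1 = 1"
proof -
  have "zeta_reg_term x 1 = 0" if "x \<ge> 1" for x using that by (auto simp: zeta_reg_term_def complex_eq_iff powr_def)
  thus ?thesis by (simp add: zeta_reg_def)
qed

lemma zeta_reg_zeta:
  assumes s: "Re s > 1"
  shows "zeta_reg s = (s - 1) * zeta s"
proof -
  let ?p = "\<lambda>n. (of_nat n :: complex)"
  have "(\<lambda>n. ?p n powr (- s)) sums zeta s"
    unfolding zeta_def dirichlet_def using summable_sums[OF summable_norm_cancel[OF zeta_summable[OF s]]] by simp
  hence "(\<lambda>n. ?p (Suc n) powr (- s)) sums zeta s"
    by (subst sums_Suc_iff) simp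
  moreover have "(\<lambda>n. ?p (Suc n) powr (1 - s)) \<longlonglongrightarrow> 0"
    using s by (intro tendsto_neg_powr_complex_of_nat filterlim_Suc) auto
  from telescope_sums[OF this]
  have "(\<lambda>n. ?p (Suc (Suc n)) powr (1 - s) - ?p (Suc n) powr (1 - s)) sums (0 - ?p (Suc 0) powr (1 - s))" .
  ultimately have "(\<lambda>n. (s - 1) * ?p (Suc n) powr (- s) + (?p (Suc (Suc n)) powr (1 - s) - ?p (Suc n) powr (1 - s))) sums ((s - 1) * zeta s + (0 - 1))"
    by (intro sums_add sums_mult) auto
  moreover have "zeta_reg_term (real (Suc n)) s = (s - 1) * ?p (Suc n) powr (- s) + (?p (Suc (Suc n)) powr (1 - s) - ?p (Suc n) powr (1 - s))" for n
    unfolding zeta_reg_term_def by (simp add: add_ac)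
  ultimately have "(\<lambda>n. zeta_reg_term (real (Suc n)) s) sums ((s - 1) * zeta s - 1)" by simp
  thus ?thesis by (simp add: zeta_reg_def sums_iff)
qed

section \<open>Bounds for zeta to the right of Re s = 1, away from the pole\<close>

text \<open>The radius R / 2 keeps the closed disc inside the open ball; 2 and 8 are 1! times 2 and
  2! times 2^2.\<close>

lemma cauchy_bounds:
  assumes h: "f holomorphic_on ball s R" and R: "R > 0" and B: "\<And>x. x \<in> ball s R \<Longrightarrow> norm (f x) \<le> B"
  shows "norm (deriv f s) \<le> 2 * B / R" "norm (deriv (deriv f) s) \<le> 8 * B / R^2"
proof -
  have c: "norm ((deriv ^^ n) f s) \<le> fact n * B / (R/2) ^ n" for n
  proof (rule Cauchy_inequality)
    show "f holomorphic_on ball s (R/2)" by (rule holomorphic_on_subset[OF h]) (use R in auto)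
    show "continuous_on (cball s (R/2)) f"
      by (rule continuous_on_subset[OF holomorphic_on_imp_continuous_on[OF h]]) (use R in auto)
    show "norm (f x) \<le> B" if "norm (s - x) = R/2" for x using B[of x] that R by (auto simp: dist_norm)
  qed (use R in auto)
  show "norm (deriv f s) \<le> 2 * B / R" using c[of 1] by (simp add: field_simps)
  show "norm (deriv (deriv f) s) \<le> 8 * B / R^2" using c[of 2] by (simp add: numeral_2_eq_2 field_simps power2_eq_square)
qed

definition strip :: "real \<Rightarrow> complex set" where
  "strip r = {s. 1 < Re s \<and> Re s \<le> 2 \<and> r \<le> norm (s - 1)}"

text \<open>The shift by 4 makes \<open>ht s\<close> dominate |x| for x within 1/32 of a point s of
  a strip, and keeps it above 1 so that its powers are monotone in the exponent.\<close>

definition ht :: "complex \<Rightarrow> real" where "ht s = \<bar>Im s\<bar> + 4"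

lemma ht_ge: "ht s \<ge> 4" by (simp add: ht_def)

lemma zeta_holomorphic: "zeta holomorphic_on {s. Re s > 1}"
  using log_zeta_holomorphic holomorphic_on_exp[THEN holomorphic_on_compose_gen, of log_zeta "{s. Re s > 1}"]
  by (auto intro!: holomorphic_transform[of "\<lambda>s. exp (log_zeta s)"] holomorphic_intros simp: zeta_eq_exp_log_zeta)

text \<open>In zeta = \<open>zeta_reg\<close> / (s - 1) the denominator cancels the factor |s - 1|
  of \<open>zeta_reg_bound\<close>. The bound holds on small discs that cross Re s = 1, so Cauchy's
  estimates carry it over to two derivatives.\<close>

lemma zeta_far_upper:
  assumes r: "0 < r" "r \<le> 1"
  obtains B where "B \<ge> 1" "\<And>s. s \<in> strip r \<Longrightarrow> norm (zeta s) \<le> B * ht s powr (1/16)"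
    "\<And>s. s \<in> strip r \<Longrightarrow> norm (deriv zeta s) \<le> B * ht s powr (1/16)"
    "\<And>s. s \<in> strip r \<Longrightarrow> norm (deriv (deriv zeta) s) \<le> B * ht s powr (1/16)"
proof -
  obtain H where H: "H \<ge> 0" "\<And>s. Re s \<ge> 1 - (1/16) / 2 \<Longrightarrow> norm (zeta_reg s - 1) \<le> H * norm (s - 1) * norm s powr (1/16)"
    by (rule zeta_reg_bound[of "1/16"]) auto
  \<comment> \<open>1/32 is how far \<open>zeta_reg_bound\<close> with a = 1/16 reaches to the left
    of Re s = 1; r / 2 keeps the disc at distance r / 2 from the pole.\<close>
  define R where "R = min (1/32) (r/2)"
  have R: "0 < R" "R \<le> 1/32" "R \<le> r/2" using r by (auto simp: R_def)
  let ?zt = "\<lambda>s. zeta_reg s / (s - 1)"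
  define B0 where "B0 = 2 / r + H"
  have B0: "B0 \<ge> 1" 
  proof -
    have "1 \<le> 2 / r" using r by simp
    thus ?thesis using H unfolding B0_def by linarith
  qed
  have bd: "norm (?zt x) \<le> B0 * ht s powr (1/16)" and xb: "Re x > 1 - (1/16)/2" "x \<noteq> 1"
    if s: "s \<in> strip r" and x: "x \<in> ball s R" for s x
  proof -
    have d: "norm (s - x) < R" using x by (simp add: dist_norm)
    have "\<bar>Re (s - x)\<bar> < R" "\<bar>Im (s - x)\<bar> < R" using d abs_Re_le_cmod[of "s - x"] abs_Im_le_cmod[of "s - x"] by linarith+
    hence re: "Re s - R < Re x" "Re x < Re s + R" "\<bar>Im x\<bar> < \<bar>Im s\<bar> + R" by auto
    show Rx: "Re x > 1 - (1/16)/2" using re s R by (auto simp: strip_def)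
    have n1: "norm (x - 1) \<ge> r / 2"
      using norm_triangle_ineq[of "s - x" "x - 1"] d s R by (auto simp: strip_def)
    thus x1: "x \<noteq> 1" using r by auto
    have "norm x \<le> \<bar>Re x\<bar> + \<bar>Im x\<bar>" by (rule cmod_le)
    also have "\<dots> \<le> ht s" using re s R Rx by (auto simp: ht_def strip_def)
    finally have nx: "norm x \<le> ht s" .
    have t1: "ht s powr (1/16) \<ge> 1" using ht_ge[of s] by (intro ge_one_powr_ge_zero) auto
    have nx2: "norm x powr (1/16) \<le> ht s powr (1/16)" using nx by (intro powr_mono2) auto
    have "norm (zeta_reg x) \<le> 1 + norm (zeta_reg x - 1)" using norm_triangle_ineq[of 1 "zeta_reg x - 1"] by simp
    also have "\<dots> \<le> 1 + H * norm (x - 1) * norm x powr (1/16)" using H(2)[of x] Rx by simp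
    finally have "norm (?zt x) \<le> (1 + H * norm (x - 1) * norm x powr (1/16)) / norm (x - 1)"
      unfolding norm_divide by (intro divide_right_mono) auto
    also have "\<dots> = 1 / norm (x - 1) + H * norm x powr (1/16)" using x1 by (simp add: field_simps)
    also have "1 / norm (x - 1) \<le> 2 / r"
    proof -
      have "1 / norm (x - 1) \<le> 1 / (r / 2)" using n1 r x1 by (intro divide_left_mono) auto
      thus ?thesis by simp
    qed
    also have "2 / r \<le> 2 / r * ht s powr (1/16)" using mult_left_mono[OF t1, of "2 / r"] r by simp
    also have "H * norm x powr (1/16) \<le> H * ht s powr (1/16)" using H nx2 by (intro mult_left_mono)
    finally show "norm (?zt x) \<le> B0 * ht s powr (1/16)" by (simp add: B0_def distrib_right)
  qed
  have hol: "?zt holomorphic_on ball s R" if "s \<in> strip r" for s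
    using xb[OF that] by (intro holomorphic_intros holomorphic_on_subset[OF zeta_reg_holomorphic[of "1/16"]]) auto
  have ev: "\<forall>\<^sub>F x in nhds s. zeta x = ?zt x" if "s \<in> strip r" for s
  proof (rule eventually_nhds_in_open[of "{s. Re s > 1}" s, THEN eventually_mono])
    show "open {s. Re s > 1}" by (rule open_halfspace_Re_gt)
    show "s \<in> {s. Re s > 1}" using that by (simp add: strip_def)
    fix x :: complex assume "x \<in> {s. Re s > 1}"
    hence "Re x > 1" by simp
    moreover from this have "x \<noteq> 1" by auto
    ultimately show "zeta x = ?zt x" by (simp add: zeta_reg_zeta)
  qed
  \<comment> \<open>Second derivatives need the first derivatives to agree on a neighbourhood, hence
    the nested eventual equality.\<close>
  have ev1: "\<forall>\<^sub>F x in nhds s. deriv zeta x = deriv ?zt x" if "s \<in> strip r" for s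
  proof -
    have "\<forall>\<^sub>F y in nhds s. \<forall>\<^sub>F x in nhds y. zeta x = ?zt x"
      using ev[OF that] by (simp add: eventually_eventually)
    thus ?thesis by (rule eventually_mono) (rule deriv_cong_ev[OF _ refl])
  qed
  define B where "B = B0 * (1 + 2 / R + 8 / R^2)"
  have B: "B \<ge> B0" "B \<ge> 2 * B0 / R" "B \<ge> 8 * B0 / R^2" using B0 R by (auto simp: B_def field_simps)
  show ?thesis
  proof (rule that[of B])
    show "B \<ge> 1" using B B0 by simp
    fix s assume s: "s \<in> strip r"
    have t: "ht s powr (1/16) \<ge> 0" by simp
    have e: "zeta s = ?zt s" "deriv zeta s = deriv ?zt s" "deriv (deriv zeta) s = deriv (deriv ?zt) s"
      using eventually_nhds_x_imp_x[OF ev[OF s]] eventually_nhds_x_imp_x[OF ev1[OF s]] deriv_cong_ev[OF ev1[OF s] refl] by auto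
    have "norm (zeta s) \<le> B0 * ht s powr (1/16)" unfolding e using bd[OF s, of s] R by simp
    also have "\<dots> \<le> B * ht s powr (1/16)" using B t by (intro mult_right_mono)
    finally show "norm (zeta s) \<le> B * ht s powr (1/16)" .
    note c = cauchy_bounds[OF hol[OF s] R(1) bd[OF s]]
    have "norm (deriv zeta s) \<le> (2 * B0 / R) * ht s powr (1/16)" unfolding e using c(1) by (simp add: mult_ac)
    also have "\<dots> \<le> B * ht s powr (1/16)" using B t by (intro mult_right_mono)
    finally show "norm (deriv zeta s) \<le> B * ht s powr (1/16)" .
    have "norm (deriv (deriv zeta) s) \<le> (8 * B0 / R^2) * ht s powr (1/16)" unfolding e using c(2) by (simp add: mult_ac)
    also have "\<dots> \<le> B * ht s powr (1/16)" using B t by (intro mult_right_mono)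
    finally show "norm (deriv (deriv zeta) s) \<le> B * ht s powr (1/16)" .
  qed
qed

text \<open>The 3-4-1 inequality bounds (Re s - 1)^3 by a constant times ht^(1/16) |zeta s|^4, which
  is weak close to Re s = 1. Points nearer than A ht^(-5/16) are reached horizontally from that
  distance by the bound for zeta'. The exponent 5/16 balances the two: 3 (5/16) + 1/16 = 4 (1/4),
  and 1/16 - 5/16 = -1/4.\<close>

lemma zeta_far_lower:
  assumes r: "0 < r" "r \<le> 1"
  obtains c where "c > 0" "\<And>s. s \<in> strip r \<Longrightarrow> norm (zeta s) \<ge> c * ht s powr (- 1/4)"
proof -
  obtain B where B: "B \<ge> 1" "\<And>s. s \<in> strip r \<Longrightarrow> norm (zeta s) \<le> B * ht s powr (1/16)"
    "\<And>s. s \<in> strip r \<Longrightarrow> norm (deriv zeta s) \<le> B * ht s powr (1/16)"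
    using zeta_far_upper[OF r] by metis
  obtain H where H: "H \<ge> 0" "\<And>s. Re s \<ge> 1 - (1/16) / 2 \<Longrightarrow> norm (zeta_reg s - 1) \<le> H * norm (s - 1) * norm s powr (1/16)"
    by (rule zeta_reg_bound[of "1/16"]) auto
  define K where "K = 1 + 2 * H"
  have K: "K \<ge> 1" using H by (simp add: K_def)
  have zr: "norm (zeta (of_real x)) \<le> K / (x - 1)" if x: "1 < x" "x \<le> 2" for x
  proof -
    have "x powr (1/16) \<le> x powr 1" using x by (intro powr_mono) auto
    hence x2: "x powr (1/16) \<le> 2" using x by simp
    have nx: "norm (complex_of_real x - 1) = x - 1" using x by (metis abs_of_pos diff_gt_0_iff_gt norm_of_real of_real_1 of_real_diff)
    have "norm (zeta_reg (of_real x)) \<le> 1 + norm (zeta_reg (of_real x) - 1)" using norm_triangle_ineq[of 1 "zeta_reg (of_real x) - 1"] by simp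
    also have "\<dots> \<le> 1 + H * (x - 1) * x powr (1/16)" using H(2)[of "of_real x"] x nx by simp
    also have "\<dots> \<le> 1 + H * 1 * 2" using x x2 H by (intro add_left_mono mult_mono) auto
    finally have Z: "norm (zeta_reg (of_real x)) \<le> K" by (simp add: K_def)
    have "norm (zeta_reg (of_real x)) = (x - 1) * norm (zeta (of_real x))"
      using zeta_reg_zeta[of "of_real x"] x nx by (simp add: norm_mult)
    thus ?thesis using Z x by (simp add: field_simps)
  qed
  define K2 where "K2 = 2 * B * K^3"
  have K2: "K2 \<ge> 1"
  proof -
    have "1 * 1 \<le> (2 * B) * K^3" using B K by (intro mult_mono one_le_power) auto
    thus ?thesis by (simp add: K2_def)
  qed
  have main: "(Re s - 1)^3 \<le> K2 * ht s powr (1/16) * norm (zeta s)^4" if s: "s \<in> strip r" for s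
  proof -
    define x t where "x = Re s" and "t = Im s"
    have sx: "s = Complex x t" by (simp add: x_def t_def)
    have x: "1 < x" "x \<le> 2" using s by (auto simp: strip_def x_def)
    have far2: "Complex x (2 * t) \<in> strip r"
    proof -
      have "r \<le> norm (Complex (x - 1) t)" using s by (simp add: strip_def sx complex_diff one_complex.code)
      also have "\<dots> \<le> norm (Complex (x - 1) (2 * t))" by (simp add: cmod_def power2_eq_square)
      finally show ?thesis using x by (simp add: strip_def one_complex.code complex_diff)
    qed
    have t2: "ht (Complex x (2 * t)) \<le> 2 * ht s" by (simp add: ht_def sx)
    have "norm (zeta (Complex x (2 * t))) \<le> B * ht (Complex x (2 * t)) powr (1/16)" by (rule B(2)[OF far2])
    also have "\<dots> \<le> B * (2 * ht s) powr (1/16)"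
      using t2 B ht_ge[of "Complex x (2 * t)"] by (intro mult_left_mono powr_mono2) auto
    also have "\<dots> = B * (2 powr (1/16) * ht s powr (1/16))" using ht_ge[of s] by (simp add: powr_mult)
    also have "\<dots> \<le> B * (2 powr 1 * ht s powr (1/16))" using B by (intro mult_left_mono mult_right_mono powr_mono) auto
    finally have z2: "norm (zeta (Complex x (2 * t))) \<le> 2 * B * ht s powr (1/16)" by simp
    have "1 \<le> norm (zeta (of_real x)) ^ 3 * norm (zeta s) ^ 4 * norm (zeta (Complex x (2 * t)))"
      using zeta_341[OF x(1), of t] by (simp add: sx)
    also have "\<dots> \<le> (K / (x - 1))^3 * norm (zeta s) ^ 4 * (2 * B * ht s powr (1/16))"
      using zr[OF x] z2 x K by (intro mult_mono power_mono) auto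
    also have "\<dots> = K2 * ht s powr (1/16) * norm (zeta s)^4 / (x - 1)^3" by (simp add: K2_def power_divide)
    finally show ?thesis using x by (simp add: x_def[symmetric] field_simps)
  qed
  \<comment> \<open>This value makes the lower bound that the 3-4-1 inequality gives at distance
    \<open>A * ht s powr (-5/16)\<close> from the line equal to twice the oscillation of \<open>zeta\<close> over that distance.\<close>
  define A where "A = 1 / (16 * B^4 * K2)"
  have BK: "1 \<le> B^4 * K2" using B K2 mult_mono[of 1 "B^4" 1 K2] one_le_power[of B 4] by auto
  have A: "0 < A" "A \<le> 1" using BK B K2 by (auto simp: A_def field_simps)
  have case1: "norm (zeta s) \<ge> 2 * B * A * ht s powr (- 1/4)" if s: "s \<in> strip r" and x: "Re s - 1 \<ge> A * ht s powr (- 5/16)" for s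
  proof -
    have t: "ht s > 0" using ht_ge[of s] by simp
    have "(2 * B * A * ht s powr (- 1/4))^4 = 16 * B^4 * A^4 * ht s powr (- 1)"
      using t by (simp add: power_mult_distrib powr_power_real)
    also have "16 * B^4 * A^4 = A^3 / K2"
      using B K2 by (simp add: A_def field_simps eval_nat_numeral)
    also have "A^3 / K2 * ht s powr (- 1) = (A * ht s powr (- 5/16))^3 * ht s powr (- 1/16) / K2"
    proof -
      have e: "(ht s powr (- 5/16))^3 * ht s powr (- 1/16) = ht s powr (- 1)"
        unfolding powr_power_real[OF t] powr_add[symmetric] by simp
      show ?thesis unfolding e[symmetric] by (simp add: power_mult_distrib)
    qed
    also have "\<dots> \<le> (Re s - 1)^3 * ht s powr (- 1/16) / K2"
      using x A K2 by (intro divide_right_mono mult_right_mono power_mono) auto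
    also have "\<dots> \<le> (K2 * ht s powr (1/16) * norm (zeta s)^4) * ht s powr (- 1/16) / K2"
      using main[OF s] K2 by (intro divide_right_mono mult_right_mono) auto
    also have "\<dots> = norm (zeta s)^4 * (ht s powr (1/16) * ht s powr (- 1/16))" using K2 by simp
    also have "\<dots> = norm (zeta s)^4" using t by (simp add: powr_add[symmetric])
    finally have "(2 * B * A * ht s powr (- 1/4)) ^ Suc 3 \<le> norm (zeta s) ^ Suc 3" by (simp add: eval_nat_numeral)
    thus ?thesis by (rule power_le_imp_le_base) simp
  qed
  have "norm (zeta s) \<ge> B * A * ht s powr (- 1/4)" if s: "s \<in> strip r" for s
  proof (cases "Re s - 1 \<ge> A * ht s powr (- 5/16)")
    case True
    have "B * A * ht s powr (- 1/4) \<le> 2 * B * A * ht s powr (- 1/4)" using A B by simp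
    thus ?thesis using case1[OF s True] by linarith
  next
    case False
    define e where "e = A * ht s powr (- 5/16)"
    have t: "ht s \<ge> 4" by (rule ht_ge)
    have "ht s powr (- 5/16) \<le> ht s powr 0" using t by (intro powr_mono) auto
    hence e: "0 < e" "e \<le> 1" using A t mult_mono[of A 1 "ht s powr (- 5/16)" 1] by (auto simp: e_def)
    define s1 where "s1 = Complex (1 + e) (Im s)"
    \<comment> \<open>Moving to the right increases the distance from 1 and keeps the height, so the
      derivative bound is uniform on the segment.\<close>
    have seg: "v \<in> strip r" "ht v = ht s" if vs: "v \<in> closed_segment s s1" for v
    proof -
      obtain u where u: "v = (1 - u) *\<^sub>R s + u *\<^sub>R s1" "0 \<le> u" "u \<le> 1"
        using vs by (auto simp: closed_segment_def)
      have "Re v = Re s + u * (1 + e - Re s)" "Re v = 1 + e - (1 - u) * (1 + e - Re s)" "Im v = Im s"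
        by (simp_all add: u(1) s1_def algebra_simps)
      moreover have "0 \<le> u * (1 + e - Re s)" "0 \<le> (1 - u) * (1 + e - Re s)"
        using u False by (auto simp: e_def)
      ultimately have v: "Re s \<le> Re v" "Re v \<le> 1 + e" "Im v = Im s" by linarith+
      have "r \<le> norm (s - 1)" using s by (simp add: strip_def)
      also have "\<dots> \<le> norm (v - 1)"
        using v s by (simp add: cmod_def strip_def power_mono)
      finally show "v \<in> strip r" using v s e by (simp add: strip_def)
      show "ht v = ht s" using v by (simp add: ht_def)
    qed
    have "norm (zeta s - zeta s1) \<le> (B * ht s powr (1/16)) * norm (s - s1)"
    proof (rule field_differentiable_bound[where S="closed_segment s s1"])
      fix v assume v: "v \<in> closed_segment s s1"
      show "(zeta has_field_derivative deriv zeta v) (at v within closed_segment s s1)"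
        by (rule holomorphic_derivI[OF zeta_holomorphic open_halfspace_Re_gt]) (use seg[OF v] in \<open>auto simp: strip_def\<close>)
      show "norm (deriv zeta v) \<le> B * ht s powr (1/16)" using B(3)[OF seg(1)[OF v]] seg(2)[OF v] by simp
    qed auto
    also have "norm (s - s1) \<le> e"
    proof -
      have "s - s1 = of_real (Re s - (1 + e))" by (simp add: s1_def complex_eq_iff)
      thus ?thesis using False s by (simp add: e_def strip_def del: of_real_diff of_real_add)
    qed
    also have "B * ht s powr (1/16) * e = B * A * (ht s powr (1/16) * ht s powr (- 5/16))" by (simp add: e_def)
    also have "\<dots> = B * A * ht s powr (- 1/4)" using t by (simp add: powr_add[symmetric])
    finally have d: "norm (zeta s - zeta s1) \<le> B * A * ht s powr (- 1/4)" using B by (simp add: mult_left_mono)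
    have s1: "s1 \<in> strip r" "ht s1 = ht s" using seg[of s1] by auto
    have "2 * B * A * ht s powr (- 1/4) \<le> norm (zeta s1)"
      using case1[OF s1(1)] s1(2) by (simp add: s1_def e_def)
    thus ?thesis using d norm_triangle_ineq2[of "zeta s1" "zeta s"] by (simp add: norm_minus_commute)
  qed
  thus ?thesis using that[of "B * A"] A B by auto
qed

section \<open>The Dirichlet series of the arithmetic function\<close>

text \<open>Closed form of the local series 1 + sum over m >= 1 of ((m + 1) / k) y^m, from the
  expansion of 1 / (1 - y)^2.\<close>

definition euler_local :: "nat \<Rightarrow> complex \<Rightarrow> complex" where
  "euler_local k y = 1 + (1 / (1 - y)^2 - 1) / of_nat k"

text \<open>
  The logarithm of the Euler factor with the factor of \<open>zeta powr (2 / k)\<close> divided out; it is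
  \<open>O(y\<^sup>2)\<close>, which is why its sum over the primes converges to the left of the line \<open>Re s = 1\<close>.
\<close>
definition log_local_corr :: "nat \<Rightarrow> complex \<Rightarrow> complex" where
  "log_local_corr k y = of_real (2 / real k) * Ln (1 - y) + Ln (euler_local k y)"

text \<open>u = 1 / (1 - y) has positive real part. A real value r <= 0 would force u^2 = k (r - 1)
  + 1 <= -1, where k >= 2 enters; but a real u^2 with Re u > 0 means that u is real, so u^2 >=
  0.\<close>

lemma euler_local_not_nonpos:
  assumes k: "k \<ge> 2" and y: "norm y < 1"
  shows "euler_local k y \<notin> \<real>\<^sub>\<le>\<^sub>0"
proof
  assume *: "euler_local k y \<in> \<real>\<^sub>\<le>\<^sub>0"
  define u where "u = 1 / (1 - y)"
  have R: "Re (1 - y) > 0" using complex_Re_le_cmod[of y] y by auto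
  hence "1 - y \<noteq> 0" by auto
  hence u0: "Re u > 0" using R unfolding u_def Re_complex_div_gt_0[of 1] by simp
  obtain r where r: "r \<le> 0" "euler_local k y = of_real r" using * by (auto elim!: nonpos_Reals_cases)
  have "u^2 = of_nat k * (of_real r - 1) + 1"
    using r(2) k by (simp add: euler_local_def u_def power_divide field_simps)
  also have "\<dots> = of_real (real k * (r - 1) + 1)" by simp
  finally have u2: "u^2 = of_real (real k * (r - 1) + 1)" .
  have "Im (u^2) = 0" unfolding u2 by (rule Im_complex_of_real)
  hence "Im u = 0" using u0 by (simp add: power2_eq_square)
  hence "Re (u^2) \<ge> 0" by (simp add: power2_eq_square)
  hence "real k * (r - 1) + 1 \<ge> 0" unfolding u2 by simp
  moreover have "real k * (r - 1) + 1 \<le> 2 * (r - 1) + 1" using k r by (intro add_right_mono mult_right_mono_neg) auto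
  ultimately have "0 \<le> 2 * (r - 1) + 1" by (rule order_trans)
  thus False using r by simp
qed

lemma log_local_corr_holomorphic:
  assumes k: "k \<ge> 2"
  shows "log_local_corr k holomorphic_on ball 0 1"
proof -
  have 1: "1 - y \<noteq> 0" if "norm y < 1" for y :: complex using that by auto
  have "euler_local k holomorphic_on ball 0 1"
    unfolding euler_local_def using k 1 by (intro holomorphic_intros) auto
  thus ?thesis unfolding log_local_corr_def using euler_local_not_nonpos[OF k] one_minus_nonpos
    by (intro holomorphic_intros) auto
qed

lemma log_local_corr_0: "log_local_corr k 0 = 0" by (simp add: log_local_corr_def euler_local_def)

text \<open>The linear coefficients -2 / k and 2 / k cancel; this is what fixes the exponent 2 / k
  of zeta.\<close>

lemma log_local_corr_deriv_0:
  assumes k: "k \<ge> 2"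
  shows "(log_local_corr k has_field_derivative 0) (at 0)"
proof -
  have l0: "euler_local k 0 = 1" by (simp add: euler_local_def)
  have d: "(euler_local k has_field_derivative 2 / of_nat k) (at 0)"
    unfolding euler_local_def using k by (auto intro!: derivative_eq_intros simp: field_simps)
  have "((\<lambda>y. Ln (euler_local k y)) has_field_derivative 1 / euler_local k 0 * (2 / of_nat k)) (at 0)"
    by (rule DERIV_chain2[OF _ d]) (auto simp: l0 intro!: derivative_eq_intros)
  hence 1: "((\<lambda>y. Ln (euler_local k y)) has_field_derivative 2 / of_nat k) (at 0)" by (simp add: l0)
  have 2: "((\<lambda>y. Ln (1 - y)) has_field_derivative - 1) (at (0::complex))"
    by (auto intro!: derivative_eq_intros)
  have "(log_local_corr k has_field_derivative of_real (2 / real k) * (- 1) + 2 / of_nat k) (at 0)"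
    unfolding log_local_corr_def by (intro DERIV_add DERIV_cmult 1 2)
  thus ?thesis by simp
qed

text \<open>Value and first derivative vanish at 0, and the second derivative is bounded on a
  compact disc, so two mean value estimates suffice. The radius 3/5 lies between 2^(-3/4) and
  1.\<close>

lemma log_local_corr_bound:
  assumes k: "k \<ge> 2"
  obtains C where "C \<ge> 0" "\<And>y. norm y \<le> 3/5 \<Longrightarrow> norm (log_local_corr k y) \<le> C * norm y ^ 2"
proof -
  let ?l = "log_local_corr k"
  have h: "?l holomorphic_on ball 0 1" by (rule log_local_corr_holomorphic[OF k])
  have h1: "deriv ?l holomorphic_on ball 0 1" by (intro holomorphic_deriv h) auto
  have h2: "deriv (deriv ?l) holomorphic_on ball 0 1" by (intro holomorphic_deriv h1) auto
  have "continuous_on (cball 0 (3/5)) (deriv (deriv ?l))"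
    by (rule continuous_on_subset[OF holomorphic_on_imp_continuous_on[OF h2]]) auto
  hence "compact (deriv (deriv ?l) ` cball 0 (3/5))" by (intro compact_continuous_image) auto
  hence "bounded (deriv (deriv ?l) ` cball 0 (3/5))" by (rule compact_imp_bounded)
  then obtain C where C: "C > 0" "\<And>y. y \<in> cball 0 (3/5) \<Longrightarrow> norm (deriv (deriv ?l) y) \<le> C"
    unfolding bounded_pos by blast
  have d0: "deriv ?l 0 = 0" using log_local_corr_deriv_0[OF k] by (rule DERIV_imp_deriv)
  have b1: "norm (deriv ?l y) \<le> C * norm y" if y: "norm y \<le> 3/5" for y
  proof -
    have "norm (deriv ?l y - deriv ?l 0) \<le> C * norm (y - 0)"
    proof (rule field_differentiable_bound[where S="cball 0 (3/5)"])
      show "(deriv ?l has_field_derivative deriv (deriv ?l) z) (at z within cball 0 (3/5))" if "z \<in> cball 0 (3/5)" for z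
        by (rule holomorphic_derivI[OF h1]) (use that in auto)
    qed (use C y in auto)
    thus ?thesis by (simp add: d0)
  qed
  have "norm (?l y) \<le> C * norm y ^ 2" if y: "norm y \<le> 3/5" for y
  proof -
    have "norm (?l y - ?l 0) \<le> (C * norm y) * norm (y - 0)"
    proof (rule field_differentiable_bound[where S="cball 0 (norm y)"])
      fix z :: complex assume z: "z \<in> cball 0 (norm y)"
      show "(?l has_field_derivative deriv ?l z) (at z within cball 0 (norm y))"
        by (rule holomorphic_derivI[OF h]) (use z y in auto)
      have "norm (deriv ?l z) \<le> C * norm z" using z y by (intro b1) auto
      also have "\<dots> \<le> C * norm y" using z C by (intro mult_left_mono) auto
      finally show "norm (deriv ?l z) \<le> C * norm y" .
    qed auto
    thus ?thesis by (simp add: log_local_corr_0 power2_eq_square)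
  qed
  thus ?thesis using that[of C] C by auto
qed

lemma prime_powr_bound_35:
  assumes "prime p" "Re s > 3/4"
  shows "norm (of_nat p powr (- s) :: complex) \<le> 3/5"
proof -
  have p: "real p \<ge> 2" using prime_ge_2_nat[OF assms(1)] by simp
  have "real p powr (- Re s) \<le> real p powr (- 3/4)" using p assms by (intro powr_mono) auto
  also have "\<dots> \<le> 2 powr (- 3/4)" using p by (intro powr_mono2') auto
  also have "\<dots> \<le> 3/5"
  \<comment> \<open>Fourth powers are compared: 1/8 is less than 81/625.\<close>
  proof (rule power_le_imp_le_base[of _ 3])
    have "((2::real) powr (- 3/4)) ^ 4 = 1/8"
      by (subst powr_power_real) (simp_all add: powr_minus_divide)
    thus "(2 powr (- 3/4)) ^ Suc 3 \<le> (3/5 :: real) ^ Suc 3" by (simp add: eval_nat_numeral)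
  qed simp
  finally show ?thesis by (simp add: norm_of_nat_powr)
qed

definition log_corr :: "nat \<Rightarrow> complex \<Rightarrow> complex" where "log_corr k = prime_sum (log_local_corr k)"

text \<open>The quadratic bound dominates the terms by n^(-3/2), uniformly for Re s > 3/4. This
  half-plane leaves a margin of 1/4 to the left of Re s = 1 for Cauchy's estimates.\<close>

lemma log_corr_series:
  assumes k: "k \<ge> 2"
  obtains G where "G \<ge> 0" "log_corr k holomorphic_on {s. Re s > 3/4}"
    "\<And>s. Re s > 3/4 \<Longrightarrow> summable (\<lambda>n. norm (if prime n then log_local_corr k (of_nat n powr (- s)) else 0))"
    "\<And>s. Re s > 3/4 \<Longrightarrow> norm (log_corr k s) \<le> G"
proof -
  obtain C where C: "C \<ge> 0" "\<And>y. norm y \<le> 3/5 \<Longrightarrow> norm (log_local_corr k y) \<le> C * norm y ^ 2"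
    using log_local_corr_bound[OF k] by blast
  have bd: "norm (log_local_corr k (of_nat n powr (- s))) \<le> C * norm (of_nat n powr (- s) :: complex) ^ 2" if "prime n" "Re s > 3/4" for n s
    using C(2) prime_powr_bound_35 that by blast
  have hol: "log_corr k holomorphic_on {s. Re s > 3/4}"
    unfolding log_corr_def by (rule prime_sum_holomorphic[OF log_local_corr_holomorphic[OF k], where b=2 and C=C]) (use bd C in auto)
  have sm: "summable (\<lambda>n. norm (if prime n then log_local_corr k (of_nat n powr (- s)) else 0))" if "Re s > 3/4" for s
    by (rule prime_sum_summable[where b=2 and C=C]) (use bd C that in auto)
  have sm2: "summable (\<lambda>n. C * real n powr (- (3/2)))" by (intro summable_mult summable_powr) auto
  have "norm (log_corr k s) \<le> (\<Sum>n. C * real n powr (- (3/2)))" if s: "Re s > 3/4" for s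
    unfolding log_corr_def prime_sum_def
  proof (rule norm_suminf_le[OF _ sm2])
    fix n
    show "norm (if prime n then log_local_corr k (of_nat n powr (- s)) else 0) \<le> C * real n powr (- (3/2))"
    proof (cases "prime n")
      case True
      have "norm (of_nat n powr (- s) :: complex) ^ 2 = real n powr (- Re s * 2)"
        using True by (simp add: norm_of_nat_powr powr_power_real prime_gt_0_nat)
      also have "\<dots> \<le> real n powr (- (3/2))" using s prime_gt_1_nat[OF True] by (intro powr_mono) auto
      finally have "C * norm (of_nat n powr (- s) :: complex) ^ 2 \<le> C * real n powr (- (3/2))" using C by (intro mult_left_mono)
      thus ?thesis using bd[OF True s] True by auto
    qed (use C in auto)
  qed
  moreover have "0 \<le> (\<Sum>n. C * real n powr (- (3/2)))" by (intro suminf_nonneg sm2) (use C in auto)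
  ultimately show ?thesis using that hol sm by blast
qed

lemma D_omega_sums:
  assumes p: "prime p" and k: "k \<ge> 1" and y: "norm y < 1"
  shows "(\<lambda>m. complex_of_real (D_omega k (p ^ m)) * y ^ m) sums euler_local k y"
proof -
  have 1: "(\<lambda>m. of_nat (Suc m) * y ^ m) sums (1 / (1 - y)^2)" by (rule geometric_deriv_sums[OF y])
  \<comment> \<open>At m = 0 the coefficient is 1 and not 1 / k, since p^0 has no prime divisor;
    this series carries the correction.\<close>
  have 2: "(\<lambda>m. if m = 0 then 1 - 1 / of_nat k else (0::complex)) sums (1 - 1 / of_nat k)"
    by (rule sums_single)
  have "(\<lambda>m. of_nat (Suc m) * y ^ m / of_nat k + (if m = 0 then 1 - 1 / of_nat k else 0)) sums (1 / (1 - y)^2 / of_nat k + (1 - 1 / of_nat k))"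
    by (intro sums_add sums_divide 1 2)
  moreover have "of_nat (Suc m) * y ^ m / of_nat k + (if m = 0 then 1 - 1 / of_nat k else 0) = complex_of_real (D_omega k (p ^ m)) * y ^ m" for m
  proof (cases "m = 0")
    case False
    thus ?thesis using D_omega_prime_power[OF p, of m k] by simp
  qed (use D_omega_1[of k] in simp)
  moreover have "1 / (1 - y)^2 / of_nat k + (1 - 1 / of_nat k) = euler_local k y"
    by (simp add: euler_local_def diff_divide_distrib)
  ultimately show ?thesis by simp
qed

definition D_series :: "nat \<Rightarrow> complex \<Rightarrow> complex" where
  "D_series k = dirichlet (\<lambda>n. of_real (D_omega k n))"

lemma D_series_summable:
  assumes "k \<ge> 1" "Re s > 1"
  shows "summable (\<lambda>n. norm (complex_of_real (D_omega k n) * of_nat n powr (- s)))"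
  using summable_D_omega[OF assms] D_omega_nonneg by (simp add: norm_mult norm_of_nat_powr)

text \<open>The factorization is done on logarithms, prime by prime: by definition
  \<open>log_local_corr\<close> is what remains of Ln of the local factor after subtracting 2 / k
  times -Ln(1 - y). Linearity of the sum over primes does the rest.\<close>

lemma D_series_eq_exp:
  assumes k: "k \<ge> 2" and s: "Re s > 1"
  shows "D_series k s = exp (of_real (2 / real k) * log_zeta s + log_corr k s)"
proof -
  let ?L = "\<lambda>y. Ln (euler_local k y)"
  let ?z = "complex_of_real (2 / real k)"
  let ?y = "\<lambda>n. of_nat n powr (- s) :: complex"
  have sg: "summable (\<lambda>n. norm (if prime n then log_local_corr k (?y n) else 0))"
    by (rule log_corr_series[OF k]) (use s in auto)
  have sl: "summable (\<lambda>n. norm (if prime n then - Ln (1 - ?y n) else 0))" by (rule log_zeta_summable[OF s])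
  have eq: "(if prime n then ?L (?y n) else 0) = ?z * (if prime n then - Ln (1 - ?y n) else 0) + (if prime n then log_local_corr k (?y n) else 0)" for n
    by (simp add: log_local_corr_def)
  have sL: "summable (\<lambda>n. norm (if prime n then ?L (?y n) else 0))"
    unfolding eq
  proof (rule summable_comparison_test[OF _ summable_add[OF summable_mult[OF sl, of "norm ?z"] sg]])
    show "\<exists>N. \<forall>n\<ge>N. norm (norm (?z * (if prime n then - Ln (1 - ?y n) else 0) + (if prime n then log_local_corr k (?y n) else 0)))
       \<le> norm ?z * norm (if prime n then - Ln (1 - ?y n) else 0) + norm (if prime n then log_local_corr k (?y n) else 0)"
      by (intro exI[of _ 0] allI impI) (simp add: norm_mult[symmetric] norm_triangle_ineq del: norm_mult)
  qed
  have "D_series k s = exp (prime_sum ?L s)"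
    unfolding D_series_def
  proof (rule dirichlet_euler_exp[OF _ _ D_series_summable _ sL])
    fix p m n :: nat assume *: "prime p" "\<not> p dvd n" "n > 0"
    hence "coprime (p ^ m) n" by (simp add: prime_imp_coprime)
    thus "complex_of_real (D_omega k (p ^ m * n)) = of_real (D_omega k (p ^ m)) * of_real (D_omega k n)"
      using * D_omega_mult[of "p ^ m" n k] by (simp add: prime_gt_0_nat)
  next
    fix p :: nat assume p: "prime p"
    have y: "norm (?y p) < 1" using prime_powr_bound(1)[OF p] s by auto
    have "exp (?L (?y p)) = euler_local k (?y p)"
      using euler_local_not_nonpos[OF k y] by (intro exp_Ln) auto
    thus "(\<lambda>m. complex_of_real (D_omega k (p ^ m)) * ?y p ^ m) sums exp (?L (?y p))"
      using D_omega_sums[OF p _ y] k by simp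
  qed (use k s D_omega_1[of k] in auto)
  also have "prime_sum ?L s = ?z * log_zeta s + log_corr k s"
    unfolding prime_sum_def log_zeta_def log_corr_def eq
    by (subst suminf_add[symmetric] suminf_mult[symmetric]
      | intro summable_mult summable_norm_cancel[OF sl] summable_norm_cancel[OF sg] refl)+
  finally show ?thesis .
qed

text \<open>At s = 1 the arguments of both logarithms are positive reals, so the exponential undoes
  them; with q = 1 / p, 1 / (1 - q)^2 - 1 equals (2 p - 1) / (p - 1)^2.\<close>

lemma euler_factor_eq:
  assumes k: "k \<ge> 2" and p: "prime p"
  shows "euler_factor k p = exp (Re (log_local_corr k (of_nat p powr (- 1))))"
proof -
  define q where "q = 1 / real p"
  have p2: "real p \<ge> 2" using prime_ge_2_nat[OF p] by simp
  have q: "0 < q" "q \<le> 1/2" using p2 by (auto simp: q_def field_simps)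
  have y: "(of_nat p powr (- 1) :: complex) = of_real q"
    using p2 by (simp add: q_def powr_minus powr_to_1 inverse_eq_divide)
  have n: "norm (complex_of_real q) < 1" using q by simp
  have e1: "euler_local k (of_real q) = of_real (1 + (1 / (1 - q)^2 - 1) / real k)"
    by (simp add: euler_local_def)
  have q1: "1 \<le> 1 / (1 - q)^2" using q by (simp add: field_simps power_le_one)
  have pos: "1 + (1 / (1 - q)^2 - 1) / real k > 0" using q1 by (intro add_pos_nonneg) auto
  have l: "log_local_corr k (of_real q) = of_real (2 / real k * ln (1 - q) + ln (1 + (1 / (1 - q)^2 - 1) / real k))"
    unfolding log_local_corr_def e1 using pos q Ln_of_real[of "1 - q"] Ln_of_real[OF pos] by simp
  have "exp (Re (log_local_corr k (of_nat p powr (- 1)))) = (1 - q) powr (2 / real k) * (1 + (1 / (1 - q)^2 - 1) / real k)"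
    unfolding y l using pos q by (simp add: exp_add powr_def)
  also have "(1 / (1 - q)^2 - 1) / real k = (2 * real p - 1) / (real k * (real p - 1)^2)"
  proof -
    have "1 - q = (real p - 1) / real p" using p2 by (simp add: q_def field_simps)
    hence "1 / (1 - q)^2 - 1 = (real p)^2 / (real p - 1)^2 - 1" by (simp add: power_divide)
    also have "\<dots> = ((real p)^2 - (real p - 1)^2) / (real p - 1)^2" using p2 by (simp add: diff_divide_distrib)
    also have "(real p)^2 - (real p - 1)^2 = 2 * real p - 1" by (simp add: power2_eq_square algebra_simps)
    finally show ?thesis by (simp add: mult.commute)
  qed
  finally show ?thesis by (simp add: euler_factor_def q_def)
qed

text \<open>The factors are exponentials of a convergent series of reals, which yields convergence
  of the product as well as its value.\<close>

lemma euler_factor_prod: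
  assumes k: "k \<ge> 2"
  shows "convergent_prod (on_primes (euler_factor k))"
    "(\<Prod>p. on_primes (euler_factor k) p) = exp (Re (log_corr k 1))"
proof -
  let ?a = "\<lambda>n. if prime n then log_local_corr k (of_nat n powr (- 1)) else 0"
  have sm: "summable ?a"
    by (rule log_corr_series[OF k], rule summable_norm_cancel) auto
  have eq: "on_primes (euler_factor k) = (\<lambda>n. exp (Re (?a n)))"
    using euler_factor_eq[OF k] by (auto simp: on_primes_def fun_eq_iff)
  have smR: "summable (\<lambda>n. Re (?a n))" by (rule summable_Re[OF sm])
  show "convergent_prod (on_primes (euler_factor k))" unfolding eq by (rule convergent_prod_exp[OF smR])
  have "(\<Prod>p. on_primes (euler_factor k) p) = exp (\<Sum>n. Re (?a n))" unfolding eq by (rule prodinf_exp[OF smR])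
  also have "(\<Sum>n. Re (?a n)) = Re (log_corr k 1)" unfolding log_corr_def prime_sum_def by (rule Re_suminf[OF sm, symmetric])
  finally show "(\<Prod>p. on_primes (euler_factor k) p) = exp (Re (log_corr k 1))" .
qed

section \<open>The transform and its second derivative\<close>

text \<open>The logarithmic derivative of \<open>D_series k s / s\<close>; the last term comes from
  the denominator.\<close>

definition log_deriv :: "nat \<Rightarrow> complex \<Rightarrow> complex" where
  "log_deriv k s = of_real (2 / real k) * (deriv zeta s / zeta s) + deriv (log_corr k) s - 1 / s"

definition log_deriv' :: "nat \<Rightarrow> complex \<Rightarrow> complex" where
  "log_deriv' k s = of_real (2 / real k) * (deriv (deriv zeta) s / zeta s - (deriv zeta s / zeta s)^2) + deriv (deriv (log_corr k)) s + 1 / s^2"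

text \<open>The Laplace transform of S(e^v) e^(-v), as \<open>laplace_D_sum\<close> shows.\<close>

definition D_transform :: "nat \<Rightarrow> complex \<Rightarrow> complex" where "D_transform k w = D_series k (1 + w) / (1 + w)"

text \<open>The second derivative in the form g'' = g (l^2 + l') with l = g' / g, which keeps the
  size of g and of its logarithmic derivatives apart.\<close>

definition D_transform'' :: "nat \<Rightarrow> complex \<Rightarrow> complex" where
  "D_transform'' k w = D_transform k w * (log_deriv k (1 + w) ^ 2 + log_deriv' k (1 + w))"

text \<open>The second derivative of C w^(-z) with z = 2 / k, where C = exp (Re
  (\<open>log_corr k 1\<close>)) is the Euler product.\<close>

definition polar_part :: "nat \<Rightarrow> complex \<Rightarrow> complex" where
  "polar_part k w = of_real (exp (Re (log_corr k 1)) * (2 / real k) * (2 / real k + 1)) * w powr of_real (- (2 / real k) - 2)"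

lemma halfplane_open: "open {s. Re s > a}" by (rule open_halfspace_Re_gt)

lemma zeta_nonzero: "Re s > 1 \<Longrightarrow> zeta s \<noteq> 0" by (simp add: zeta_eq_exp_log_zeta)

lemma log_corr_holomorphic: "k \<ge> 2 \<Longrightarrow> log_corr k holomorphic_on {s. Re s > 3/4}"
  by (rule log_corr_series)

lemma deriv_log_corr:
  assumes "k \<ge> 2" "Re s > 3/4"
  shows "(log_corr k has_field_derivative deriv (log_corr k) s) (at s)"
    "(deriv (log_corr k) has_field_derivative deriv (deriv (log_corr k)) s) (at s)"
proof -
  note h = log_corr_holomorphic[OF assms(1)]
  show "(log_corr k has_field_derivative deriv (log_corr k) s) (at s)"
    by (rule holomorphic_derivI[OF h halfplane_open]) (use assms in auto)
  show "(deriv (log_corr k) has_field_derivative deriv (deriv (log_corr k)) s) (at s)"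
    by (rule holomorphic_derivI[OF holomorphic_deriv[OF h halfplane_open] halfplane_open]) (use assms in auto)
qed

lemma deriv_zeta:
  assumes "Re s > 1"
  shows "(zeta has_field_derivative deriv zeta s) (at s)"
    "(deriv zeta has_field_derivative deriv (deriv zeta) s) (at s)"
proof -
  note h = zeta_holomorphic
  show "(zeta has_field_derivative deriv zeta s) (at s)"
    by (rule holomorphic_derivI[OF h halfplane_open]) (use assms in auto)
  show "(deriv zeta has_field_derivative deriv (deriv zeta) s) (at s)"
    by (rule holomorphic_derivI[OF holomorphic_deriv[OF h halfplane_open] halfplane_open]) (use assms in auto)
qed

lemma deriv_log_zeta:
  assumes s: "Re s > 1"
  shows "(log_zeta has_field_derivative deriv zeta s / zeta s) (at s)"
proof -
  have d: "(log_zeta has_field_derivative deriv log_zeta s) (at s)"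
    by (rule holomorphic_derivI[OF log_zeta_holomorphic halfplane_open]) (use s in auto)
  have "((\<lambda>s. exp (log_zeta s)) has_field_derivative exp (log_zeta s) * deriv log_zeta s) (at s)"
    by (rule DERIV_chain2[OF DERIV_exp d])
  hence "(zeta has_field_derivative exp (log_zeta s) * deriv log_zeta s) (at s)"
    by (rule has_field_derivative_transform_within_open[OF _ halfplane_open[of 1]]) (use s in \<open>auto simp: zeta_eq_exp_log_zeta\<close>)
  from DERIV_unique[OF deriv_zeta(1)[OF s] this] have "deriv zeta s / zeta s = deriv log_zeta s"
    using s by (simp add: zeta_eq_exp_log_zeta)
  thus ?thesis using d by simp
qed

lemma has_field_derivative_log_deriv:
  assumes k: "k \<ge> 2" and s: "Re s > 1"
  shows "(log_deriv k has_field_derivative log_deriv' k s) (at s)"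
proof -
  have s0: "s \<noteq> 0" using s by auto
  have q: "((\<lambda>s. deriv zeta s / zeta s) has_field_derivative (deriv (deriv zeta) s / zeta s - (deriv zeta s / zeta s)^2)) (at s)"
    using DERIV_divide[OF deriv_zeta(2)[OF s] deriv_zeta(1)[OF s] zeta_nonzero[OF s]] zeta_nonzero[OF s]
    by (simp add: diff_divide_distrib power2_eq_square)
  have i: "((\<lambda>s::complex. 1 / s) has_field_derivative - (1 / s^2)) (at s)"
    using s0 by (auto intro!: derivative_eq_intros simp: power2_eq_square)
  have s34: "Re s > 3/4" using s by simp
  have "((\<lambda>s. of_real (2 / real k) * (deriv zeta s / zeta s) + deriv (log_corr k) s - 1 / s) has_field_derivative
     of_real (2 / real k) * (deriv (deriv zeta) s / zeta s - (deriv zeta s / zeta s)^2) + deriv (deriv (log_corr k)) s - (- (1 / s^2))) (at s)"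
    by (intro DERIV_diff DERIV_add DERIV_cmult q i deriv_log_corr(2)[OF k s34])
  thus ?thesis unfolding log_deriv_def[abs_def] log_deriv'_def by simp
qed

lemma D_transform_derivs:
  assumes k: "k \<ge> 2" and w: "Re w > 0"
  shows "(D_transform k has_field_derivative D_transform k w * log_deriv k (1 + w)) (at w)"
    "((\<lambda>w. D_transform k w * log_deriv k (1 + w)) has_field_derivative D_transform'' k w) (at w)"
proof -
  have sh: "((\<lambda>w. 1 + w) has_field_derivative 1) (at w)" for w :: complex
    by (auto intro!: derivative_eq_intros)
  have 1: "(D_transform k has_field_derivative D_transform k w * log_deriv k (1 + w)) (at w)" if w: "Re w > 0" for w
  proof -
    define s where "s = 1 + w"
    have s: "Re s > 1" "Re s > 3/4" "s \<noteq> 0" using w by (auto simp: s_def complex_eq_iff)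
    let ?e = "\<lambda>s. exp (of_real (2 / real k) * log_zeta s + log_corr k s)"
    have "((\<lambda>s. of_real (2 / real k) * log_zeta s + log_corr k s) has_field_derivative of_real (2 / real k) * (deriv zeta s / zeta s) + deriv (log_corr k) s) (at s)"
      by (intro DERIV_add DERIV_cmult deriv_log_zeta deriv_log_corr(1)[OF k] s)
    from DERIV_chain2[OF DERIV_exp this]
    have "(?e has_field_derivative ?e s * (of_real (2 / real k) * (deriv zeta s / zeta s) + deriv (log_corr k) s)) (at s)" .
    from DERIV_divide[OF this DERIV_ident s(3)]
    have "((\<lambda>s. ?e s / s) has_field_derivative ?e s / s * log_deriv k s) (at s)"
      using s(3) by (simp add: log_deriv_def field_simps)
    hence "((\<lambda>s. D_series k s / s) has_field_derivative ?e s / s * log_deriv k s) (at s)"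
      by (rule has_field_derivative_transform_within_open[OF _ halfplane_open[of 1]]) (use s k in \<open>auto simp: D_series_eq_exp\<close>)
    hence "((\<lambda>s. D_series k s / s) has_field_derivative D_series k s / s * log_deriv k s) (at (1 + w))"
      using s k by (simp add: D_series_eq_exp s_def)
    from DERIV_chain2[OF this sh] show ?thesis by (simp add: D_transform_def[abs_def] s_def)
  qed
  show "(D_transform k has_field_derivative D_transform k w * log_deriv k (1 + w)) (at w)" by (rule 1[OF w])
  have "(log_deriv k has_field_derivative log_deriv' k (1 + w)) (at (1 + w))" by (rule has_field_derivative_log_deriv[OF k]) (use w in simp)
  from DERIV_chain2[OF this sh] have n: "((\<lambda>w. log_deriv k (1 + w)) has_field_derivative log_deriv' k (1 + w)) (at w)" by simp
  from DERIV_mult[OF 1[OF w] n]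
  show "((\<lambda>w. D_transform k w * log_deriv k (1 + w)) has_field_derivative D_transform'' k w) (at w)"
    by (simp add: D_transform''_def power2_eq_square algebra_simps)
qed

text \<open>Passing to moduli turns the complex power of zeta into a real one.\<close>

lemma norm_D_series:
  assumes k: "k \<ge> 2" and s: "Re s > 1"
  shows "norm (D_series k s) = norm (zeta s) powr (2 / real k) * exp (Re (log_corr k s))"
proof -
  have "norm (D_series k s) = exp (2 / real k * Re (log_zeta s)) * exp (Re (log_corr k s))"
    using s k by (simp add: D_series_eq_exp exp_add norm_mult)
  also have "exp (2 / real k * Re (log_zeta s)) = norm (zeta s) powr (2 / real k)"
    using s by (simp add: zeta_eq_exp_log_zeta powr_def)
  finally show ?thesis .
qed

text \<open>Discs of radius 1/4 around points with Re s > 1 stay in Re s > 3/4; 8 and 128 are 2 and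
  8 divided by 1/4 and by its square.\<close>

lemma log_corr_bounds:
  assumes k: "k \<ge> 2"
  obtains G where "G \<ge> 0" "\<And>s. Re s > 1 \<Longrightarrow> norm (log_corr k s) \<le> G"
    "\<And>s. Re s > 1 \<Longrightarrow> norm (deriv (log_corr k) s) \<le> 8 * G"
    "\<And>s. Re s > 1 \<Longrightarrow> norm (deriv (deriv (log_corr k)) s) \<le> 128 * G"
proof -
  obtain G where G: "G \<ge> 0" "\<And>s. Re s > 3/4 \<Longrightarrow> norm (log_corr k s) \<le> G" using log_corr_series[OF k] by metis
  have sub: "Re x > 3/4" if "Re s > 1" "x \<in> ball s (1/4)" for s x
    using that abs_Re_le_cmod[of "s - x"] by (simp add: dist_norm)
  have h: "log_corr k holomorphic_on ball s (1/4)" if "Re s > 1" for s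
    by (rule holomorphic_on_subset[OF log_corr_holomorphic[OF k]]) (use sub[OF that] in auto)
  have c: "norm (deriv (log_corr k) s) \<le> 2 * G / (1/4)" "norm (deriv (deriv (log_corr k)) s) \<le> 8 * G / (1/4)^2" if s: "Re s > 1" for s
    using cauchy_bounds[OF h[OF s], of G] G(2) sub[OF s] by auto
  show ?thesis by (rule that[of G]) (use G c in \<open>auto simp: power2_eq_square\<close>)
qed

text \<open>In powers of T = ht^(1/16): zeta, zeta', zeta'' are O(T) and 1 / zeta is O(T^4), so
  \<open>log_deriv\<close> is O(T^5) and \<open>log_deriv'\<close> is O(T^10). As z <= 1, |zeta|^z
  is O(T), while 1 / s gives T^(-16). The product is O(T^(-5)), hence bounded.\<close>

lemma D_transform_far:
  assumes k: "k \<ge> 2" and r: "0 < r" "r \<le> 1"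
  obtains M where "M \<ge> 0" "\<And>s. s \<in> strip r \<Longrightarrow> norm (D_transform k (s - 1) * (log_deriv k s ^ 2 + log_deriv' k s)) \<le> M"
proof -
  obtain B where B: "B \<ge> 1" "\<And>s. s \<in> strip r \<Longrightarrow> norm (zeta s) \<le> B * ht s powr (1/16)"
    "\<And>s. s \<in> strip r \<Longrightarrow> norm (deriv zeta s) \<le> B * ht s powr (1/16)"
    "\<And>s. s \<in> strip r \<Longrightarrow> norm (deriv (deriv zeta) s) \<le> B * ht s powr (1/16)"
    by (rule zeta_far_upper[OF r]) blast
  obtain c where c: "c > 0" "\<And>s. s \<in> strip r \<Longrightarrow> norm (zeta s) \<ge> c * ht s powr (- 1/4)"
    by (rule zeta_far_lower[OF r]) blast
  obtain G where G: "G \<ge> 0" "\<And>s. Re s > 1 \<Longrightarrow> norm (log_corr k s) \<le> G"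
    "\<And>s. Re s > 1 \<Longrightarrow> norm (deriv (log_corr k) s) \<le> 8 * G"
    "\<And>s. Re s > 1 \<Longrightarrow> norm (deriv (deriv (log_corr k)) s) \<le> 128 * G"
    by (rule log_corr_bounds[OF k]) blast
  define z where "z = 2 / real k"
  have z: "0 < z" "z \<le> 1" using k by (auto simp: z_def)
  define b where "b = B / c"
  have b: "b \<ge> 0" using B c by (simp add: b_def)
  define N where "N = b + 8 * G + 1"
  define N2 where "N2 = b + b^2 + 128 * G + 1"
  have N: "N \<ge> 0" "N2 \<ge> 0" using b G by (auto simp: N_def N2_def)
  define M where "M = 5 * (1 + B) * exp G * (N^2 + N2)"
  have "norm (D_transform k (s - 1) * (log_deriv k s ^ 2 + log_deriv' k s)) \<le> M" if s: "s \<in> strip r" for s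
  proof -
    have Rs: "Re s > 1" using s by (simp add: strip_def)
    define T where "T = ht s powr (1/16)"
    have t4: "ht s \<ge> 4" by (rule ht_ge)
    have T1: "T \<ge> 1" unfolding T_def using t4 by (intro ge_one_powr_ge_zero) auto
    have T16: "T ^ 16 = ht s" using t4 by (simp add: T_def powr_power_real)
    have T4: "ht s powr (- 1/4) = 1 / T ^ 4"
      using t4 by (simp add: T_def powr_power_real powr_minus_divide)
    have Tm: "T ^ i \<le> T ^ j" if "i \<le> j" for i j using that T1 by (rule power_increasing)
    have lo: "c / T ^ 4 \<le> norm (zeta s)" using c(2)[OF s] unfolding T4 by simp
    have z0: "norm (zeta s) > 0" using zeta_nonzero[OF Rs] by simp
    have quot: "norm (x / zeta s) \<le> b * T ^ 5" if "norm x \<le> B * T" for x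
    proof -
      have "norm (x / zeta s) \<le> B * T / (c / T ^ 4)"
        unfolding norm_divide using that lo c B T1 by (intro frac_le) auto
      also have "\<dots> = b * T ^ 5" by (simp add: b_def eval_nat_numeral)
      finally show ?thesis .
    qed
    have q1: "norm (deriv zeta s / zeta s) \<le> b * T ^ 5" by (rule quot) (use B(3)[OF s] in \<open>simp add: T_def\<close>)
    have q2: "norm (deriv (deriv zeta) s / zeta s) \<le> b * T ^ 5" by (rule quot) (use B(4)[OF s] in \<open>simp add: T_def\<close>)
    have ns1: "norm s \<ge> 1" using complex_Re_le_cmod[of s] Rs by linarith
    have nst: "ht s \<le> 5 * norm s" using abs_Im_le_cmod[of s] ns1 by (simp add: ht_def)
    have i1: "norm (1 / s) \<le> 1" "norm (1 / s^2) \<le> 1"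
      using ns1 one_le_power[of "norm s" 2] by (auto simp: norm_divide norm_power divide_le_eq_1)
    have nz: "norm (complex_of_real z) \<le> 1" using z by simp
    have "norm (log_deriv k s) \<le> norm (of_real z * (deriv zeta s / zeta s)) + norm (deriv (log_corr k) s) + norm (1 / s)"
      unfolding log_deriv_def z_def by (intro order_trans[OF norm_triangle_ineq4] add_right_mono norm_triangle_ineq)
    also have "norm (of_real z * (deriv zeta s / zeta s)) \<le> 1 * (b * T ^ 5)"
      unfolding norm_mult[of "of_real z"] using nz q1 by (intro mult_mono) auto
    finally have "norm (log_deriv k s) \<le> b * T ^ 5 + 8 * G + 1" using G(3)[OF Rs] i1 by linarith
    also have "\<dots> \<le> b * T ^ 5 + 8 * G * T ^ 5 + 1 * T ^ 5"
      using G T1 by (intro add_mono mult_left_mono order_refl) (auto simp: mult_le_cancel_left1)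
    finally have n1: "norm (log_deriv k s) \<le> N * T ^ 5" by (simp add: N_def distrib_right)
    have "norm (log_deriv' k s) \<le> norm (of_real z * (deriv (deriv zeta) s / zeta s - (deriv zeta s / zeta s)^2)) + norm (deriv (deriv (log_corr k)) s) + norm (1 / s^2)"
      unfolding log_deriv'_def z_def by (intro order_trans[OF norm_triangle_ineq] add_right_mono norm_triangle_ineq)
    also have "norm (of_real z * (deriv (deriv zeta) s / zeta s - (deriv zeta s / zeta s)^2)) \<le> 1 * (b * T ^ 5 + (b * T ^ 5)^2)"
      unfolding norm_mult[of "of_real z"] using nz q1 q2
      by (intro mult_mono order_trans[OF norm_triangle_ineq4] add_mono) (auto simp: norm_power intro!: power_mono)
    finally have "norm (log_deriv' k s) \<le> b * T ^ 5 + b^2 * T ^ 10 + 128 * G + 1"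
      using G(4)[OF Rs] i1 by (simp add: power_mult_distrib)
    also have "\<dots> \<le> b * T ^ 10 + b^2 * T ^ 10 + 128 * G * T ^ 10 + 1 * T ^ 10"
      using G T1 b Tm[of 5 10] one_le_power[OF T1, of 10]
      by (intro add_mono mult_left_mono order_refl) (auto simp: mult_le_cancel_left1)
    finally have n2: "norm (log_deriv' k s) \<le> N2 * T ^ 10" by (simp add: N2_def distrib_right)
    have "norm (log_deriv k s ^ 2 + log_deriv' k s) \<le> (N * T ^ 5)^2 + N2 * T ^ 10"
      using n1 n2 by (intro order_trans[OF norm_triangle_ineq] add_mono) (auto simp: norm_power intro!: power_mono)
    also have "\<dots> = (N^2 + N2) * T ^ 10" by (simp add: power_mult_distrib distrib_right)
    finally have n: "norm (log_deriv k s ^ 2 + log_deriv' k s) \<le> (N^2 + N2) * T ^ 10" .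
    have "norm (zeta s) powr z \<le> (1 + norm (zeta s)) powr z" using z by (intro powr_mono2) auto
    also have "\<dots> \<le> (1 + norm (zeta s)) powr 1" using z by (intro powr_mono) auto
    also have "\<dots> = 1 + norm (zeta s)" by simp
    also have "\<dots> \<le> 1 * T + B * T" using B(2)[OF s] T1 by (simp add: T_def)
    finally have zz: "norm (zeta s) powr z \<le> (1 + B) * T" by (simp add: distrib_right)
    have "Re (log_corr k s) \<le> G" using complex_Re_le_cmod[of "log_corr k s"] G(2)[OF Rs] by linarith
    hence "norm (D_series k s) \<le> ((1 + B) * T) * exp G"
      unfolding norm_D_series[OF k Rs] z_def[symmetric] using zz B T1 by (intro mult_mono) auto
    hence "norm (D_transform k (s - 1)) \<le> ((1 + B) * T) * exp G / (ht s / 5)"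
      unfolding D_transform_def norm_divide using nst t4 B T1 by (intro frac_le) auto
    hence "norm (D_transform k (s - 1)) \<le> 5 * (1 + B) * exp G * T / T ^ 16" by (simp add: T16 mult_ac)
    hence "norm (D_transform k (s - 1) * (log_deriv k s ^ 2 + log_deriv' k s)) \<le> (5 * (1 + B) * exp G * T / T ^ 16) * ((N^2 + N2) * T ^ 10)"
      unfolding norm_mult using n B T1 by (intro mult_mono) auto
    also have "\<dots> = M * (T ^ 11 / T ^ 16)" by (simp add: M_def eval_nat_numeral)
    also have "\<dots> \<le> M * 1"
      using Tm[of 11 16] T1 B N by (intro mult_left_mono) (auto simp: M_def divide_le_eq_1)
    finally show ?thesis by simp
  qed
  moreover have "M \<ge> 0" using B N by (simp add: M_def)
  ultimately show ?thesis using that by blast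
qed

text \<open>The coefficients are nonnegative; this settles the phase of the limit at s = 1, which
  moduli cannot see.\<close>

lemma D_series_real:
  assumes k: "k \<ge> 1" and x: "x > 1"
  shows "D_series k (of_real x) = of_real (norm (D_series k (of_real x)))"
proof -
  have "D_series k (of_real x) = (\<Sum>n. complex_of_real (D_omega k n * real n powr (- x)))"
    unfolding D_series_def dirichlet_def
  proof (intro suminf_cong)
    fix n show "complex_of_real (D_omega k n) * of_nat n powr (- of_real x) = complex_of_real (D_omega k n * real n powr (- x))"
      using powr_of_real[of "real n" "- x"] by simp
  qed
  also have "\<dots> = of_real (\<Sum>n. D_omega k n * real n powr (- x))"
    by (rule suminf_of_real[symmetric]) (rule summable_D_omega[OF k x])
  finally have e: "D_series k (of_real x) = of_real (\<Sum>n. D_omega k n * real n powr (- x))" .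
  have "(\<Sum>n. D_omega k n * real n powr (- x)) \<ge> 0"
    by (intro suminf_nonneg summable_D_omega k x) (simp add: D_omega_nonneg)
  thus ?thesis unfolding e by simp
qed

text \<open>Write the transform as w^(-z) K(w) and its logarithmic derivative as lam - z / w with
  lam holomorphic at s = 1. In the second derivative, z (z + 1) / w^2 is multiplied by K; replacing
  K by C costs O(|w|) there, and all other terms are O(1 / |w|). The total is O(|w|^(-z-1)), which
  is O(|w|^(-2)) because z <= 1.\<close>

lemma D_transform_near:
  assumes k: "k \<ge> 2"
  obtains r M where "0 < r" "r \<le> 1" "M \<ge> 0" "\<And>w. 0 < Re w \<Longrightarrow> norm w < r \<Longrightarrow>
     norm (D_transform'' k w - polar_part k w) \<le> M * (1 / norm w ^ 2)"
proof -
  define z where "z = 2 / real k"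
  have z: "0 < z" "z \<le> 1" using k by (auto simp: z_def)
  let ?z = "complex_of_real z"
  let ?A = "{s. Re s > 1 - (1/16) / 2}"
  have hZ: "zeta_reg holomorphic_on ?A" by (rule zeta_reg_holomorphic) auto
  obtain d where d: "d > 0" "\<And>s. dist s 1 < d \<Longrightarrow> dist (zeta_reg s) (zeta_reg 1) < 1/2"
  proof -
    have "isCont zeta_reg 1"
      by (rule holomorphic_on_imp_continuous_on[OF hZ, unfolded continuous_on_eq_continuous_at[OF halfplane_open], rule_format]) auto
    thus ?thesis using that unfolding continuous_at_eps_delta by (metis half_gt_zero zero_less_one)
  qed
  \<comment> \<open>The ball of radius 2 r around 1 lies in the half-plane of
    \<open>zeta_reg\<close>, and there \<open>zeta_reg\<close> differs from 1 by less than 1/2,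
    hence has no zero; the closed ball of radius r inside it is used for compactness.\<close>
  define r where "r = min (1/64) (d/2)"
  have r: "0 < r" "r \<le> 1/64" "2 * r \<le> d" using d by (auto simp: r_def)
  have inA: "Re s > 1 - (1/16) / 2" "Re s > 3/4" "s \<noteq> 0" if "s \<in> ball 1 (2*r)" for s
  proof -
    have "\<bar>Re (1 - s)\<bar> < 2 * r" using abs_Re_le_cmod[of "1 - s"] that by (simp add: dist_norm)
    thus "Re s > 1 - (1/16) / 2" "Re s > 3/4" "s \<noteq> 0" using r by auto
  qed
  have Zn: "norm (zeta_reg s - 1) < 1/2" if "s \<in> ball 1 (2*r)" for s
    using d(2)[of s] that r by (simp add: zeta_reg_1 dist_norm norm_minus_commute)
  have Z0: "zeta_reg s \<noteq> 0" if "s \<in> ball 1 (2*r)" for s using Zn[OF that] by auto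
  define lam where "lam = (\<lambda>s. ?z * (deriv zeta_reg s / zeta_reg s) + deriv (log_corr k) s - 1 / s)"
  have hlam: "lam holomorphic_on ball 1 (2*r)"
    unfolding lam_def
  proof (intro holomorphic_on_diff holomorphic_on_add holomorphic_on_mult holomorphic_on_divide holomorphic_on_const holomorphic_on_ident)
    show "deriv zeta_reg holomorphic_on ball 1 (2*r)"
      by (rule holomorphic_on_subset[OF holomorphic_deriv[OF hZ halfplane_open]]) (use inA in auto)
    show "zeta_reg holomorphic_on ball 1 (2*r)" by (rule holomorphic_on_subset[OF hZ]) (use inA in auto)
    show "deriv (log_corr k) holomorphic_on ball 1 (2*r)"
      by (rule holomorphic_on_subset[OF holomorphic_deriv[OF log_corr_holomorphic[OF k] halfplane_open]]) (use inA in auto)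
  qed (use Z0 inA in auto)
  have bounded: "\<exists>L\<ge>0. \<forall>s\<in>cball 1 r. norm (h s) \<le> L" if "h holomorphic_on ball 1 (2*r)" for h :: "complex \<Rightarrow> complex"
  proof -
    have "continuous_on (cball 1 r) h"
      by (rule continuous_on_subset[OF holomorphic_on_imp_continuous_on[OF that]]) (use r in auto)
    hence "bounded (h ` cball 1 r)" by (intro compact_imp_bounded compact_continuous_image) auto
    thus ?thesis unfolding bounded_pos by (auto intro: less_imp_le)
  qed
  obtain L1 where L1: "L1 \<ge> 0" "\<And>s. s \<in> cball 1 r \<Longrightarrow> norm (lam s) \<le> L1" using bounded[OF hlam] by blast
  obtain L2 where L2: "L2 \<ge> 0" "\<And>s. s \<in> cball 1 r \<Longrightarrow> norm (deriv lam s) \<le> L2"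
    using bounded[OF holomorphic_deriv[OF hlam open_ball]] by blast
  obtain G where G: "G \<ge> 0" "\<And>s. Re s > 1 \<Longrightarrow> norm (log_corr k s) \<le> G" using log_corr_bounds[OF k] by metis
  let ?U = "{w. Re w > 0} \<inter> ball 0 (2*r)"
  have U: "1 + w \<in> ball 1 (2*r)" "Re (1 + w) > 1" "w \<noteq> 0" if "w \<in> ?U" for w
    using that by (auto simp: dist_norm)
  have opU: "open ?U" by (intro open_Int halfplane_open open_ball)
  \<comment> \<open>Logarithmic differentiation of \<open>zeta_reg\<close> = (s - 1) zeta isolates
    the pole.\<close>
  have nu_eq: "log_deriv k (1 + w) = lam (1 + w) - ?z / w" if w: "w \<in> ?U" for w
  proof -
    define s where "s = 1 + w"
    have s: "s \<in> ball 1 (2*r)" "Re s > 1" "s - 1 = w" "w \<noteq> 0" using U[OF w] by (auto simp: s_def)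
    have dZ: "(zeta_reg has_field_derivative deriv zeta_reg s) (at s)"
      by (rule holomorphic_derivI[OF hZ halfplane_open]) (use inA[OF s(1)] in auto)
    have "((\<lambda>s. (s - 1) * zeta s) has_field_derivative 1 * zeta s + deriv zeta s * (s - 1)) (at s)"
      by (rule DERIV_mult[OF _ deriv_zeta(1)[OF s(2)]]) (auto intro!: derivative_eq_intros)
    hence "(zeta_reg has_field_derivative 1 * zeta s + deriv zeta s * (s - 1)) (at s)"
      by (rule has_field_derivative_transform_within_open[OF _ halfplane_open[of 1]]) (use s in \<open>auto simp: zeta_reg_zeta\<close>)
    from DERIV_unique[OF dZ this] have "deriv zeta_reg s = zeta s + deriv zeta s * w" by (simp add: s)
    hence "deriv zeta_reg s / zeta_reg s = 1 / w + deriv zeta s / zeta s"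
      using zeta_nonzero[OF s(2)] s(4) by (simp add: zeta_reg_zeta[OF s(2)] s(3) field_simps)
    thus ?thesis unfolding log_deriv_def lam_def s_def[symmetric] z_def[symmetric] by (simp add: algebra_simps)
  qed
  have lam_d: "(lam has_field_derivative deriv lam (1 + w)) (at (1 + w))" if w: "w \<in> ?U" for w
    by (rule holomorphic_derivI[OF hlam open_ball U(1)[OF w]])
  have sh: "((\<lambda>w. 1 + w) has_field_derivative 1) (at w)" for w :: complex
    by (auto intro!: derivative_eq_intros)
  have nu'_eq: "log_deriv' k (1 + w) = deriv lam (1 + w) + ?z / w^2" if w: "w \<in> ?U" for w
  proof -
    have n: "((\<lambda>w. log_deriv k (1 + w)) has_field_derivative log_deriv' k (1 + w)) (at w)"
      using DERIV_chain2[OF has_field_derivative_log_deriv[OF k U(2)[OF w]] sh] by simp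
    have l: "((\<lambda>w. lam (1 + w)) has_field_derivative deriv lam (1 + w)) (at w)"
      using DERIV_chain2[OF lam_d[OF w] sh] by simp
    have i: "((\<lambda>w. ?z / w) has_field_derivative - (?z / w^2)) (at w)"
      using U(3)[OF w] by (auto intro!: derivative_eq_intros simp: power2_eq_square)
    have "((\<lambda>w. lam (1 + w) - ?z / w) has_field_derivative deriv lam (1 + w) - (- (?z / w^2))) (at w)"
      by (rule DERIV_diff[OF l i])
    hence "((\<lambda>w. log_deriv k (1 + w)) has_field_derivative deriv lam (1 + w) - (- (?z / w^2))) (at w)"
      by (rule has_field_derivative_transform_within_open[OF _ opU w]) (simp add: nu_eq)
    from DERIV_unique[OF n this] show ?thesis by simp
  qed
  \<comment> \<open>\<open>K\<close> has the logarithmic derivative \<open>lam (1 + w)\<close>, which is bounded near \<open>0\<close>,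
    so it is Lipschitz there and has a limit at \<open>0\<close>, which is computed along the real axis.\<close>
  define K where "K = (\<lambda>w. w powr ?z * D_transform k w)"
  have Kd: "(K has_field_derivative K w * lam (1 + w)) (at w)" if w: "w \<in> ?U" for w
  proof -
    have wn: "w \<notin> \<real>\<^sub>\<le>\<^sub>0" using w by (auto simp: complex_nonpos_Reals_iff)
    have Rw: "Re w > 0" using w by simp
    have "(K has_field_derivative ?z * w powr (?z - 1) * D_transform k w + (D_transform k w * log_deriv k (1 + w)) * w powr ?z) (at w)"
      unfolding K_def by (rule DERIV_mult[OF has_field_derivative_powr[OF wn] D_transform_derivs(1)[OF k Rw]])
    also have "?z * w powr (?z - 1) * D_transform k w + (D_transform k w * log_deriv k (1 + w)) * w powr ?z = K w * lam (1 + w)"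
      using U(3)[OF w] by (simp add: K_def nu_eq[OF w] powr_diff powr_to_1 algebra_simps)
    finally show ?thesis .
  qed
  \<comment> \<open>In the modulus, |w|^z and |zeta|^z combine to |zeta_reg|^z, which is continuous
    at w = 0.\<close>
  have Kn: "norm (K w) = norm (zeta_reg (1 + w)) powr z * exp (Re (log_corr k (1 + w))) / norm (1 + w)" if w: "w \<in> ?U" for w
  proof -
    have "norm (K w) = norm w powr z * (norm (zeta (1 + w)) powr z * exp (Re (log_corr k (1 + w))) / norm (1 + w))"
      unfolding K_def D_transform_def norm_mult norm_divide norm_D_series[OF k U(2)[OF w]] z_def[symmetric]
      by (subst norm_powr_real_powr') auto
    also have "\<dots> = norm (zeta_reg (1 + w)) powr z * exp (Re (log_corr k (1 + w))) / norm (1 + w)"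
      by (simp add: zeta_reg_zeta[OF U(2)[OF w]] norm_mult powr_mult)
    finally show ?thesis .
  qed
  define E where "E = 2 * exp G"
  have E: "E \<ge> 0" by (simp add: E_def)
  have KE: "norm (K w) \<le> E" if w: "w \<in> ?U" for w
  proof -
    have "norm (zeta_reg (1 + w)) \<le> 2" using Zn[OF U(1)[OF w]] norm_triangle_ineq[of 1 "zeta_reg (1 + w) - 1"] by simp
    hence "norm (zeta_reg (1 + w)) powr z \<le> 2 powr z" using z by (intro powr_mono2) auto
    also have "\<dots> \<le> 2 powr 1" using z by (intro powr_mono) auto
    finally have a: "norm (zeta_reg (1 + w)) powr z \<le> 2" by simp
    have b: "exp (Re (log_corr k (1 + w))) \<le> exp G"
      using complex_Re_le_cmod[of "log_corr k (1 + w)"] G(2)[OF U(2)[OF w]] by simp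
    have c: "1 \<le> norm (1 + w)" using complex_Re_le_cmod[of "1 + w"] w by simp
    have "norm (K w) \<le> 2 * exp G / 1" unfolding Kn[OF w] using a b c by (intro frac_le mult_mono) auto
    thus ?thesis by (simp add: E_def)
  qed
  define C where "C = exp (Re (log_corr k 1))"
  have KC: "norm (K w - of_real C) \<le> E * L1 * norm w" if w: "Re w > 0" "norm w < r" for w
  proof -
    let ?V = "{w. Re w > 0} \<inter> ball 0 r"
    have conv: "convex ?V" by (intro convex_Int convex_halfspace_Re_gt convex_ball)
    have VU: "v \<in> ?U" if "v \<in> ?V" for v using that r by auto
    have d: "norm (K w - K v) \<le> (E * L1) * norm (w - v)" if v: "v \<in> ?V" for v
    proof (rule field_differentiable_bound[OF conv])
      fix x assume x: "x \<in> ?V"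
      show "(K has_field_derivative K x * lam (1 + x)) (at x within ?V)"
        by (rule has_field_derivative_at_within[OF Kd[OF VU[OF x]]])
      have "norm (lam (1 + x)) \<le> L1" by (rule L1(2)) (use x in \<open>auto simp: dist_norm\<close>)
      thus "norm (K x * lam (1 + x)) \<le> E * L1" unfolding norm_mult using KE[OF VU[OF x]] E by (intro mult_mono) auto
    qed (use w v in \<open>auto simp: dist_norm\<close>)
    \<comment> \<open>For positive real arguments K equals its modulus, so the formula for the
      modulus gives the limit itself.\<close>
    have lim: "((\<lambda>x. K (of_real x)) \<longlongrightarrow> of_real C) (at_right 0)"
    proof -
      let ?h = "\<lambda>x::real. norm (zeta_reg (1 + of_real x)) powr z * exp (Re (log_corr k (1 + of_real x))) / norm (1 + complex_of_real x)"
      have cZ: "isCont zeta_reg 1"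
        by (rule holomorphic_on_imp_continuous_on[OF hZ, unfolded continuous_on_eq_continuous_at[OF halfplane_open], rule_format]) auto
      have cg: "isCont (log_corr k) 1"
        by (rule holomorphic_on_imp_continuous_on[OF log_corr_holomorphic[OF k], unfolded continuous_on_eq_continuous_at[OF halfplane_open], rule_format]) auto
      have t: "((\<lambda>x. 1 + complex_of_real x) \<longlongrightarrow> 1) (at_right 0)"
        by (auto intro!: tendsto_eq_intros)
      have "(?h \<longlongrightarrow> norm (zeta_reg 1) powr z * exp (Re (log_corr k 1)) / norm (1::complex)) (at_right 0)"
        by (intro tendsto_intros isCont_tendsto_compose[OF cZ t] isCont_tendsto_compose[OF cg t] t) (auto simp: zeta_reg_1)
      hence "(?h \<longlongrightarrow> C) (at_right 0)" by (simp add: C_def zeta_reg_1)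
      hence l: "((\<lambda>x. complex_of_real (?h x)) \<longlongrightarrow> of_real C) (at_right 0)" by (rule tendsto_of_real)
      have "\<forall>\<^sub>F x in at_right 0. complex_of_real (?h x) = K (of_real x)"
        using eventually_at_right_less[of "0::real"] eventually_at_right_real[OF r(1)]
      proof eventually_elim
        case (elim x)
        hence x: "0 < x" "x < r" by auto
        have xU: "complex_of_real x \<in> ?U" using x r by (auto simp: dist_norm)
        have "K (of_real x) = of_real (x powr z) * (of_real (norm (D_series k (of_real (1 + x)))) / of_real (1 + x))"
          unfolding K_def D_transform_def using x k powr_of_real[of x z] D_series_real[of k "1 + x"] by simp
        also have "\<dots> = complex_of_real (x powr z * (norm (D_series k (of_real (1 + x))) / (1 + x)))" by simp
        finally have e: "K (of_real x) = complex_of_real (x powr z * (norm (D_series k (of_real (1 + x))) / (1 + x)))" .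
        have "norm (K (of_real x)) = x powr z * (norm (D_series k (of_real (1 + x))) / (1 + x))"
          unfolding e norm_of_real using x by (intro abs_of_nonneg) auto
        hence "K (of_real x) = complex_of_real (norm (K (of_real x)))" using e by simp
        thus ?case using Kn[OF xU] by simp
      qed
      from Lim_transform_eventually[OF l this] show ?thesis .
    qed
    have l1: "((\<lambda>x. norm (K w - K (of_real x))) \<longlongrightarrow> norm (K w - of_real C)) (at_right 0)"
      by (intro tendsto_intros lim)
    have l2: "((\<lambda>x::real. (E * L1) * norm (w - of_real x)) \<longlongrightarrow> (E * L1) * norm (w - of_real 0)) (at_right 0)"
      by (intro tendsto_intros)
    have "\<forall>\<^sub>F x in at_right 0. norm (K w - K (of_real x)) \<le> (E * L1) * norm (w - of_real x)"
      using eventually_at_right_less[of "0::real"] eventually_at_right_real[OF r(1)]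
      by eventually_elim (rule d, auto simp: dist_norm)
    from tendsto_le[OF _ l2 l1 this] show ?thesis by simp
  qed
  define M where "M = 2 * E * L1 + E * (L1^2 + 2 * L1 + L2)"
  have M: "M \<ge> 0" using E L1 L2 by (simp add: M_def)
  have "norm (D_transform'' k w - of_real (C * z * (z + 1)) * w powr of_real (- z - 2)) \<le> M * (1 / norm w ^ 2)"
    if w: "0 < Re w" "norm w < r" for w
  proof -
    have wU: "w \<in> ?U" using w r by auto
    have w0: "w \<noteq> 0" "norm w > 0" using w by auto
    have w1: "norm w \<le> 1" using w r by auto
    have cb: "1 + w \<in> cball 1 r" using w by (auto simp: dist_norm)
    define l l' where "l = lam (1 + w)" and "l' = deriv lam (1 + w)"
    have l: "norm l \<le> L1" "norm l' \<le> L2" using L1(2)[OF cb] L2(2)[OF cb] by (auto simp: l_def l'_def)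
    have ffK: "D_transform k w = w powr (- ?z) * K w" using w0 by (simp add: K_def powr_minus)
    have pw: "w powr of_real (- z - 2) = w powr (- ?z) / w^2"
    proof -
      have "w powr of_real (- z - 2) = w powr (- ?z - of_nat 2)" by simp
      also have "\<dots> = w powr (- ?z) / w powr (of_nat 2)" by (rule powr_diff)
      also have "w powr (of_nat 2) = w ^ 2" using w0 by (simp only: powr_nat if_False)
      finally show ?thesis .
    qed
    have "D_transform'' k w - of_real (C * z * (z + 1)) * w powr of_real (- z - 2)
      = w powr (- ?z) * ((K w - of_real C) * (?z * (?z + 1) / w^2) + K w * (l^2 - 2 * ?z * l / w + l'))"
    proof -
      have e: "W * K' * ((l - Z / w)^2 + (l' + Z / w^2)) - c * Z * (Z + 1) * (W / w^2)
         = W * ((K' - c) * (Z * (Z + 1) / w^2) + K' * (l^2 - 2 * Z * l / w + l'))" for W K' c Z :: complex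
        by (simp add: algebra_simps power2_eq_square add_divide_distrib diff_divide_distrib)
      have c: "complex_of_real (C * z * (z + 1)) = of_real C * ?z * (?z + 1)" by simp
      show ?thesis
        unfolding pw D_transform''_def ffK nu_eq[OF wU] nu'_eq[OF wU] l_def[symmetric] l'_def[symmetric] c by (rule e)
    qed
    also have "norm \<dots> \<le> norm w powr (- z) * (2 * E * L1 / norm w + E * ((L1^2 + 2 * L1 + L2) / norm w))"
      unfolding norm_mult[of "w powr (- ?z)"]
    proof (intro mult_mono order_trans[OF norm_triangle_ineq] add_mono)
      show "norm (w powr (- ?z)) \<le> norm w powr (- z)" by (subst norm_powr_real_powr') auto
      have "norm ((K w - of_real C) * (?z * (?z + 1) / w^2)) = norm (K w - of_real C) * (z * (z + 1) / norm w ^ 2)"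
      proof -
        have "?z * (?z + 1) = of_real (z * (z + 1))" by simp
        hence "norm (?z * (?z + 1)) = z * (z + 1)" using z by (simp only: norm_of_real) simp
        thus ?thesis by (simp only: norm_mult[of "K w - of_real C"] norm_divide norm_power)
      qed
      also have "\<dots> \<le> (E * L1 * norm w) * (2 / norm w ^ 2)"
      proof (intro mult_mono divide_right_mono KC w)
        have "z * (z + 1) \<le> 1 * 2" using z by (intro mult_mono) auto
        thus "z * (z + 1) \<le> 2" by simp
      qed (use E L1 z in auto)
      also have "\<dots> = 2 * E * L1 / norm w" using w0 by (simp add: power2_eq_square)
      finally show "norm ((K w - of_real C) * (?z * (?z + 1) / w^2)) \<le> 2 * E * L1 / norm w" .
      have "norm (l^2 - 2 * ?z * l / w + l') \<le> norm (l^2) + norm (2 * ?z * l / w) + norm l'"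
        by (intro order_trans[OF norm_triangle_ineq] add_right_mono norm_triangle_ineq4)
      also have "norm (l^2) \<le> L1^2 / norm w"
      proof -
        have "norm (l^2) \<le> L1^2" unfolding norm_power using l by (intro power_mono) auto
        also have "L1^2 \<le> L1^2 / norm w" using w0 w1 by (simp add: pos_le_divide_eq mult_left_le)
        finally show ?thesis .
      qed
      also have "norm (2 * ?z * l / w) \<le> 2 * L1 / norm w"
      proof -
        have "norm (2 * ?z * l / w) = 2 * z * norm l / norm w" using z by (simp add: norm_mult norm_divide)
        also have "\<dots> \<le> 2 * 1 * L1 / norm w" using z l by (intro divide_right_mono mult_mono) auto
        finally show ?thesis by simp
      qed
      also have "norm l' \<le> L2 / norm w"
      proof -
        have "L2 \<le> L2 / norm w" using w0 w1 L2 by (simp add: pos_le_divide_eq mult_left_le)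
        thus ?thesis using l by linarith
      qed
      finally have "norm (l^2 - 2 * ?z * l / w + l') \<le> (L1^2 + 2 * L1 + L2) / norm w"
        by (simp add: add_divide_distrib)
      thus "norm (K w * (l^2 - 2 * ?z * l / w + l')) \<le> E * ((L1^2 + 2 * L1 + L2) / norm w)"
        unfolding norm_mult[of "K w"] using KE[OF wU] E by (intro mult_mono) auto
    qed (use E L1 L2 in auto)
    also have "\<dots> = M * (norm w powr (- z) / norm w)"
    proof -
      have "p * (a / n + E * (b / n)) = (a + E * b) * (p / n)" for p a b n :: real
        by (simp add: algebra_simps add_divide_distrib)
      thus ?thesis unfolding M_def .
    qed
    also have "\<dots> \<le> M * (1 / norm w ^ 2)"
    proof (intro mult_left_mono M)
      have "norm w powr (- z) \<le> norm w powr (- 1)" using w0 w1 z by (intro powr_mono') auto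
      hence "norm w powr (- z) / norm w \<le> norm w powr (- 1) / norm w" by (intro divide_right_mono) auto
      also have "\<dots> = 1 / norm w ^ 2" using w0 by (simp add: powr_minus_divide power2_eq_square)
      finally show "norm w powr (- z) / norm w \<le> 1 / norm w ^ 2" .
    qed
    finally show ?thesis .
  qed
  thus ?thesis using that[of r M] r M unfolding polar_part_def z_def C_def by auto
qed

text \<open>For |w| >= r the two terms are bounded separately, the polar part by its value at |w| =
  r.\<close>

lemma D_transform_bound:
  assumes k: "k \<ge> 2"
  obtains M where "M \<ge> 0" "\<And>w. 0 < Re w \<Longrightarrow> Re w \<le> 1 \<Longrightarrow>
     norm (D_transform'' k w - polar_part k w) \<le> M * (1 + 1 / norm w ^ 2)"
proof -
  obtain r M1 where r: "0 < r" "r \<le> 1" and M1: "M1 \<ge> 0" "\<And>w. 0 < Re w \<Longrightarrow> norm w < r \<Longrightarrow>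
     norm (D_transform'' k w - polar_part k w) \<le> M1 * (1 / norm w ^ 2)"
    by (rule D_transform_near[OF k]) blast
  obtain M2 where M2: "M2 \<ge> 0" "\<And>s. s \<in> strip r \<Longrightarrow> norm (D_transform k (s - 1) * (log_deriv k s ^ 2 + log_deriv' k s)) \<le> M2"
    by (rule D_transform_far[OF k r]) blast
  define z where "z = 2 / real k"
  have z: "0 < z" using k by (simp add: z_def)
  define c where "c = exp (Re (log_corr k 1)) * z * (z + 1)"
  have c: "c \<ge> 0" using z by (simp add: c_def)
  define M where "M = M1 + M2 + c * r powr (- z - 2)"
  have M: "M \<ge> 0" "M1 \<le> M" "M2 + c * r powr (- z - 2) \<le> M" using M1 M2 c by (auto simp: M_def)
  have "norm (D_transform'' k w - of_real c * w powr of_real (- z - 2)) \<le> M * (1 + 1 / norm w ^ 2)"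
    if w: "0 < Re w" "Re w \<le> 1" for w
  proof (cases "norm w < r")
    case True
    have "norm (D_transform'' k w - of_real c * w powr of_real (- z - 2)) \<le> M1 * (1 / norm w ^ 2)"
      using M1(2)[OF w(1) True] unfolding polar_part_def c_def z_def .
    also have "\<dots> \<le> M * (1 + 1 / norm w ^ 2)" using M M1 by (intro mult_mono) auto
    finally show ?thesis .
  next
    case False
    have strip: "1 + w \<in> strip r" using w False by (simp add: strip_def)
    have "norm (w powr of_real (- z - 2)) = norm w powr (- z - 2)" by (subst norm_powr_real_powr') auto
    also have "\<dots> \<le> r powr (- z - 2)" using False r z by (intro powr_mono2') auto
    finally have "norm (of_real c * w powr of_real (- z - 2)) \<le> c * r powr (- z - 2)"
      unfolding norm_mult norm_of_real using c by (simp add: mult_left_mono)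
    hence "norm (D_transform'' k w - of_real c * w powr of_real (- z - 2)) \<le> M2 + c * r powr (- z - 2)"
      using M2(2)[OF strip] unfolding D_transform''_def add_diff_cancel_left' by (intro order_trans[OF norm_triangle_ineq4] add_mono) auto
    also have "\<dots> \<le> M * 1" using M by simp
    also have "\<dots> \<le> M * (1 + 1 / norm w ^ 2)" using M by (intro mult_left_mono) auto
    finally show ?thesis .
  qed
  thus ?thesis using that[of M] M unfolding polar_part_def c_def z_def by blast
qed

section \<open>The summatory function\<close>

definition D_sum :: "nat \<Rightarrow> real \<Rightarrow> real" where
  "D_sum k x = (\<Sum>n | 1 \<le> n \<and> real n \<le> x. D_omega k n)"

lemma finite_nat_le_real: "finite {n. 1 \<le> n \<and> real n \<le> x}"
proof (rule finite_subset)
  show "{n. 1 \<le> n \<and> real n \<le> x} \<subseteq> {..nat \<lfloor>x\<rfloor>}" by (auto simp: le_nat_floor)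
qed auto

lemma mono_D_sum: "mono (\<lambda>v. D_sum k (exp v))"
proof (rule monoI)
  fix u v :: real assume "u \<le> v"
  hence "{n. 1 \<le> n \<and> real n \<le> exp u} \<subseteq> {n. 1 \<le> n \<and> real n \<le> exp v}"
    using exp_le_cancel_iff[of u v] by (auto intro: order_trans)
  thus "D_sum k (exp u) \<le> D_sum k (exp v)" unfolding D_sum_def
    by (intro sum_mono2 finite_nat_le_real) (auto simp: D_omega_nonneg)
qed

text \<open>The transform of the constant 1, translated by a. In the application a = ln n is the
  point where the n-th coefficient enters S(e^v).\<close>

lemma has_bochner_integral_exp_tail:
  assumes w: "Re s > 0" and a: "a \<ge> 0"
  shows "has_bochner_integral lborel (\<lambda>v. if v > 0 \<and> a \<le> v then exp (- s * of_real v) else 0) (exp (- s * of_real a) / s)"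
proof -
  have l: "laplaceable (pow_fun 0)" by (rule laplaceable_pow_fun) auto
  have "laplace (pow_fun 0) s = of_real (Gamma (0 + 1)) * s powr of_real (- 0 - 1)"
    by (rule laplace_pow_fun[OF _ w]) auto
  also have "\<dots> = 1 / s" using w by (auto simp: powr_minus powr_to_1 inverse_eq_divide)
  finally have 1: "has_bochner_integral lborel (\<lambda>v. exp (- s * of_real v) * pow_fun 0 v) (1 / s)"
    using laplaceable_integrable[OF l w] by (simp add: has_bochner_integral_iff laplace_def)
  let ?g = "\<lambda>v. exp (- s * of_real v) * pow_fun 0 v"
  have "integrable lborel (\<lambda>v. ?g (- a + 1 * v))"
    by (rule lborel_integrable_real_affine[OF integrable.intros[OF 1]]) simp
  moreover have "(LBINT v. ?g v) = \<bar>1\<bar> *\<^sub>R (LBINT v. ?g (- a + 1 * v))"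
    by (rule lborel_integral_real_affine) simp
  ultimately have "integrable lborel (\<lambda>v. ?g (- a + 1 * v)) \<and> (LBINT v. ?g v) = \<bar>1\<bar> *\<^sub>R (LBINT v. ?g (- a + 1 * v))"
    by blast
  hence 2: "has_bochner_integral lborel (\<lambda>v. ?g (- a + 1 * v)) (1 / s)"
    using 1 unfolding has_bochner_integral_iff by simp
  have 3: "has_bochner_integral lborel (\<lambda>v. exp (- s * of_real a) * ?g (- a + 1 * v)) (exp (- s * of_real a) * (1 / s))"
    by (rule has_bochner_integral_mult_right) (use 2 in auto)
  \<comment> \<open>At v = a the closed condition and the open support of \<open>pow_fun\<close> may
    disagree; this is a null set.\<close>
  have AE: "AE v in lborel. (if v > 0 \<and> a \<le> v then exp (- s * of_real v) else 0) = exp (- s * of_real a) * ?g (- a + 1 * v)"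
    using AE_lborel_singleton[of a]
  proof eventually_elim
    case (elim v)
    thus ?case using a by (auto simp: pow_fun_def mult_exp_exp algebra_simps)
  qed
  have m: "(\<lambda>v. if v > 0 \<and> a \<le> v then exp (- s * of_real v) else 0) \<in> borel_measurable lborel" by measurable
  have "has_bochner_integral lborel (\<lambda>v. if v > 0 \<and> a \<le> v then exp (- s * of_real v) else 0) (exp (- s * of_real a) * (1 / s))"
    using has_bochner_integral_cong_AE[OF m borel_measurable_has_bochner_integral[OF 3] AE] 3 by blast
  thus ?thesis by simp
qed

text \<open>S(e^v) is the sum of the coefficients with ln n <= v, so each n contributes n^(-s) / s
  with s = 1 + w. Sum and integral may be exchanged because the L1 norms form the Dirichlet series
  at Re s, divided by Re s.\<close>

lemma laplace_D_sum:
  assumes k: "k \<ge> 1" and w: "Re w > 0"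
  defines "q \<equiv> \<lambda>v. if v > 0 then complex_of_real (D_sum k (exp v) * exp (- v)) else 0"
  shows "integrable lborel (\<lambda>v. exp (- w * of_real v) * q v)"
    "(LBINT v. exp (- w * of_real v) * q v) = D_transform k w"
proof -
  define s where "s = 1 + w"
  have s: "Re s > 1" using w by (simp add: s_def)
  let ?e = "\<lambda>n v. if v > 0 \<and> ln (real n) \<le> v then exp (- s * of_real v) else 0"
  let ?f = "\<lambda>n v. if n = 0 then 0 else of_real (D_omega k n) * ?e n v"
  have ns: "exp (- s * of_real (ln (real n))) = (of_nat n powr (- s) :: complex)" if "n > 0" for n
    using that Ln_of_nat[of n] by (simp add: powr_def)
  have below: "n = 0 \<or> v < ln (real n)" if "n \<notin> {n. 1 \<le> n \<and> real n \<le> exp v}" for n v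
  proof (cases "n = 0")
    case False
    hence "exp v < real n" using that by auto
    hence "exp v < exp (ln (real n))" using False by simp
    thus ?thesis by (simp only: exp_less_cancel_iff simp_thms)
  qed simp
  have hb: "has_bochner_integral lborel (?e n) (of_nat n powr (- s) / s)" if "n > 0" for n
    using has_bochner_integral_exp_tail[of s "ln (real n)"] s that ns[OF that] by simp
  have hf: "has_bochner_integral lborel (?f n) (of_real (D_omega k n) * of_nat n powr (- s) / s)" for n
  proof (cases "n = 0")
    case False
    hence "n > 0" by simp
    from has_bochner_integral_mult_right[OF hb[OF this], of "complex_of_real (D_omega k n)"] False
    show ?thesis by (simp only: if_False times_divide_eq_right)
  qed (simp add: has_bochner_integral_iff)
  \<comment> \<open>The modulus of the n-th term is the same term at the real point Re s, so the
    tail formula also evaluates its L1 norm.\<close>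
  have hn: "(LBINT v. norm (?f n v)) = D_omega k n * real n powr (- Re s) / Re s" for n
  proof (cases "n = 0")
    case False
    hence n: "n > 0" by simp
    have "norm (?f n v) = D_omega k n * norm (?e n v)" for v using False D_omega_nonneg by (simp add: norm_mult)
    hence "(LBINT v. norm (?f n v)) = D_omega k n * (LBINT v. norm (?e n v))" by simp
    also have "(LBINT v. norm (?e n v)) = real n powr (- Re s) / Re s"
    proof -
      have h: "has_bochner_integral lborel (\<lambda>v. if v > 0 \<and> ln (real n) \<le> v then exp (- of_real (Re s) * of_real v) else 0) (exp (- of_real (Re s) * of_real (ln (real n))) / of_real (Re s) :: complex)"
        by (rule has_bochner_integral_exp_tail) (use s n in auto)
      have e: "(if v > 0 \<and> ln (real n) \<le> v then exp (- of_real (Re s) * of_real v) else 0) = complex_of_real (norm (?e n v))" for v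
        by (auto simp: exp_of_real[symmetric])
      have "complex_of_real (LBINT v. norm (?e n v)) = exp (- of_real (Re s) * of_real (ln (real n))) / of_real (Re s)"
        using h unfolding e has_bochner_integral_iff by (simp only: integral_complex_of_real)
      also have "\<dots> = complex_of_real (real n powr (- Re s) / Re s)"
        using n by (simp add: powr_def exp_of_real[symmetric])
      finally show ?thesis by (simp only: of_real_eq_iff)
    qed
    finally show ?thesis by simp
  qed (simp add: D_omega_0)
  have qs: "(\<lambda>n. ?f n v) sums (exp (- w * of_real v) * q v)" for v
  proof (cases "v > 0")
    case True
    let ?N = "{n. 1 \<le> n \<and> real n \<le> exp v}"
    have "(\<lambda>n. ?f n v) sums (\<Sum>n\<in>?N. ?f n v)"
    proof (rule sums_finite[OF finite_nat_le_real])
      fix n assume "n \<notin> ?N"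
      thus "?f n v = 0" using below[of n v] by auto
    qed
    also have "(\<Sum>n\<in>?N. ?f n v) = (\<Sum>n\<in>?N. of_real (D_omega k n) * exp (- s * of_real v))"
    proof (rule sum.cong[OF refl])
      fix n assume n: "n \<in> ?N"
      hence "ln (real n) \<le> v" using ln_le_cancel_iff[of "real n" "exp v"] by simp
      thus "?f n v = of_real (D_omega k n) * exp (- s * of_real v)" using n True by simp
    qed
    also have "\<dots> = exp (- w * of_real v) * q v"
      using True by (simp add: q_def D_sum_def sum_distrib_right[symmetric] s_def mult_exp_exp exp_of_real[symmetric] algebra_simps)
    finally show ?thesis .
  next
    case False
    hence "?f n v = 0" for n by simp
    thus ?thesis using False by (simp add: q_def)
  qed
  have sm: "summable (\<lambda>n. (LBINT v. norm (?f n v)))"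
    unfolding hn by (intro summable_divide summable_D_omega k s)
  have AEs: "AE v in lborel. summable (\<lambda>n. norm (?f n v))"
  proof (rule AE_I2)
    fix v :: real
    show "summable (\<lambda>n. norm (?f n v))"
    proof (rule summable_finite[OF finite_nat_le_real[of "exp v"]])
      fix n assume "n \<notin> {n. 1 \<le> n \<and> real n \<le> exp v}"
      thus "norm (?f n v) = 0" using below[of n v] by auto
    qed
  qed
  have int: "integrable lborel (?f n)" for n using hf by (simp add: has_bochner_integral_iff)
  have eq: "(\<lambda>v. \<Sum>n. ?f n v) = (\<lambda>v. exp (- w * of_real v) * q v)"
    using qs by (simp add: sums_iff)
  show "integrable lborel (\<lambda>v. exp (- w * of_real v) * q v)"
    using integrable_suminf[OF int AEs sm] unfolding eq .
  have "(LBINT v. exp (- w * of_real v) * q v) = (\<Sum>n. LBINT v. ?f n v)"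
    using integral_suminf[OF int AEs sm] unfolding eq .
  also have "\<dots> = (\<Sum>n. of_real (D_omega k n) * of_nat n powr (- s) / s)"
    using hf by (simp only: has_bochner_integral_iff)
  also have "\<dots> = D_transform k w"
    unfolding D_transform_def D_series_def dirichlet_def s_def[symmetric]
    by (rule suminf_divide[OF summable_norm_cancel[OF D_series_summable[OF k s]]])
  finally show "(LBINT v. exp (- w * of_real v) * q v) = D_transform k w" .
qed

text \<open>For z >= 1/2 the factor (ln u)^(2 z) already dominates ln u; for smaller z the factor
  u^(z-1) saves a power of u that absorbs the logarithm.\<close>

lemma error_term_bigo:
  assumes z: "0 < z" "z \<le> 1"
  shows "(\<lambda>u::real. 1 / u + u powr (z - 2) * ln u) \<in> O(\<lambda>u. 1 / u * ln u powr (2 * z))"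
proof (rule bigoI[of _ 2])
  have "\<forall>\<^sub>F u::real in at_top. ln u \<le> u powr (1/2)" by real_asymp
  with eventually_ge_at_top[of "exp 1"]
  show "\<forall>\<^sub>F u::real in at_top. norm (1 / u + u powr (z - 2) * ln u) \<le> 2 * norm (1 / u * ln u powr (2 * z))"
  proof eventually_elim
    case (elim u)
    have u1: "u > 1" using elim(1) exp_gt_one[of 1] by linarith
    have l: "ln u \<ge> 1" using elim(1) u1 by (simp add: ln_ge_iff)
    have l1: "1 \<le> ln u powr (2 * z)" using l z by (intro ge_one_powr_ge_zero) auto
    have l2: "u powr (z - 1) * ln u \<le> ln u powr (2 * z)"
    proof (cases "z \<ge> 1/2")
      case True
      have "u powr (z - 1) \<le> u powr 0" using u1 z by (intro powr_mono) auto
      hence "u powr (z - 1) * ln u \<le> 1 * ln u" using u1 l by (intro mult_right_mono) auto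
      also have "1 * ln u = ln u powr 1" using l by simp
      also have "\<dots> \<le> ln u powr (2 * z)" using l True by (intro powr_mono) auto
      finally show ?thesis .
    next
      case False
      have "u powr (z - 1) * ln u \<le> u powr (- 1/2) * u powr (1/2)"
        using u1 l False elim(2) by (intro mult_mono powr_mono) auto
      also have "\<dots> = 1" using u1 by (simp add: powr_add[symmetric])
      finally show ?thesis using l1 by linarith
    qed
    have "u powr (z - 2) = u powr (z - 1) * (1 / u)"
      using u1 powr_add[of u "z - 1" "-1"] by (simp add: powr_minus_divide)
    hence "1 / u + u powr (z - 2) * ln u = 1 / u * (1 + u powr (z - 1) * ln u)" by (simp add: algebra_simps)
    also have "\<dots> \<le> 1 / u * (2 * ln u powr (2 * z))" using l1 l2 u1 by (intro mult_left_mono) auto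
    finally show ?case using u1 l by (simp add: abs_mult)
  qed
qed

theorem theorem1:
  fixes k :: nat
  assumes "k \<ge> 2"
  shows "convergent_prod (on_primes (euler_factor k)) \<and>
    (\<lambda>x::real. (\<Sum>n | 1 \<le> n \<and> real n \<le> x. D_omega k n)
        - x * (ln x) powr (2 / real k - 1) / Gamma (2 / real k)
            * (\<Prod>p. on_primes (euler_factor k) p))
      \<in> O[at_top](\<lambda>x. x * (ln x) powr (-1) * (ln (ln x)) powr (4 / real k))"
proof
  show "convergent_prod (on_primes (euler_factor k))" by (rule euler_factor_prod(1)[OF assms])
  define z where "z = 2 / real k"
  have z: "0 < z" "z \<le> 1" using assms by (auto simp: z_def)
  define C where "C = exp (Re (log_corr k 1))"
  have k1: "k \<ge> 1" using assms by simp
  obtain M where M: "M \<ge> 0" "\<And>w. 0 < Re w \<Longrightarrow> Re w \<le> 1 \<Longrightarrow>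
     norm (D_transform'' k w - of_real (C * z * (z + 1)) * w powr of_real (- z - 2)) \<le> M * (1 + 1 / norm w ^ 2)"
    unfolding C_def z_def by (rule D_transform_bound[OF assms, unfolded polar_part_def]) blast
  let ?T = "\<lambda>v. D_sum k (exp v)"
  let ?q = "\<lambda>v. if v > 0 then complex_of_real (?T v * exp (- v)) else 0"
  have "(\<lambda>u. ?T u * exp (- u) - C / Gamma z * u powr (z - 1)) \<in> O(\<lambda>u. 1 / u + u powr (z - 2) * ln u)"
  proof (rule tauberian[where f="D_transform k" and f'="\<lambda>w. D_transform k w * log_deriv k (1 + w)" and f''="D_transform'' k" and M=M])
    show "mono ?T" by (rule mono_D_sum)
    show "0 \<le> ?T v" for v unfolding D_sum_def by (intro sum_nonneg D_omega_nonneg)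
    show "?T v \<le> (1 + v) * exp v" if "v \<ge> 0" for v
      using sum_D_omega_le[OF k1, of "exp v"] that by (simp add: D_sum_def mult.commute)
    show "laplaceable ?q"
      unfolding laplaceable_def
    proof (intro conjI allI impI)
      fix s :: real assume "s > 0"
      hence "integrable lborel (\<lambda>v. exp (- of_real s * of_real v) * ?q v)" by (intro laplace_D_sum(1)[OF k1]) simp
      thus "integrable lborel (\<lambda>v. exp (- complex_of_real (s * v)) * ?q v)" by simp
    qed auto
    show "laplace ?q w = D_transform k w" if "Re w > 0" for w
      unfolding laplace_def by (rule laplace_D_sum(2)[OF k1 that])
  qed (use z M D_transform_derivs[OF assms] in \<open>auto simp: C_def\<close>)
  from landau_o.big_trans[OF this error_term_bigo[OF z]]
  have "(\<lambda>u. ?T u * exp (- u) - C / Gamma z * u powr (z - 1)) \<in> O(\<lambda>u. 1 / u * ln u powr (2 * z))" .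
  \<comment> \<open>With u = ln x, multiplication by x undoes exp(-u), and 2 z = 4 / k is the
    exponent of the iterated logarithm.\<close>
  from landau_o.big.compose[OF this ln_at_top]
  have "(\<lambda>x. ?T (ln x) * exp (- ln x) - C / Gamma z * ln x powr (z - 1)) \<in> O(\<lambda>x. 1 / ln x * ln (ln x) powr (2 * z))" .
  hence 1: "(\<lambda>x. x * (?T (ln x) * exp (- ln x) - C / Gamma z * ln x powr (z - 1))) \<in> O(\<lambda>x. x * (1 / ln x * ln (ln x) powr (2 * z)))"
    by (intro landau_o.big.mult_left)
  have 2: "\<forall>\<^sub>F x in at_top. x * (?T (ln x) * exp (- ln x) - C / Gamma z * ln x powr (z - 1))
     = (\<Sum>n | 1 \<le> n \<and> real n \<le> x. D_omega k n) - x * (ln x) powr (2 / real k - 1) / Gamma (2 / real k) * (\<Prod>p. on_primes (euler_factor k) p)"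
    using eventually_gt_at_top[of 0]
  proof eventually_elim
    case (elim x)
    thus ?case unfolding euler_factor_prod(2)[OF assms] C_def[symmetric] z_def[symmetric]
      by (simp add: D_sum_def exp_minus right_diff_distrib field_simps)
  qed
  have 3: "\<forall>\<^sub>F x in at_top. x * (1 / ln x * ln (ln x) powr (2 * z)) = x * (ln x) powr (-1) * (ln (ln x)) powr (4 / real k)"
    using eventually_gt_at_top[of "1::real"]
  proof eventually_elim
    case (elim x)
    thus ?case by (simp add: z_def powr_minus_divide)
  qed
  show "(\<lambda>x::real. (\<Sum>n | 1 \<le> n \<and> real n \<le> x. D_omega k n)
        - x * (ln x) powr (2 / real k - 1) / Gamma (2 / real k)
            * (\<Prod>p. on_primes (euler_factor k) p))
      \<in> O[at_top](\<lambda>x. x * (ln x) powr (-1) * (ln (ln x)) powr (4 / real k))"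
    using iffD1[OF landau_o.big.in_cong[OF 2] 1] unfolding landau_o.big.cong[OF 3] .
qed

end
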